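(* Let $A$ be an associative ring containing three pairwise orthogonal idempotents $e_1,e_2,e_3$ such that $Ae_iA=Ae_4A=A$ for $1\le i\le 3$, where $e_4=1-e_1-e_2-e_3$. Let $B$ be another associative ring, and let $\varphi:[A,A]\to[B,B]$ be an isomorphism of Lie rings. Let $u:\widehat{[A,A]}\to[A,A]$ be the universal central extension and let $\kappa:\widehat{[A,A]}\to\widehat{A\oplus A^{op}}$ be the canonical Lie homomorphism (defined in the context). Then there exists a unique homomorphism of associative rings $\chi:\widehat{A\oplus A^{op}}\to B$ such that $\chi\circ\kappa=\varphi\circ u$.
   Context: Rings are associative and not necessarily unital. For additive subgroups $X,Y$ of a ring, $XY$ is the additive subgroup generated by the products $xy$, and $[X,Y]$ is the additive subgroup generated by the commutators $[x,y]=xy-yx$, $x\in X$, $y\in Y$. $[A,A]$ is a Lie ring under the commutator. The ring $A$ is not assumed to contain $1$; $e_4$ lies in the unital hull $A+\mathbb{Z}\cdot 1$ (which is $A$ itself if $A$ is unital), and $Ae_4A$ is the additive subgroup of $A$ generated by the elements $ae_4b=ab-\sum_{i=1}^3 ae_ib$, $a,b\in A$. A Lie ring $L$ is perfect if $L=[L,L]$. For a perfect Lie ring $L$, a central extension of $L$ is a surjective homomorphism of Lie rings $\theta:L'\to L$ with $L'$ perfect and $\operatorname{Ker}\theta$ contained in the center of $L'$. There is a unique (up to isomorphism over $L$) universal central extension $u:\widehat L\to L$: for any central extension $\theta:L'\to L$ there is a homomorphism $\chi:\widehat L\to L'$ with $\theta\circ\chi=u$. For a ring $C$, $\operatorname{Ann}(C)=\{c\in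 C\mid cC=Cc=(0)\}$. If $C=CC$, an annihilator extension of $C$ is a surjective ring homomorphism $\psi:C'\to C$ with $C'=C'C'$ and $\operatorname{Ker}\psi\subseteq\operatorname{Ann}(C')$. There is a unique (up to isomorphism over $C$) universal annihilator extension $\omega:\widehat C\to C$: for any annihilator extension $\psi:C'\to C$ there is a ring homomorphism $\chi:\widehat C\to C'$ with $\psi\circ\chi=\omega$. If $C=CC$ and $[C,C]$ is perfect, then the Lie ring $[[\widehat C,\widehat C],[\widehat C,\widehat C]]$ is perfect and $\omega$ restricts to a central extension $[[\widehat C,\widehat C],[\widehat C,\widehat C]]\to[C,C]$; hence there is a Lie homomorphism $\gamma:\widehat{[C,C]}\to[[\widehat C,\widehat C],[\widehat C,\widehat C]]\subseteq\widehat C$ with $\omega\circ\gamma$ equal to the universal central extension map $\widehat{[C,C]}\to[C,C]$. $A^{op}$ is the opposite ring of $A$: the same additive group, elements written $a^{op}$, with $a^{op}b^{op}=(ba)^{op}$. Under the assumptions on $A$, the Lie rings $[A,A]$ and $[A\oplus A^{op},A\oplus A^{op}]$ are perfect and $A\oplus A^{op}$ equals its square. The embedding of perfect Lie rings $\theta:[A,A]\to[A\oplus A^{op},A\oplus A^{op}]$, $\theta(a)=a\oplus(-a^{op})$, lifts to a homomorphism $\xi:\widehat{[A,A]}\to\widehat{[A\oplus A^{op},A\oplus A^{op}]}$ of universal central extensions. The canonical Lie homomorphism is $\kappa=\gamma\circ\xi$, where $\gamma$ is taken for $C=A\oplus A^{op}$; it is the Lie homomorphism $\widehat{[A,A]}\to\widehat{A\oplus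 A^{op}}$ satisfying $\omega\circ\kappa=\theta\circ u$, where $\omega:\widehat{A\oplus A^{op}}\to A\oplus A^{op}$ is the universal annihilator extension. *)

theory Defs
  imports "HOL-Algebra.Generated_Groups" "HOL-Algebra.Chinese_Remainder"
begin

text \<open>
  Associative rings without unit and Lie rings are both carried by the record type \<open>ring\<close> of
  HOL-Algebra. In a Lie ring the field \<open>mult\<close> is the Lie bracket. The field \<open>one\<close> is never used:
  no axiom mentions it and homomorphisms need not respect it.
\<close>

locale nonassoc_ring = abelian_group R for R (structure) +
  assumes m_closed [intro, simp]: "\<lbrakk>x \<in> carrier R; y \<in> carrier R\<rbrakk> \<Longrightarrow> x \<otimes> y \<in> carrier R"
    and l_distr: "\<lbrakk>x \<in> carrier R; y \<in> carrier R; z \<in> carrier R\<rbrakk>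
      \<Longrightarrow> (x \<oplus> y) \<otimes> z = x \<otimes> z \<oplus> y \<otimes> z"
    and r_distr: "\<lbrakk>x \<in> carrier R; y \<in> carrier R; z \<in> carrier R\<rbrakk>
      \<Longrightarrow> z \<otimes> (x \<oplus> y) = z \<otimes> x \<oplus> z \<otimes> y"

locale assoc_ring = nonassoc_ring +
  assumes m_assoc: "\<lbrakk>x \<in> carrier R; y \<in> carrier R; z \<in> carrier R\<rbrakk>
    \<Longrightarrow> (x \<otimes> y) \<otimes> z = x \<otimes> (y \<otimes> z)"

locale lie_ring = nonassoc_ring +
  assumes alternating: "x \<in> carrier R \<Longrightarrow> x \<otimes> x = \<zero>"
    and jacobi: "\<lbrakk>x \<in> carrier R; y \<in> carrier R; z \<in> carrier R\<rbrakk>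
      \<Longrightarrow> x \<otimes> (y \<otimes> z) \<oplus> y \<otimes> (z \<otimes> x) \<oplus> z \<otimes> (x \<otimes> y) = \<zero>"

definition rng_hom :: "('a, 'm) ring_scheme \<Rightarrow> ('b, 'n) ring_scheme \<Rightarrow> ('a \<Rightarrow> 'b) set"
  where "rng_hom R S = hom R S \<inter> hom (add_monoid R) (add_monoid S)"

definition rng_iso :: "('a, 'm) ring_scheme \<Rightarrow> ('b, 'n) ring_scheme \<Rightarrow> ('a \<Rightarrow> 'b) set"
  where "rng_iso R S = {h \<in> rng_hom R S. bij_betw h (carrier R) (carrier S)}"

text \<open>
  The product \<open>ST\<close> of additive subgroups of a ring, respectively \<open>[S, T]\<close> in a Lie ring.
\<close>

definition span_prod :: "('a, 'm) ring_scheme \<Rightarrow> 'a set \<Rightarrow> 'a set \<Rightarrow> 'a set"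
  where "span_prod R S T = generate (add_monoid R) {x \<otimes>\<^bsub>R\<^esub> y | x y. x \<in> S \<and> y \<in> T}"

definition commutator_ring :: "('a, 'm) ring_scheme \<Rightarrow> ('a, 'm) ring_scheme"
  where "commutator_ring R = R\<lparr>mult := \<lambda>x y. x \<otimes>\<^bsub>R\<^esub> y \<ominus>\<^bsub>R\<^esub> y \<otimes>\<^bsub>R\<^esub> x\<rparr>"

text \<open>
  For a Lie ring \<open>L\<close>, \<open>derived_ring L\<close> is the Lie ring \<open>[L, L]\<close>. So the Lie ring \<open>[A, A]\<close> of an
  associative ring \<open>A\<close> is \<open>derived_ring (commutator_ring A)\<close>.
\<close>

definition derived_ring :: "('a, 'm) ring_scheme \<Rightarrow> ('a, 'm) ring_scheme"
  where "derived_ring L = L\<lparr>carrier := span_prod L (carrier L) (carrier L)\<rparr>"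

definition op_ring :: "('a, 'm) ring_scheme \<Rightarrow> ('a, 'm) ring_scheme"
  where "op_ring R = R\<lparr>mult := \<lambda>x y. y \<otimes>\<^bsub>R\<^esub> x\<rparr>"

abbreviation double_ring :: "('a, 'm) ring_scheme \<Rightarrow> ('a \<times> 'a) ring"
  where "double_ring R \<equiv> RDirProd R (op_ring R)"


section \<open>Central extensions of perfect Lie rings\<close>

definition perfect_lie_ring :: "('a, 'm) ring_scheme \<Rightarrow> bool"
  where "perfect_lie_ring L \<longleftrightarrow>
    lie_ring L \<and> span_prod L (carrier L) (carrier L) = carrier L"

definition lie_center :: "('a, 'm) ring_scheme \<Rightarrow> 'a set"
  where "lie_center L = {z \<in> carrier L. \<forall>x\<in>carrier L. z \<otimes>\<^bsub>L\<^esub> x = \<zero>\<^bsub>L\<^esub>}"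

definition central_extension ::
    "('b, 'n) ring_scheme \<Rightarrow> ('b \<Rightarrow> 'a) \<Rightarrow> ('a, 'm) ring_scheme \<Rightarrow> bool"
  where "central_extension L' \<theta> L \<longleftrightarrow>
    perfect_lie_ring L \<and> perfect_lie_ring L' \<and>
    \<theta> \<in> rng_hom L' L \<and> \<theta> ` carrier L' = carrier L \<and>
    a_kernel L' L \<theta> \<subseteq> lie_center L'"

text \<open>
  A formula of HOL cannot quantify over all types, so the extensions \<open>L'\<close> that are tested have their
  carriers in the type \<open>('a \<times> 'a) list\<close>. This loses nothing: in a central extension, a bracket is
  determined by the images of its factors in \<open>L\<close>, so up to isomorphism every central extension of
  \<open>L\<close> lives in this type. The lemma \<open>universal_central_extension_lift\<close> below derives the universal
  property for extensions of arbitrary type. The same applies to annihilator extensions.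
\<close>

definition universal_central_extension ::
    "('b, 'n) ring_scheme \<Rightarrow> ('b \<Rightarrow> 'a) \<Rightarrow> ('a, 'm) ring_scheme \<Rightarrow> bool"
  where "universal_central_extension U u L \<longleftrightarrow>
    central_extension U u L \<and>
    (\<forall>(L' :: ('a \<times> 'a) list ring) \<theta>. central_extension L' \<theta> L \<longrightarrow>
      (\<exists>\<chi>\<in>rng_hom U L'. \<forall>x\<in>carrier U. \<theta> (\<chi> x) = u x))"


section \<open>Annihilator extensions of idempotent rings\<close>

definition idempotent_ring :: "('a, 'm) ring_scheme \<Rightarrow> bool"
  where "idempotent_ring C \<longleftrightarrow>
    assoc_ring C \<and> span_prod C (carrier C) (carrier C) = carrier C"

definition annihilator :: "('a, 'm) ring_scheme \<Rightarrow> 'a set"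
  where "annihilator C =
    {c \<in> carrier C. \<forall>x\<in>carrier C. c \<otimes>\<^bsub>C\<^esub> x = \<zero>\<^bsub>C\<^esub> \<and> x \<otimes>\<^bsub>C\<^esub> c = \<zero>\<^bsub>C\<^esub>}"

definition annihilator_extension ::
    "('b, 'n) ring_scheme \<Rightarrow> ('b \<Rightarrow> 'a) \<Rightarrow> ('a, 'm) ring_scheme \<Rightarrow> bool"
  where "annihilator_extension C' \<psi> C \<longleftrightarrow>
    idempotent_ring C \<and> idempotent_ring C' \<and>
    \<psi> \<in> rng_hom C' C \<and> \<psi> ` carrier C' = carrier C \<and>
    a_kernel C' C \<psi> \<subseteq> annihilator C'"

definition universal_annihilator_extension ::
    "('b, 'n) ring_scheme \<Rightarrow> ('b \<Rightarrow> 'a) \<Rightarrow> ('a, 'm) ring_scheme \<Rightarrow> bool"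
  where "universal_annihilator_extension U \<omega> C \<longleftrightarrow>
    annihilator_extension U \<omega> C \<and>
    (\<forall>(C' :: ('a \<times> 'a) list ring) \<psi>. annihilator_extension C' \<psi> C \<longrightarrow>
      (\<exists>\<chi>\<in>rng_hom U C'. \<forall>x\<in>carrier U. \<psi> (\<chi> x) = \<omega> x))"


section \<open>The canonical Lie homomorphism\<close>

definition double_embedding :: "('a, 'm) ring_scheme \<Rightarrow> 'a \<Rightarrow> 'a \<times> 'a"
  where "double_embedding A a = (a, \<ominus>\<^bsub>A\<^esub> a)"

text \<open>
  Here \<open>C = A \<oplus> A\<^sup>o\<^sup>p\<close>, \<open>u : U \<rightarrow> [A, A]\<close> and \<open>v : V \<rightarrow> [C, C]\<close> are the universal central extensions
  and \<open>\<omega> : W \<rightarrow> C\<close> is the universal annihilator extension. The map \<open>\<xi>\<close> lifts the embedding of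
  \<open>[A, A]\<close> into \<open>[C, C]\<close>, and \<open>\<gamma>\<close> comes from the central extension
  \<open>[[W, W], [W, W]] \<rightarrow> [C, C]\<close> given by \<open>\<omega>\<close>.
\<close>

definition canonical_lie_hom ::
    "('a, 'm) ring_scheme \<Rightarrow> ('l, 'n) ring_scheme \<Rightarrow> ('l \<Rightarrow> 'a) \<Rightarrow>
     ('k, 'p) ring_scheme \<Rightarrow> ('k \<Rightarrow> 'a \<times> 'a) \<Rightarrow>
     ('c, 'q) ring_scheme \<Rightarrow> ('c \<Rightarrow> 'a \<times> 'a) \<Rightarrow> ('l \<Rightarrow> 'c) \<Rightarrow> bool"
  where "canonical_lie_hom A U u V v W \<omega> \<kappa> \<longleftrightarrow>
    (\<exists>\<xi> \<gamma>.
      \<xi> \<in> rng_hom U V \<and>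
      (\<forall>x\<in>carrier U. v (\<xi> x) = double_embedding A (u x)) \<and>
      \<gamma> \<in> rng_hom V (derived_ring (derived_ring (commutator_ring W))) \<and>
      (\<forall>y\<in>carrier V. \<omega> (\<gamma> y) = v y) \<and>
      (\<forall>x\<in>carrier U. \<kappa> x = \<gamma> (\<xi> x)))"


section \<open>Independence of the universal properties from the type of the extensions\<close>

lemma image_ring_simps:
  "carrier (image_ring f R) = f ` carrier R"
  "x \<otimes>\<^bsub>image_ring f R\<^esub> y =
    f (inv_into (carrier R) f x \<otimes>\<^bsub>R\<^esub> inv_into (carrier R) f y)"
  "x \<oplus>\<^bsub>image_ring f R\<^esub> y =
    f (inv_into (carrier R) f x \<oplus>\<^bsub>R\<^esub> inv_into (carrier R) f y)"
  "\<zero>\<^bsub>image_ring f R\<^esub> = f \<zero>\<^bsub>R\<^esub>"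
  by (simp_all add: image_ring_def image_group_def monoid.defs)

context nonassoc_ring
begin

lemma image_ring_nonassoc:
  assumes "inj_on f (carrier R)"
  shows "nonassoc_ring (image_ring f R)"
proof -
  have "abelian_group (image_ring f R)"
  proof (rule abelian_groupI)
    fix x assume "x \<in> carrier (image_ring f R)"
    then obtain a where a: "a \<in> carrier R" "x = f a"
      by (auto simp: image_ring_simps)
    then show "\<exists>y\<in>carrier (image_ring f R). y \<oplus>\<^bsub>image_ring f R\<^esub> x = \<zero>\<^bsub>image_ring f R\<^esub>"
      using assms l_neg[OF a(1)] by (auto simp: image_ring_simps intro!: bexI[of _ "\<ominus> a"])
  qed (use assms in \<open>auto simp: image_ring_simps a_ac\<close>)
  moreover have "nonassoc_ring_axioms (image_ring f R)"
    by standard (use assms in \<open>auto simp: image_ring_simps l_distr r_distr\<close>)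
  ultimately show ?thesis
    by (rule nonassoc_ring.intro)
qed

lemma image_ring_hom:
  assumes "inj_on f (carrier R)"
  shows "f \<in> rng_hom R (image_ring f R)"
  using assms by (auto simp: rng_hom_def hom_def image_ring_simps)

lemma image_ring_inv_hom:
  assumes "inj_on f (carrier R)"
  shows "inv_into (carrier R) f \<in> rng_hom (image_ring f R) R"
  using assms by (auto simp: rng_hom_def hom_def image_ring_simps)

lemma image_ring_span:
  assumes inj: "inj_on f (carrier R)" and span: "span_prod R (carrier R) (carrier R) = carrier R"
  shows "span_prod (image_ring f R) (carrier (image_ring f R)) (carrier (image_ring f R)) =
    carrier (image_ring f R)"
proof -
  interpret I: nonassoc_ring "image_ring f R"
    by (rule image_ring_nonassoc[OF inj])
  interpret h: group_hom "add_monoid R" "add_monoid (image_ring f R)" f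
    using image_ring_hom[OF inj] a_group I.a_group
    by (simp add: group_hom_def group_hom_axioms_def rng_hom_def)
  let ?P = "{x \<otimes> y | x y. x \<in> carrier R \<and> y \<in> carrier R}"
  have "{x \<otimes>\<^bsub>image_ring f R\<^esub> y | x y. x \<in> carrier (image_ring f R) \<and> y \<in> carrier (image_ring f R)}
      = f ` ?P"
  proof (intro equalityI subsetI)
    fix z assume "z \<in> f ` ?P"
    then obtain x y where xy: "x \<in> carrier R" "y \<in> carrier R" "z = f (x \<otimes> y)"
      by auto
    then have "z = f x \<otimes>\<^bsub>image_ring f R\<^esub> f y"
      using inj by (simp add: image_ring_simps)
    then show "z \<in> {x \<otimes>\<^bsub>image_ring f R\<^esub> y | x y.
        x \<in> carrier (image_ring f R) \<and> y \<in> carrier (image_ring f R)}"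
      using xy by (auto simp: image_ring_simps(1))
  next
    fix z assume "z \<in> {x \<otimes>\<^bsub>image_ring f R\<^esub> y | x y.
        x \<in> carrier (image_ring f R) \<and> y \<in> carrier (image_ring f R)}"
    then obtain x y where "x \<in> carrier R" "y \<in> carrier R" "z = f (x \<otimes> y)"
      using inj by (auto simp: image_ring_simps)
    then show "z \<in> f ` ?P"
      by blast
  qed
  moreover have "?P \<subseteq> carrier (add_monoid R)"
    by auto
  ultimately show ?thesis
    using h.generate_img[of ?P] span by (simp add: span_prod_def image_ring_simps(1))
qed

text \<open>A surjection onto \<open>R\<close> from the lists over \<open>P \<times> P\<close>: the sums of the products \<open>s p \<otimes> s q\<close>.\<close>

primrec list_eval :: "('c \<Rightarrow> 'a) \<Rightarrow> ('c \<times> 'c) list \<Rightarrow> 'a"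
  where "list_eval s [] = \<zero>"
  | "list_eval s (p # ps) = s (fst p) \<otimes> s (snd p) \<oplus> list_eval s ps"

lemma list_eval_closed:
  assumes "set ps \<subseteq> P \<times> P" and "s ` P \<subseteq> carrier R"
  shows "list_eval s ps \<in> carrier R"
  using assms by (induction ps) (auto intro!: a_closed m_closed)

lemma list_eval_append:
  assumes "set ps \<subseteq> P \<times> P" and "set qs \<subseteq> P \<times> P" and "s ` P \<subseteq> carrier R"
  shows "list_eval s (ps @ qs) = list_eval s ps \<oplus> list_eval s qs"
  using assms
proof (induction ps)
  case Nil
  then show ?case
    using list_eval_closed[of qs P s] by simp
next
  case (Cons p ps)
  then have "s (fst p) \<in> carrier R" "s (snd p) \<in> carrier R"
    by auto
  then show ?case
    using Cons list_eval_closed[of qs P s] list_eval_closed[of ps P s] by (auto simp: a_assoc)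
qed

lemma minus_mult:
  assumes "x \<in> carrier R" and "y \<in> carrier R"
  shows "\<ominus> (x \<otimes> y) = (\<ominus> x) \<otimes> y"
proof -
  have "\<zero> \<otimes> y \<oplus> \<zero> \<otimes> y = \<zero> \<otimes> y \<oplus> \<zero>"
    using assms l_distr[of \<zero> \<zero> y] by simp
  then have "\<zero> \<otimes> y = \<zero>"
    using assms add.l_cancel_one[of "\<zero> \<otimes> y" "\<zero> \<otimes> y"] by simp
  then have "(\<ominus> x) \<otimes> y \<oplus> x \<otimes> y = \<zero>"
    using assms l_distr[of "\<ominus> x" x y] by (simp add: l_neg)
  then show ?thesis
    using assms by (simp add: minus_equality)
qed

lemma exists_inj_into_list:
  fixes \<theta> :: "'a \<Rightarrow> 'c"
  assumes span: "span_prod R (carrier R) (carrier R) = carrier R"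
    and det: "\<And>x y x' y'. \<lbrakk>x \<in> carrier R; y \<in> carrier R; x' \<in> carrier R; y' \<in> carrier R;
      \<theta> x = \<theta> x'; \<theta> y = \<theta> y'\<rbrakk> \<Longrightarrow> x \<otimes> y = x' \<otimes> y'"
  shows "\<exists>f :: 'a \<Rightarrow> ('c \<times> 'c) list. inj_on f (carrier R)"
proof -
  define s where "s = inv_into (carrier R) \<theta>"
  define P where "P = \<theta> ` carrier R"
  have s: "s (\<theta> x) \<in> carrier R" "\<theta> (s (\<theta> x)) = \<theta> x" if "x \<in> carrier R" for x
    using that unfolding s_def by (auto simp: inv_into_into f_inv_into_f)
  then have sP: "s ` P \<subseteq> carrier R"
    by (auto simp: P_def)
  have prod: "x \<otimes> y \<in> list_eval s ` lists (P \<times> P)" if "x \<in> carrier R" "y \<in> carrier R" for x y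
  proof (rule image_eqI)
    show "x \<otimes> y = list_eval s [(\<theta> x, \<theta> y)]"
      using that s by (simp add: det[of x y "s (\<theta> x)" "s (\<theta> y)"])
  qed (use that in \<open>auto simp: P_def\<close>)
  have "z \<in> list_eval s ` lists (P \<times> P)"
    if "z \<in> generate (add_monoid R) {x \<otimes> y | x y. x \<in> carrier R \<and> y \<in> carrier R}" for z
    using that
  proof (induction rule: generate.induct)
    case one
    show ?case
      by (rule image_eqI[of _ _ "[]"]) auto
  next
    case (incl h)
    then show ?case
      using prod by auto
  next
    case (inv h)
    then show ?case
      using prod[of "\<ominus> _"] minus_mult by (auto simp flip: a_inv_def)
  next
    case (eng h1 h2)
    then obtain ps qs where "ps \<in> lists (P \<times> P)" "h1 = list_eval s ps"
      "qs \<in> lists (P \<times> P)" "h2 = list_eval s qs"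
      by blast
    then show ?case
      using list_eval_append[of ps P qs s] sP
      by (intro image_eqI[of _ _ "ps @ qs"]) (auto simp: lists_eq_set)
  qed
  then have sub: "carrier R \<subseteq> list_eval s ` lists (P \<times> P)"
    using span by (auto simp: span_prod_def)
  show ?thesis
    using inj_on_inv_into[OF sub] by blast
qed

end

lemma rng_hom_comp:
  assumes "f \<in> rng_hom R S" and "g \<in> rng_hom S T"
  shows "(\<lambda>x. g (f x)) \<in> rng_hom R T"
  using assms unfolding rng_hom_def hom_def by (auto simp: Pi_iff)

lemma rng_hom_kernel_diff:
  assumes "abelian_group R" and "abelian_group S" and "h \<in> rng_hom R S"
    and "x \<in> carrier R" and "y \<in> carrier R" and "h x = h y"
  shows "x \<ominus>\<^bsub>R\<^esub> y \<in> a_kernel R S h"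
proof -
  interpret R: abelian_group R by fact
  interpret S: abelian_group S by fact
  interpret h: group_hom "add_monoid R" "add_monoid S" h
    using assms R.a_group S.a_group
    by (simp add: group_hom_def group_hom_axioms_def rng_hom_def)
  show ?thesis
    using assms(4-6) h.hom_mult[of x "\<ominus>\<^bsub>R\<^esub> y"] h.hom_inv[of y] h.hom_closed[of y]
    by (simp add: a_kernel_def' R.minus_eq S.r_neg flip: a_inv_def)
qed

lemma image_ring_kernel:
  assumes "inj_on f (carrier R)" and "z \<in> a_kernel (image_ring f R) S (\<lambda>x. h (inv_into (carrier R) f x))"
  obtains a where "a \<in> a_kernel R S h" and "z = f a"
  using assms by (auto simp: a_kernel_def' image_ring_simps)

lemma central_extension_image_ring:
  assumes ext: "central_extension L' \<theta> L" and inj: "inj_on f (carrier L')"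
  shows "central_extension (image_ring f L') (\<lambda>x. \<theta> (inv_into (carrier L') f x)) L"
proof -
  interpret L': lie_ring L'
    using ext by (simp add: central_extension_def perfect_lie_ring_def)
  have hom: "\<theta> \<in> rng_hom L' L" and sur: "\<theta> ` carrier L' = carrier L"
    and ker: "a_kernel L' L \<theta> \<subseteq> lie_center L'"
    using ext by (auto simp: central_extension_def)
  have "lie_ring_axioms (image_ring f L')"
    by standard (use inj in \<open>auto simp: image_ring_simps L'.alternating L'.jacobi\<close>)
  then have "perfect_lie_ring (image_ring f L')"
    using L'.image_ring_nonassoc[OF inj] L'.image_ring_span[OF inj] ext
    by (auto simp: perfect_lie_ring_def central_extension_def lie_ring_def)
  moreover have "a_kernel (image_ring f L') L (\<lambda>x. \<theta> (inv_into (carrier L') f x))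
      \<subseteq> lie_center (image_ring f L')"
  proof
    fix z assume "z \<in> a_kernel (image_ring f L') L (\<lambda>x. \<theta> (inv_into (carrier L') f x))"
    then obtain a where "a \<in> a_kernel L' L \<theta>" "z = f a"
      by (rule image_ring_kernel[OF inj])
    then show "z \<in> lie_center (image_ring f L')"
      using ker inj by (auto simp: lie_center_def image_ring_simps)
  qed
  moreover have "(\<lambda>x. \<theta> (inv_into (carrier L') f x)) ` carrier (image_ring f L') = carrier L"
    using sur inj by (simp add: image_ring_simps image_image)
  ultimately show ?thesis
    using ext rng_hom_comp[OF L'.image_ring_inv_hom[OF inj] hom]
    by (simp add: central_extension_def)
qed

theorem universal_central_extension_lift:
  fixes U :: "('b, 'n) ring_scheme" and L :: "('a, 'm) ring_scheme"
    and L' :: "('c, 'p) ring_scheme"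
  assumes univ: "universal_central_extension U u L" and ext: "central_extension L' \<theta> L"
  shows "\<exists>\<chi>\<in>rng_hom U L'. \<forall>x\<in>carrier U. \<theta> (\<chi> x) = u x"
proof -
  interpret L': lie_ring L'
    using ext by (simp add: central_extension_def perfect_lie_ring_def)
  interpret L: lie_ring L
    using ext by (simp add: central_extension_def perfect_lie_ring_def)
  have hom: "\<theta> \<in> rng_hom L' L" and ker: "a_kernel L' L \<theta> \<subseteq> lie_center L'"
    and span: "span_prod L' (carrier L') (carrier L') = carrier L'"
    using ext by (auto simp: central_extension_def perfect_lie_ring_def)
  have left: "x \<otimes>\<^bsub>L'\<^esub> y = x' \<otimes>\<^bsub>L'\<^esub> y"
    if c: "x \<in> carrier L'" "x' \<in> carrier L'" "y \<in> carrier L'" and "\<theta> x = \<theta> x'" for x x' y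
  proof -
    have "x \<ominus>\<^bsub>L'\<^esub> x' \<in> lie_center L'"
      using rng_hom_kernel_diff[OF L'.abelian_group_axioms L.abelian_group_axioms hom] that ker
      by blast
    then have "(x \<ominus>\<^bsub>L'\<^esub> x') \<otimes>\<^bsub>L'\<^esub> y = \<zero>\<^bsub>L'\<^esub>"
      using c by (simp add: lie_center_def)
    then have "x \<otimes>\<^bsub>L'\<^esub> y \<ominus>\<^bsub>L'\<^esub> x' \<otimes>\<^bsub>L'\<^esub> y = \<zero>\<^bsub>L'\<^esub>"
      using c by (simp add: L'.minus_eq L'.l_distr L'.minus_mult)
    then show ?thesis
      using c L'.minus_equality[of "x \<otimes>\<^bsub>L'\<^esub> y" "\<ominus>\<^bsub>L'\<^esub> (x' \<otimes>\<^bsub>L'\<^esub> y)"]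
      by (simp add: L'.minus_eq)
  qed
  have anti: "x \<otimes>\<^bsub>L'\<^esub> y = \<ominus>\<^bsub>L'\<^esub> (y \<otimes>\<^bsub>L'\<^esub> x)" if c: "x \<in> carrier L'" "y \<in> carrier L'" for x y
  proof -
    have "x \<otimes>\<^bsub>L'\<^esub> y \<oplus>\<^bsub>L'\<^esub> y \<otimes>\<^bsub>L'\<^esub> x = \<zero>\<^bsub>L'\<^esub>"
      using c L'.alternating[of "x \<oplus>\<^bsub>L'\<^esub> y"]
      by (simp add: L'.l_distr L'.r_distr L'.alternating[OF c(1)] L'.alternating[OF c(2)] L'.a_comm)
    then show ?thesis
      using c by (simp add: L'.minus_equality)
  qed
  obtain f :: "'c \<Rightarrow> ('a \<times> 'a) list" where inj: "inj_on f (carrier L')"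
    using L'.exists_inj_into_list[OF span, of \<theta>] left anti by metis
  obtain \<chi> where "\<chi> \<in> rng_hom U (image_ring f L')"
    and "\<forall>x\<in>carrier U. \<theta> (inv_into (carrier L') f (\<chi> x)) = u x"
    using univ central_extension_image_ring[OF ext inj]
    unfolding universal_central_extension_def by blast
  then show ?thesis
    using rng_hom_comp[OF _ L'.image_ring_inv_hom[OF inj]]
    by (intro bexI[of _ "\<lambda>x. inv_into (carrier L') f (\<chi> x)"])
qed

lemma annihilator_extension_image_ring:
  assumes ext: "annihilator_extension C' \<psi> C" and inj: "inj_on f (carrier C')"
  shows "annihilator_extension (image_ring f C') (\<lambda>x. \<psi> (inv_into (carrier C') f x)) C"
proof -
  interpret C': assoc_ring C'
    using ext by (simp add: annihilator_extension_def idempotent_ring_def)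
  have hom: "\<psi> \<in> rng_hom C' C" and sur: "\<psi> ` carrier C' = carrier C"
    and ker: "a_kernel C' C \<psi> \<subseteq> annihilator C'"
    using ext by (auto simp: annihilator_extension_def)
  have "assoc_ring_axioms (image_ring f C')"
    by standard (use inj in \<open>auto simp: image_ring_simps C'.m_assoc\<close>)
  then have "idempotent_ring (image_ring f C')"
    using C'.image_ring_nonassoc[OF inj] C'.image_ring_span[OF inj] ext
    by (auto simp: idempotent_ring_def annihilator_extension_def assoc_ring_def)
  moreover have "a_kernel (image_ring f C') C (\<lambda>x. \<psi> (inv_into (carrier C') f x))
      \<subseteq> annihilator (image_ring f C')"
  proof
    fix z assume "z \<in> a_kernel (image_ring f C') C (\<lambda>x. \<psi> (inv_into (carrier C') f x))"
    then obtain a where "a \<in> a_kernel C' C \<psi>" "z = f a"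
      by (rule image_ring_kernel[OF inj])
    then show "z \<in> annihilator (image_ring f C')"
      using ker inj by (auto simp: annihilator_def image_ring_simps)
  qed
  moreover have "(\<lambda>x. \<psi> (inv_into (carrier C') f x)) ` carrier (image_ring f C') = carrier C"
    using sur inj by (simp add: image_ring_simps image_image)
  ultimately show ?thesis
    using ext rng_hom_comp[OF C'.image_ring_inv_hom[OF inj] hom]
    by (simp add: annihilator_extension_def)
qed

theorem universal_annihilator_extension_lift:
  fixes U :: "('b, 'n) ring_scheme" and C :: "('a, 'm) ring_scheme"
    and C' :: "('c, 'p) ring_scheme"
  assumes univ: "universal_annihilator_extension U \<omega> C" and ext: "annihilator_extension C' \<psi> C"
  shows "\<exists>\<chi>\<in>rng_hom U C'. \<forall>x\<in>carrier U. \<psi> (\<chi> x) = \<omega> x"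
proof -
  interpret C': assoc_ring C'
    using ext by (simp add: annihilator_extension_def idempotent_ring_def)
  interpret C: assoc_ring C
    using ext by (simp add: annihilator_extension_def idempotent_ring_def)
  have hom: "\<psi> \<in> rng_hom C' C" and ker: "a_kernel C' C \<psi> \<subseteq> annihilator C'"
    and span: "span_prod C' (carrier C') (carrier C') = carrier C'"
    using ext by (auto simp: annihilator_extension_def idempotent_ring_def)
  have diff: "x \<ominus>\<^bsub>C'\<^esub> x' \<in> annihilator C'"
    if "x \<in> carrier C'" "x' \<in> carrier C'" "\<psi> x = \<psi> x'" for x x'
    using rng_hom_kernel_diff[OF C'.abelian_group_axioms C.abelian_group_axioms hom] that ker
    by blast
  have det: "x \<otimes>\<^bsub>C'\<^esub> y = x' \<otimes>\<^bsub>C'\<^esub> y'"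
    if c: "x \<in> carrier C'" "y \<in> carrier C'" "x' \<in> carrier C'" "y' \<in> carrier C'"
      and e: "\<psi> x = \<psi> x'" "\<psi> y = \<psi> y'" for x y x' y'
  proof -
    have split: "a = (a \<ominus>\<^bsub>C'\<^esub> b) \<oplus>\<^bsub>C'\<^esub> b" if "a \<in> carrier C'" "b \<in> carrier C'" for a b
      using that by (simp add: C'.minus_eq C'.a_assoc C'.l_neg)
    have "x \<otimes>\<^bsub>C'\<^esub> y = ((x \<ominus>\<^bsub>C'\<^esub> x') \<oplus>\<^bsub>C'\<^esub> x') \<otimes>\<^bsub>C'\<^esub> y"
      using split[OF c(1,3)] by simp
    also have "\<dots> = x' \<otimes>\<^bsub>C'\<^esub> y"
      using c diff[of x x'] e by (simp add: C'.l_distr annihilator_def)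
    also have "\<dots> = x' \<otimes>\<^bsub>C'\<^esub> ((y \<ominus>\<^bsub>C'\<^esub> y') \<oplus>\<^bsub>C'\<^esub> y')"
      using split[OF c(2,4)] by simp
    also have "\<dots> = x' \<otimes>\<^bsub>C'\<^esub> y'"
      using c diff[of y y'] e by (simp add: C'.r_distr annihilator_def)
    finally show ?thesis .
  qed
  obtain f :: "'c \<Rightarrow> ('a \<times> 'a) list" where inj: "inj_on f (carrier C')"
    using C'.exists_inj_into_list[OF span, of \<psi>] det by metis
  obtain \<chi> where "\<chi> \<in> rng_hom U (image_ring f C')"
    and "\<forall>x\<in>carrier U. \<psi> (inv_into (carrier C') f (\<chi> x)) = \<omega> x"
    using univ annihilator_extension_image_ring[OF ext inj]
    unfolding universal_annihilator_extension_def by blast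
  then show ?thesis
    using rng_hom_comp[OF _ C'.image_ring_inv_hom[OF inj]]
    by (intro bexI[of _ "\<lambda>x. inv_into (carrier C') f (\<chi> x)"])
qed

end

theory Submission
  imports Defs
begin

text \<open>
  Let \<open>A\<^sub>i\<^sub>j = e\<^sub>iAe\<^sub>j\<close> be the Peirce components for the four idempotents, the last one being only formal,
  and regard \<open>f = \<phi>\<close> as a map from \<open>[A, A]\<close> to \<open>B\<close>. The image \<open>[B, B]\<close> of \<open>f\<close> is a Lie ideal of \<open>B\<close>, so
  every element of \<open>B\<close> acts on \<open>[A, A]\<close> as a derivation, and derivations of \<open>[A, A]\<close> are rigid: for
  \<open>i \<noteq> j\<close> they map \<open>A\<^sub>i\<^sub>j\<close> into the union of row \<open>i\<close> and column \<open>j\<close> (\<open>der_entry\<close>). Let \<open>i, k, j, m\<close> be four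
  indices, \<open>x \<in> A\<^sub>i\<^sub>k\<close> and \<open>y \<in> A\<^sub>k\<^sub>j\<close>. Factors that commute can be moved into brackets, and this shows that
  \<open>f x \<cdot> f y\<close> belongs to \<open>[B, f A\<^sub>m\<^sub>j]\<close>, to \<open>[B, f A\<^sub>i\<^sub>j]\<close> and to \<open>[f A\<^sub>i\<^sub>m, B]\<close>. The three hooks that support these
  sets have only the place \<open>(i, j)\<close> in common, so \<open>f A\<^sub>i\<^sub>k \<cdot> f A\<^sub>k\<^sub>j \<subseteq> f A\<^sub>i\<^sub>j\<close> (\<open>f_mult_in_comp\<close>). It follows that
  \<open>f A\<^sub>i\<^sub>j \<cdot> f A\<^sub>p\<^sub>q = 0\<close> unless \<open>j = p\<close> or \<open>i = q\<close> (\<open>f_mult_zero\<close>). The argument is free of division, and so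
  it is insensitive to torsion in \<open>A\<close>.

  For \<open>x \<in> A\<^sub>i\<^sub>k\<close> and \<open>y \<in> A\<^sub>k\<^sub>j\<close> the identity \<open>f (xy) = f x \<cdot> f y - f y \<cdot> f x\<close> now splits \<open>f\<close> into an associative and
  an antiassociative part. The pairs \<open>(xy, f x \<cdot> f y)\<close> span the graph of a well defined additive map
  \<open>A\<^sub>i\<^sub>j \<rightarrow> B\<close> (\<open>graph_inj\<close>), and these graphs multiply like the components themselves (\<open>graph_mult\<close>,
  \<open>graph_mult_zero\<close>). In \<open>A \<times> B\<close> they generate a ring, the cover of \<open>A\<close>, in which the values over the
  diagonal components are determined only up to annihilators: the projection from the cover to \<open>A\<close> is an
  annihilator extension (\<open>annihilator_extension_Cover\<close>). The same construction for \<open>A\<^sup>o\<^sup>p\<close> and \<open>-f\<close> covers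
  the antiassociative part. The values of the two covers in \<open>B\<close> annihilate each other
  (\<open>cover_orthogonal\<close>), so the sum of the values is a ring homomorphism from the product of the covers to
  \<open>B\<close>, and this product is an annihilator extension of \<open>A \<oplus> A\<^sup>o\<^sup>p\<close>. The universal property of \<open>W\<close> yields \<open>\<chi>\<close>.

  The equation \<open>\<chi> \<circ> \<kappa> = \<phi> \<circ> u\<close> has to be checked on brackets only, because \<open>U\<close> is perfect. There it holds because
  two elements of an annihilator extension with the same image have the same products. Uniqueness holds
  because the elements \<open>(a, -a)\<close> generate the ring \<open>A \<oplus> A\<^sup>o\<^sup>p\<close> and because \<open>W = WW\<close>.
\<close>

section \<open>Rings without unit\<close>

definition span :: "('a, 'm) ring_scheme \<Rightarrow> 'a set \<Rightarrow> 'a set"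
  where "span R S = generate (add_monoid R) S"

lemma span_prod_eq_span: "span_prod R S T = span R {x \<otimes>\<^bsub>R\<^esub> y | x y. x \<in> S \<and> y \<in> T}"
  by (simp add: span_prod_def span_def)

definition bracket :: "('a, 'm) ring_scheme \<Rightarrow> 'a \<Rightarrow> 'a \<Rightarrow> 'a"
  where "bracket R x y = x \<otimes>\<^bsub>R\<^esub> y \<ominus>\<^bsub>R\<^esub> y \<otimes>\<^bsub>R\<^esub> x"

context abelian_group
begin

lemma neg_zero: "\<ominus> \<zero> = \<zero>"
  using add.inv_one by (simp add: a_inv_def)

lemma span_closed: "S \<subseteq> carrier G \<Longrightarrow> x \<in> span G S \<Longrightarrow> x \<in> carrier G"
  using add.generate_in_carrier[of S x] by (simp add: span_def)

lemma span_base: "x \<in> S \<Longrightarrow> x \<in> span G S"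
  unfolding span_def by (rule generate.incl)

lemma span_zero: "\<zero> \<in> span G S"
  using generate.one[of "add_monoid G" S] by (simp add: span_def)

lemma span_add: "x \<in> span G S \<Longrightarrow> y \<in> span G S \<Longrightarrow> x \<oplus> y \<in> span G S"
  using generate.eng[of x "add_monoid G" S y] by (simp add: span_def)

lemma span_neg: "S \<subseteq> carrier G \<Longrightarrow> x \<in> span G S \<Longrightarrow> \<ominus> x \<in> span G S"
  using add.generate_m_inv_closed[of S x] by (simp add: span_def)

lemma span_mono: "S \<subseteq> T \<Longrightarrow> span G S \<subseteq> span G T"
  using add.mono_generate[of S T] by (simp add: span_def)

lemma span_induct [consumes 2, case_names zero base neg add]:
  assumes "x \<in> span G S" and "S \<subseteq> carrier G" and "P \<zero>" and "\<And>x. x \<in> S \<Longrightarrow> P x"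
    and "\<And>x. x \<in> carrier G \<Longrightarrow> P x \<Longrightarrow> P (\<ominus> x)"
    and "\<And>x y. x \<in> carrier G \<Longrightarrow> y \<in> carrier G \<Longrightarrow> P x \<Longrightarrow> P y \<Longrightarrow> P (x \<oplus> y)"
  shows "P x"
proof -
  have "x \<in> carrier G \<and> P x"
    using assms(1) unfolding span_def
  proof (induction rule: generate.induct)
    case one
    then show ?case using assms(3) by simp
  next
    case (incl h)
    then show ?case using assms(2,4) by auto
  next
    case (inv h)
    then show ?case using assms(2,4,5) by (auto simp flip: a_inv_def)
  next
    case (eng h1 h2)
    then show ?case using assms(6) by simp
  qed
  then show ?thesis ..
qed

lemma span_subset:
  assumes "S \<subseteq> carrier G" and "S \<subseteq> span G T" and "T \<subseteq> carrier G"
  shows "span G S \<subseteq> span G T"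
proof
  fix x assume "x \<in> span G S"
  then show "x \<in> span G T"
    using assms(1)
    by (induction rule: span_induct) (use assms in \<open>auto simp: span_zero span_add span_neg\<close>)
qed

lemma span_empty: "x \<in> span G {} \<Longrightarrow> x = \<zero>"
  using span_induct[of x "{}" "\<lambda>x. x = \<zero>"] by (auto simp: neg_zero)

lemma finsum_in_span:
  assumes "S \<subseteq> carrier G" and "finite I" and "\<And>i. i \<in> I \<Longrightarrow> g i \<in> span G S"
  shows "(\<Oplus>i\<in>I. g i) \<in> span G S"
  using assms(2,3)
proof (induction rule: finite_induct)
  case empty
  then show ?case by (simp add: span_zero)
next
  case (insert i I)
  then have "g \<in> I \<rightarrow> carrier G" "g i \<in> carrier G"
    using span_closed[OF assms(1)] by auto
  then show ?case
    using insert by (simp add: span_add)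
qed

lemma finsum_single:
  assumes "finite I" and "i \<in> I" and "\<And>j. j \<in> I \<Longrightarrow> g j \<in> carrier G"
    and "\<And>j. j \<in> I \<Longrightarrow> j \<noteq> i \<Longrightarrow> g j = \<zero>"
  shows "(\<Oplus>j\<in>I. g j) = g i"
proof -
  have "(\<Oplus>j\<in>I. g j) = (\<Oplus>j\<in>I. if i = j then g j else \<zero>)"
    using assms by (intro finsum_cong') auto
  also have "\<dots> = g i"
    using assms by (intro finsum_singleton) auto
  finally show ?thesis .
qed

lemma zero_of_double: "x \<in> carrier G \<Longrightarrow> x \<oplus> x = x \<Longrightarrow> x = \<zero>"
  using add.l_cancel_one[of x x] by simp

lemma minus_eq_zeroD: "x \<in> carrier G \<Longrightarrow> y \<in> carrier G \<Longrightarrow> x \<ominus> y = \<zero> \<Longrightarrow> x = y"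
  using minus_equality[of x "\<ominus> y"] by (simp add: minus_eq)

lemma minus_zero [simp]: "x \<in> carrier G \<Longrightarrow> x \<ominus> \<zero> = x"
  by (simp add: minus_eq neg_zero)

lemma zero_minus [simp]: "x \<in> carrier G \<Longrightarrow> \<zero> \<ominus> x = \<ominus> x"
  by (simp add: minus_eq)

lemma minus_self: "x \<in> carrier G \<Longrightarrow> x \<ominus> x = \<zero>"
  by (simp add: minus_eq r_neg)

lemma minus_cancel: "x \<in> carrier G \<Longrightarrow> y \<in> carrier G \<Longrightarrow> x \<ominus> y \<oplus> y = x"
  by (simp add: minus_eq a_assoc l_neg)

lemma minus_swap: "x \<in> carrier G \<Longrightarrow> y \<in> carrier G \<Longrightarrow> \<ominus> (x \<ominus> y) = y \<ominus> x"
  by (simp add: minus_eq minus_add a_comm)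

lemma add_minus_add:
  "\<lbrakk>x \<in> carrier G; y \<in> carrier G; z \<in> carrier G; w \<in> carrier G\<rbrakk> \<Longrightarrow>
    (x \<oplus> y) \<ominus> (z \<oplus> w) = (x \<ominus> z) \<oplus> (y \<ominus> w)"
  by (simp add: minus_eq minus_add a_ac)

lemma minus_telescope:
  "\<lbrakk>x \<in> carrier G; y \<in> carrier G; z \<in> carrier G\<rbrakk> \<Longrightarrow> (x \<ominus> y) \<oplus> (y \<ominus> z) = x \<ominus> z"
proof -
  assume c: "x \<in> carrier G" "y \<in> carrier G" "z \<in> carrier G"
  then have "(x \<ominus> y) \<oplus> (y \<ominus> z) = ((x \<ominus> y) \<oplus> y) \<ominus> z"
    by (simp add: minus_eq a_assoc)
  then show ?thesis
    using c by (simp add: minus_cancel)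
qed

end

text \<open>
  Inclusions between spans are inherited along additive maps. Multiplications and brackets with a fixed
  element are the maps for which this is used.
\<close>

lemma span_hom:
  assumes R: "abelian_group R" and Q: "abelian_group Q" and S: "S \<subseteq> carrier R" and T: "T \<subseteq> carrier Q"
    and closed: "\<And>x. x \<in> carrier R \<Longrightarrow> h x \<in> carrier Q"
    and add: "\<And>x y. x \<in> carrier R \<Longrightarrow> y \<in> carrier R \<Longrightarrow> h (x \<oplus>\<^bsub>R\<^esub> y) = h x \<oplus>\<^bsub>Q\<^esub> h y"
    and base: "\<And>x. x \<in> S \<Longrightarrow> h x \<in> span Q T" and x: "x \<in> span R S"
  shows "h x \<in> span Q T"
proof -
  interpret R: abelian_group R by fact
  interpret Q: abelian_group Q by fact
  have zero: "h \<zero>\<^bsub>R\<^esub> = \<zero>\<^bsub>Q\<^esub>"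
    using add[of "\<zero>\<^bsub>R\<^esub>" "\<zero>\<^bsub>R\<^esub>"] closed by (intro Q.zero_of_double) auto
  have neg: "h (\<ominus>\<^bsub>R\<^esub> y) = \<ominus>\<^bsub>Q\<^esub> h y" if "y \<in> carrier R" for y
    using add[of "\<ominus>\<^bsub>R\<^esub> y" y] closed zero that
    by (intro Q.minus_equality[symmetric]) (auto simp: R.l_neg)
  show ?thesis
    using x S
    by (induction rule: R.span_induct) (auto simp: zero neg add base Q.span_zero Q.span_neg[OF T] Q.span_add)
qed

context nonassoc_ring
begin

lemma l_null [simp]: "x \<in> carrier R \<Longrightarrow> \<zero> \<otimes> x = \<zero>"
  using l_distr[of \<zero> \<zero> x] by (intro zero_of_double) auto

lemma r_null [simp]: "x \<in> carrier R \<Longrightarrow> x \<otimes> \<zero> = \<zero>"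
  using r_distr[of \<zero> \<zero> x] by (intro zero_of_double) auto

lemma l_minus: "x \<in> carrier R \<Longrightarrow> y \<in> carrier R \<Longrightarrow> (\<ominus> x) \<otimes> y = \<ominus> (x \<otimes> y)"
  by (simp add: minus_mult)

lemma r_minus: "x \<in> carrier R \<Longrightarrow> y \<in> carrier R \<Longrightarrow> x \<otimes> (\<ominus> y) = \<ominus> (x \<otimes> y)"
  using r_distr[of "\<ominus> y" y x] minus_equality[of "x \<otimes> \<ominus> y" "x \<otimes> y"] by (simp add: l_neg)

lemma l_diff: "\<lbrakk>x \<in> carrier R; y \<in> carrier R; z \<in> carrier R\<rbrakk> \<Longrightarrow> (x \<ominus> y) \<otimes> z = x \<otimes> z \<ominus> y \<otimes> z"
  by (simp add: minus_eq l_distr l_minus)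

lemma r_diff: "\<lbrakk>x \<in> carrier R; y \<in> carrier R; z \<in> carrier R\<rbrakk> \<Longrightarrow> z \<otimes> (x \<ominus> y) = z \<otimes> x \<ominus> z \<otimes> y"
  by (simp add: minus_eq r_distr r_minus)

lemma span_mult_right:
  "\<lbrakk>x \<in> span R S; S \<subseteq> carrier R; T \<subseteq> carrier R; w \<in> carrier R; \<And>s. s \<in> S \<Longrightarrow> s \<otimes> w \<in> span R T\<rbrakk> \<Longrightarrow>
    x \<otimes> w \<in> span R T"
  by (rule span_hom[where h = "\<lambda>x. x \<otimes> w" and S = S and R = R])
    (auto intro: abelian_group_axioms simp: l_distr)

lemma span_mult_left:
  "\<lbrakk>x \<in> span R S; S \<subseteq> carrier R; T \<subseteq> carrier R; w \<in> carrier R; \<And>s. s \<in> S \<Longrightarrow> w \<otimes> s \<in> span R T\<rbrakk> \<Longrightarrow>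
    w \<otimes> x \<in> span R T"
  by (rule span_hom[where h = "\<lambda>x. w \<otimes> x" and S = S and R = R])
    (auto intro: abelian_group_axioms simp: r_distr)

lemma span_mult_right_zero:
  "\<lbrakk>x \<in> span R S; S \<subseteq> carrier R; w \<in> carrier R; \<And>s. s \<in> S \<Longrightarrow> s \<otimes> w = \<zero>\<rbrakk> \<Longrightarrow> x \<otimes> w = \<zero>"
  using span_mult_right[of x S "{}" w] span_empty span_zero by auto

lemma span_mult_left_zero:
  "\<lbrakk>x \<in> span R S; S \<subseteq> carrier R; w \<in> carrier R; \<And>s. s \<in> S \<Longrightarrow> w \<otimes> s = \<zero>\<rbrakk> \<Longrightarrow> w \<otimes> x = \<zero>"
  using span_mult_left[of x S "{}" w] span_empty span_zero by auto

lemma bracket_closed [intro, simp]: "x \<in> carrier R \<Longrightarrow> y \<in> carrier R \<Longrightarrow> bracket R x y \<in> carrier R"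
  by (simp add: bracket_def)

lemma span_prod_closed: "S \<subseteq> carrier R \<Longrightarrow> T \<subseteq> carrier R \<Longrightarrow> span_prod R S T \<subseteq> carrier R"
  unfolding span_prod_eq_span using span_closed[of "{x \<otimes> y | x y. x \<in> S \<and> y \<in> T}"] by blast

lemma bracket_add_right:
  "\<lbrakk>x \<in> carrier R; y \<in> carrier R; z \<in> carrier R\<rbrakk> \<Longrightarrow>
    bracket R x (y \<oplus> z) = bracket R x y \<oplus> bracket R x z"
  by (simp add: bracket_def l_distr r_distr add_minus_add)

lemma bracket_neg: "x \<in> carrier R \<Longrightarrow> y \<in> carrier R \<Longrightarrow> \<ominus> bracket R x y = bracket R y x"
  by (simp add: bracket_def minus_swap)

lemma bracket_add_left:
  "\<lbrakk>x \<in> carrier R; y \<in> carrier R; z \<in> carrier R\<rbrakk> \<Longrightarrow>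
    bracket R (x \<oplus> y) z = bracket R x z \<oplus> bracket R y z"
  by (simp add: bracket_def l_distr r_distr add_minus_add)

lemma span_bracket_right:
  "\<lbrakk>x \<in> span R S; S \<subseteq> carrier R; T \<subseteq> carrier R; y \<in> carrier R; \<And>s. s \<in> S \<Longrightarrow> bracket R s y \<in> span R T\<rbrakk> \<Longrightarrow>
    bracket R x y \<in> span R T"
  by (rule span_hom[where h = "\<lambda>x. bracket R x y" and S = S and R = R])
    (auto intro: abelian_group_axioms simp: bracket_add_left)

lemma span_bracket_left:
  "\<lbrakk>x \<in> span R S; S \<subseteq> carrier R; T \<subseteq> carrier R; y \<in> carrier R; \<And>s. s \<in> S \<Longrightarrow> bracket R y s \<in> span R T\<rbrakk> \<Longrightarrow>
    bracket R y x \<in> span R T"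
  by (rule span_hom[where h = "\<lambda>x. bracket R y x" and S = S and R = R])
    (auto intro: abelian_group_axioms simp: bracket_add_right)

lemma bracket_minus_left:
  "x \<in> carrier R \<Longrightarrow> y \<in> carrier R \<Longrightarrow> bracket R (\<ominus> x) y = \<ominus> bracket R x y"
  by (simp add: bracket_def minus_eq l_minus r_minus minus_add)

lemma bracket_minus_right:
  "x \<in> carrier R \<Longrightarrow> y \<in> carrier R \<Longrightarrow> bracket R x (\<ominus> y) = \<ominus> bracket R x y"
  by (simp add: bracket_def minus_eq l_minus r_minus minus_add)

lemma bracket_zero [simp]:
  "x \<in> carrier R \<Longrightarrow> bracket R \<zero> x = \<zero>" "x \<in> carrier R \<Longrightarrow> bracket R x \<zero> = \<zero>"
  by (simp_all add: bracket_def minus_self)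

end

context assoc_ring
begin

text \<open>
  A factor that commutes with one entry of a bracket can be moved into the other entry. This turns a product
  in \<open>B\<close> into a value of an inner derivation.
\<close>

lemma mult_bracket_left:
  assumes "a \<in> carrier R" "b \<in> carrier R" "c \<in> carrier R" "a \<otimes> c = c \<otimes> a"
  shows "a \<otimes> bracket R b c = bracket R (a \<otimes> b) c"
proof -
  have "a \<otimes> (c \<otimes> b) = c \<otimes> (a \<otimes> b)"
    using assms by (simp flip: m_assoc)
  then show ?thesis
    using assms by (simp add: bracket_def r_diff m_assoc)
qed

lemma mult_bracket_right:
  assumes "a \<in> carrier R" "b \<in> carrier R" "c \<in> carrier R" "a \<otimes> b = b \<otimes> a"
  shows "a \<otimes> bracket R b c = bracket R b (a \<otimes> c)"
proof -
  have "a \<otimes> (b \<otimes> c) = b \<otimes> (a \<otimes> c)"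
    using assms by (simp flip: m_assoc)
  then show ?thesis
    using assms by (simp add: bracket_def r_diff m_assoc)
qed

lemma bracket_mult_left:
  assumes "a \<in> carrier R" "b \<in> carrier R" "c \<in> carrier R" "a \<otimes> c = c \<otimes> a"
  shows "bracket R a b \<otimes> c = bracket R a (b \<otimes> c)"
proof -
  have "(b \<otimes> a) \<otimes> c = (b \<otimes> c) \<otimes> a"
    using assms by (simp add: m_assoc)
  then show ?thesis
    using assms by (simp add: bracket_def l_diff m_assoc)
qed

lemma bracket_leibniz:
  assumes "x \<in> carrier R" "y \<in> carrier R" "z \<in> carrier R"
  shows "bracket R x (bracket R y z) = bracket R (bracket R x y) z \<oplus> bracket R y (bracket R x z)"
  using assms
proof -
  have 1: "bracket R (bracket R x y) z =
      (x \<otimes> y \<otimes> z \<ominus> y \<otimes> x \<otimes> z) \<oplus> (z \<otimes> y \<otimes> x \<ominus> z \<otimes> x \<otimes> y)"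
    using assms by (simp add: bracket_def minus_eq l_distr r_distr l_minus r_minus minus_add m_assoc a_ac)
  have 2: "bracket R y (bracket R x z) =
      (y \<otimes> x \<otimes> z \<ominus> y \<otimes> z \<otimes> x) \<oplus> (z \<otimes> x \<otimes> y \<ominus> x \<otimes> z \<otimes> y)"
    using assms by (simp add: bracket_def minus_eq l_distr r_distr l_minus r_minus minus_add m_assoc a_ac)
  have 3: "bracket R x (bracket R y z) =
      (x \<otimes> y \<otimes> z \<ominus> y \<otimes> z \<otimes> x) \<oplus> (z \<otimes> y \<otimes> x \<ominus> x \<otimes> z \<otimes> y)"
    using assms by (simp add: bracket_def minus_eq l_distr r_distr l_minus r_minus minus_add m_assoc a_ac)
  have "((a \<ominus> b) \<oplus> (c \<ominus> d)) \<oplus> ((b \<ominus> e) \<oplus> (d \<ominus> f)) = (a \<ominus> e) \<oplus> (c \<ominus> f)"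
    if "a \<in> carrier R" "b \<in> carrier R" "c \<in> carrier R" "d \<in> carrier R" "e \<in> carrier R" "f \<in> carrier R"
    for a b c d e f
  proof -
    have "((a \<ominus> b) \<oplus> (c \<ominus> d)) \<oplus> ((b \<ominus> e) \<oplus> (d \<ominus> f)) =
        ((a \<ominus> b) \<oplus> (b \<ominus> e)) \<oplus> ((c \<ominus> d) \<oplus> (d \<ominus> f))"
      using that by (simp add: a_ac)
    then show ?thesis
      using that by (simp add: minus_telescope)
  qed
  then show ?thesis
    using assms unfolding 1 2 3 by simp
qed

end

lemma op_ring_simps [simp]:
  "carrier (op_ring R) = carrier R"
  "zero (op_ring R) = zero R"
  "add (op_ring R) = add R"
  "x \<otimes>\<^bsub>op_ring R\<^esub> y = y \<otimes>\<^bsub>R\<^esub> x"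
  "add_monoid (op_ring R) = add_monoid R"
  "a_inv (op_ring R) = a_inv R"
  "a_minus (op_ring R) = a_minus R"
  "finsum (op_ring R) = finsum R"
  by (auto simp: op_ring_def a_inv_def a_minus_def finsum_def fun_eq_iff)

lemma span_op [simp]: "span (op_ring R) S = span R S"
  by (simp add: span_def)

lemma (in assoc_ring) assoc_ring_op: "assoc_ring (op_ring R)"
proof -
  have "abelian_group (op_ring R)"
    using a_comm_group by (simp add: comm_group_abelian_groupI)
  then show ?thesis
    by (intro assoc_ring.intro nonassoc_ring.intro nonassoc_ring_axioms.intro assoc_ring_axioms.intro)
      (auto simp: l_distr r_distr m_assoc)
qed

lemma bracket_op [simp]: "bracket (op_ring R) x y = bracket R y x"
  by (simp add: bracket_def)

section \<open>Peirce decompositions\<close>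

definition peirce_comp ::
    "('a, 'm) ring_scheme \<Rightarrow> ('i \<Rightarrow> 'a \<Rightarrow> 'a) \<Rightarrow> ('i \<Rightarrow> 'a \<Rightarrow> 'a) \<Rightarrow> 'i \<Rightarrow> 'i \<Rightarrow> 'a set"
  where "peirce_comp R l r i j = {a \<in> carrier R. l i a = a \<and> r j a = a}"

definition commutators :: "('a, 'm) ring_scheme \<Rightarrow> 'a set"
  where "commutators R = span R {bracket R x y | x y. x \<in> carrier R \<and> y \<in> carrier R}"

lemma peirce_comp_op [simp]: "peirce_comp (op_ring R) r l i j = peirce_comp R l r j i"
  by (auto simp: peirce_comp_def)

lemma commutators_op [simp]: "commutators (op_ring R) = commutators R"
proof -
  have "{bracket R y x | x y. x \<in> carrier R \<and> y \<in> carrier R} =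
      {bracket R x y | x y. x \<in> carrier R \<and> y \<in> carrier R}"
    by blast
  then show ?thesis
    by (simp add: commutators_def)
qed

text \<open>
  The maps \<open>l i\<close> and \<open>r i\<close> are the left and the right multiplication by the idempotent \<open>e\<^sub>i\<close>. They replace
  the idempotent because \<open>e\<^sub>4\<close> need not belong to the ring. In this form the assumptions are symmetric
  in all indices and under the passage to the opposite ring. Assumption \<open>unit\<close> expresses that at most one
  of the idempotents is only formal, and \<open>full\<close> that \<open>Ae\<^sub>kA = A\<close>.
\<close>

locale peirce_ring = assoc_ring A for A :: "('a, 'm) ring_scheme" (structure) +
  fixes I :: "'i set" and l r :: "'i \<Rightarrow> 'a \<Rightarrow> 'a"
  assumes finite_I: "finite I" and card_I: "4 \<le> card I"
    and l_closed [simp]: "\<lbrakk>i \<in> I; a \<in> carrier A\<rbrakk> \<Longrightarrow> l i a \<in> carrier A"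
    and r_closed [simp]: "\<lbrakk>i \<in> I; a \<in> carrier A\<rbrakk> \<Longrightarrow> r i a \<in> carrier A"
    and l_add: "\<lbrakk>i \<in> I; a \<in> carrier A; b \<in> carrier A\<rbrakk> \<Longrightarrow> l i (a \<oplus> b) = l i a \<oplus> l i b"
    and r_add: "\<lbrakk>i \<in> I; a \<in> carrier A; b \<in> carrier A\<rbrakk> \<Longrightarrow> r i (a \<oplus> b) = r i a \<oplus> r i b"
    and l_mult: "\<lbrakk>i \<in> I; a \<in> carrier A; b \<in> carrier A\<rbrakk> \<Longrightarrow> l i (a \<otimes> b) = l i a \<otimes> b"
    and r_mult: "\<lbrakk>i \<in> I; a \<in> carrier A; b \<in> carrier A\<rbrakk> \<Longrightarrow> r i (a \<otimes> b) = a \<otimes> r i b"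
    and mid: "\<lbrakk>i \<in> I; a \<in> carrier A; b \<in> carrier A\<rbrakk> \<Longrightarrow> r i a \<otimes> b = a \<otimes> l i b"
    and l_l: "\<lbrakk>i \<in> I; j \<in> I; a \<in> carrier A\<rbrakk> \<Longrightarrow> l i (l j a) = (if i = j then l i a else \<zero>)"
    and r_r: "\<lbrakk>i \<in> I; j \<in> I; a \<in> carrier A\<rbrakk> \<Longrightarrow> r i (r j a) = (if i = j then r i a else \<zero>)"
    and l_r: "\<lbrakk>i \<in> I; j \<in> I; a \<in> carrier A\<rbrakk> \<Longrightarrow> l i (r j a) = r j (l i a)"
    and l_sum: "a \<in> carrier A \<Longrightarrow> (\<Oplus>i\<in>I. l i a) = a"
    and r_sum: "a \<in> carrier A \<Longrightarrow> (\<Oplus>i\<in>I. r i a) = a"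
    and full: "k \<in> I \<Longrightarrow> span A {r k a \<otimes> b | a b. a \<in> carrier A \<and> b \<in> carrier A} = carrier A"
    and unit: "\<lbrakk>i \<in> I; j \<in> I; i \<noteq> j\<rbrakk> \<Longrightarrow>
      (\<exists>e\<in>carrier A. \<forall>a\<in>carrier A. l i a = e \<otimes> a) \<or> (\<exists>e\<in>carrier A. \<forall>a\<in>carrier A. r j a = a \<otimes> e)"
begin

abbreviation C :: "'i \<Rightarrow> 'i \<Rightarrow> 'a set"
  where "C \<equiv> peirce_comp A l r"

lemma peirce_ring_op: "peirce_ring (op_ring A) I r l"
proof -
  have "{b \<otimes> r k a | a b. a \<in> carrier A \<and> b \<in> carrier A} = {b \<otimes> r k a | b a. a \<in> carrier A \<and> b \<in> carrier A}" for k
    by blast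
  then have "{b \<otimes> l k a | a b. a \<in> carrier A \<and> b \<in> carrier A} =
      {r k a \<otimes> b | a b. a \<in> carrier A \<and> b \<in> carrier A}" if "k \<in> I" for k
    using mid[OF that] by auto metis+
  moreover have unit': "(\<exists>e\<in>carrier A. \<forall>a\<in>carrier A. r i a = a \<otimes> e) \<or>
      (\<exists>e\<in>carrier A. \<forall>a\<in>carrier A. l j a = e \<otimes> a)" if "i \<in> I" "j \<in> I" "i \<noteq> j" for i j
    using unit[of j i] that by blast
  ultimately show ?thesis
    using assoc_ring_op finite_I card_I full unit'
    by (intro peirce_ring.intro peirce_ring_axioms.intro)
      (auto simp: l_add r_add l_mult r_mult mid l_l r_r l_r l_sum r_sum)
qed

lemma comp_carrier [dest]: "a \<in> C i j \<Longrightarrow> a \<in> carrier A"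
  by (simp add: peirce_comp_def)

lemma comp_subset: "C i j \<subseteq> carrier A"
  by (auto simp: peirce_comp_def)

lemma l_map_zero [simp]: "i \<in> I \<Longrightarrow> l i \<zero> = \<zero>"
  using l_add[of i \<zero> \<zero>] by (intro zero_of_double) auto

lemma r_map_zero [simp]: "i \<in> I \<Longrightarrow> r i \<zero> = \<zero>"
  using r_add[of i \<zero> \<zero>] by (intro zero_of_double) auto

lemma l_map_neg: "i \<in> I \<Longrightarrow> a \<in> carrier A \<Longrightarrow> l i (\<ominus> a) = \<ominus> l i a"
  using l_add[of i "\<ominus> a" a] minus_equality[of "l i (\<ominus> a)" "l i a"] by (simp add: l_neg)

lemma r_map_neg: "i \<in> I \<Longrightarrow> a \<in> carrier A \<Longrightarrow> r i (\<ominus> a) = \<ominus> r i a"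
  using r_add[of i "\<ominus> a" a] minus_equality[of "r i (\<ominus> a)" "r i a"] by (simp add: l_neg)

lemma l_map_diff: "i \<in> I \<Longrightarrow> a \<in> carrier A \<Longrightarrow> b \<in> carrier A \<Longrightarrow> l i (a \<ominus> b) = l i a \<ominus> l i b"
  by (simp add: minus_eq l_add l_map_neg)

lemma r_map_diff: "i \<in> I \<Longrightarrow> a \<in> carrier A \<Longrightarrow> b \<in> carrier A \<Longrightarrow> r i (a \<ominus> b) = r i a \<ominus> r i b"
  by (simp add: minus_eq r_add r_map_neg)

lemma comp_zero [simp]: "i \<in> I \<Longrightarrow> j \<in> I \<Longrightarrow> \<zero> \<in> C i j"
  by (simp add: peirce_comp_def)

lemma comp_add: "i \<in> I \<Longrightarrow> j \<in> I \<Longrightarrow> a \<in> C i j \<Longrightarrow> b \<in> C i j \<Longrightarrow> a \<oplus> b \<in> C i j"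
  by (simp add: peirce_comp_def l_add r_add)

lemma comp_neg: "i \<in> I \<Longrightarrow> j \<in> I \<Longrightarrow> a \<in> C i j \<Longrightarrow> \<ominus> a \<in> C i j"
  by (simp add: peirce_comp_def l_map_neg r_map_neg)

lemma comp_mult: "i \<in> I \<Longrightarrow> k \<in> I \<Longrightarrow> a \<in> C i j \<Longrightarrow> b \<in> C j k \<Longrightarrow> a \<otimes> b \<in> C i k"
  by (simp add: peirce_comp_def l_mult r_mult)

lemma comp_entry: "i \<in> I \<Longrightarrow> j \<in> I \<Longrightarrow> a \<in> carrier A \<Longrightarrow> l i (r j a) \<in> C i j"
  by (simp add: peirce_comp_def l_l r_r l_r)

lemma comp_l: "i \<in> I \<Longrightarrow> k \<in> I \<Longrightarrow> a \<in> C i j \<Longrightarrow> l k a = (if k = i then a else \<zero>)"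
  using l_l[of k i a] by (auto simp: peirce_comp_def)

lemma comp_r: "j \<in> I \<Longrightarrow> k \<in> I \<Longrightarrow> a \<in> C i j \<Longrightarrow> r k a = (if k = j then a else \<zero>)"
  using r_r[of k j a] by (auto simp: peirce_comp_def)

lemma comp_mult_zero:
  "\<lbrakk>j \<in> I; k \<in> I; j \<noteq> k; a \<in> C i j; b \<in> C k m\<rbrakk> \<Longrightarrow> a \<otimes> b = \<zero>"
  using mid[of j a b] comp_l[of k j b m] by (auto simp: peirce_comp_def)

text \<open>
  The equation \<open>Ae\<^sub>kA = A\<close>, cut down to one component.
\<close>

lemma comp_span:
  assumes "i \<in> I" "j \<in> I" "k \<in> I" and x: "x \<in> C i j"
  shows "x \<in> span A {a \<otimes> b | a b. a \<in> C i k \<and> b \<in> C k j}"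
proof -
  let ?S = "{a \<otimes> b | a b. a \<in> C i k \<and> b \<in> C k j}"
  have S: "?S \<subseteq> carrier A"
    by auto
  have "x \<in> span A {r k a \<otimes> b | a b. a \<in> carrier A \<and> b \<in> carrier A}"
    using full[OF assms(3)] x by auto
  moreover have "{r k a \<otimes> b | a b. a \<in> carrier A \<and> b \<in> carrier A} \<subseteq> carrier A"
    using assms(3) by auto
  ultimately have "l i (r j x) \<in> span A ?S"
  proof (induction rule: span_induct)
    case (base x)
    then obtain a b where ab: "a \<in> carrier A" "b \<in> carrier A" "x = r k a \<otimes> b"
      by blast
    have "l i (r j x) = l i (r k (r k a)) \<otimes> r j b"
      using ab assms by (simp add: l_mult r_mult r_r)
    also have "\<dots> = l i (r k a) \<otimes> l k (r j b)"
      using ab assms by (simp add: l_r mid)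
    finally show ?case
      using ab assms by (intro span_base CollectI exI[of _ "l i (r k a)"] exI[of _ "l k (r j b)"])
        (simp add: comp_entry)
  qed (use assms S in \<open>auto simp: span_zero l_add r_add l_map_neg r_map_neg intro: span_add span_neg\<close>)
  then show ?thesis
    using x by (simp add: peirce_comp_def)
qed

lemma fresh: "\<exists>m\<in>I. m \<noteq> i \<and> m \<noteq> j \<and> m \<noteq> k"
proof -
  have "card {i, j, k} \<le> 3"
    by (simp add: card_insert_if)
  then have "card {i, j, k} < card I"
    using card_I by simp
  then have "\<not> I \<subseteq> {i, j, k}"
    using card_mono[of "{i, j, k}" I] by auto
  then show ?thesis
    by auto
qed

text \<open>
  At least one of \<open>i\<close> and \<open>j\<close> belongs to an idempotent of \<open>A\<close>, which fixes \<open>x\<close> from its side and, by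
  fullness, is a sum of products through the index \<open>k'\<close>, respectively \<open>k\<close>. Both one-sided conditions are
  imposed since the side is not known: the formal idempotent admits nonzero elements that one of them
  fails to detect.
\<close>

lemma nondegenerate:
  assumes ij: "i \<in> I" "j \<in> I" "i \<noteq> j" and k: "k \<in> I" "k' \<in> I" and x: "x \<in> C i j"
    and right: "\<And>y. y \<in> C j k \<Longrightarrow> x \<otimes> y = \<zero>" and left: "\<And>y. y \<in> C k' i \<Longrightarrow> y \<otimes> x = \<zero>"
  shows "x = \<zero>"
proof -
  have xc: "x \<in> carrier A" "l i x = x" "r j x = x"
    using x by (auto simp: peirce_comp_def)
  have "e \<otimes> x = \<zero>" if "e \<in> carrier A" for e
  proof -
    have "e \<in> span A {r k' a \<otimes> b | a b. a \<in> carrier A \<and> b \<in> carrier A}"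
      using full[OF k(2)] that by simp
    moreover have "{r k' a \<otimes> b | a b. a \<in> carrier A \<and> b \<in> carrier A} \<subseteq> carrier A"
      using k by auto
    ultimately show ?thesis
    proof (induction rule: span_induct)
      case (base y)
      then obtain a b where ab: "a \<in> carrier A" "b \<in> carrier A" "y = r k' a \<otimes> b"
        by blast
      have "l k' (r i b) \<otimes> x = l k' b \<otimes> x"
        using ab ij k xc by (simp add: mid l_r)
      moreover have "l k' (r i b) \<otimes> x = \<zero>"
        using ab ij k by (intro left comp_entry) auto
      ultimately have "l k' b \<otimes> x = \<zero>"
        by simp
      then show ?case
        using ab k xc by (simp add: mid m_assoc)
    qed (use xc in \<open>auto simp: l_minus l_distr\<close>)
  qed
  moreover have "x \<otimes> e = \<zero>" if "e \<in> carrier A" for e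
  proof -
    have "e \<in> span A {r k a \<otimes> b | a b. a \<in> carrier A \<and> b \<in> carrier A}"
      using full[OF k(1)] that by simp
    moreover have "{r k a \<otimes> b | a b. a \<in> carrier A \<and> b \<in> carrier A} \<subseteq> carrier A"
      using k by auto
    ultimately show ?thesis
    proof (induction rule: span_induct)
      case (base y)
      then obtain a b where ab: "a \<in> carrier A" "b \<in> carrier A" "y = r k a \<otimes> b"
        by blast
      have "x \<otimes> l j (r k a) = x \<otimes> r k a"
        using ab ij k xc mid[of j x "r k a"] by simp
      moreover have "x \<otimes> l j (r k a) = \<zero>"
        using ab ij k by (intro right comp_entry) auto
      ultimately have "x \<otimes> r k a = \<zero>"
        by simp
      moreover have "x \<otimes> (r k a \<otimes> b) = (x \<otimes> r k a) \<otimes> b"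
        using ab k xc by (simp add: m_assoc)
      ultimately have "x \<otimes> (r k a \<otimes> b) = \<zero>"
        using ab by simp
      then show ?case
        using ab by simp
    qed (use xc in \<open>auto simp: r_minus r_distr\<close>)
  qed
  ultimately show ?thesis
    using unit[OF ij] xc by metis
qed

lemma carrier_span: "carrier A \<subseteq> span A (\<Union>i\<in>I. \<Union>j\<in>I. C i j)"
proof
  let ?S = "\<Union>i\<in>I. \<Union>j\<in>I. C i j"
  have S: "?S \<subseteq> carrier A"
    by auto
  fix a assume a: "a \<in> carrier A"
  have "l i a \<in> span A ?S" if i: "i \<in> I" for i
  proof -
    have "(\<Oplus>j\<in>I. r j (l i a)) \<in> span A ?S"
      using a i comp_entry[OF i _ a] by (intro finsum_in_span S finite_I span_base) (auto simp: l_r)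
    then show ?thesis
      using a i by (simp add: r_sum)
  qed
  then have "(\<Oplus>i\<in>I. l i a) \<in> span A ?S"
    by (intro finsum_in_span S finite_I)
  then show "a \<in> span A ?S"
    using a by (simp add: l_sum)
qed

text \<open>
  The diagonal components are products \<open>A\<^sub>i\<^sub>kA\<^sub>k\<^sub>i\<close>, so the off-diagonal ones generate the ring.
\<close>

lemma peirce_induct [consumes 1, case_names zero off mult neg add]:
  assumes "x \<in> carrier A" and zero: "P \<zero>"
    and off: "\<And>i j x. \<lbrakk>i \<in> I; j \<in> I; i \<noteq> j; x \<in> C i j\<rbrakk> \<Longrightarrow> P x"
    and mult: "\<And>x y. \<lbrakk>x \<in> carrier A; y \<in> carrier A; P x; P y\<rbrakk> \<Longrightarrow> P (x \<otimes> y)"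
    and neg: "\<And>x. \<lbrakk>x \<in> carrier A; P x\<rbrakk> \<Longrightarrow> P (\<ominus> x)"
    and add: "\<And>x y. \<lbrakk>x \<in> carrier A; y \<in> carrier A; P x; P y\<rbrakk> \<Longrightarrow> P (x \<oplus> y)"
  shows "P x"
proof -
  have diag: "P x" if i: "i \<in> I" and x: "x \<in> C i i" for i x
  proof -
    obtain k where k: "k \<in> I" "k \<noteq> i"
      using fresh by blast
    have "x \<in> span A {a \<otimes> b | a b. a \<in> C i k \<and> b \<in> C k i}"
      using comp_span[OF i i k(1) x] .
    moreover have "{a \<otimes> b | a b. a \<in> C i k \<and> b \<in> C k i} \<subseteq> carrier A"
      by auto
    ultimately show ?thesis
    proof (induction rule: span_induct)
      case (base z)
      then obtain a b where ab: "z = a \<otimes> b" "a \<in> C i k" "b \<in> C k i"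
        by blast
      show ?case
        unfolding ab(1) using off[OF i k(1) k(2)[symmetric] ab(2)] off[OF k(1) i k(2) ab(3)] ab
        by (intro mult) auto
    qed (use zero neg add in blast)+
  qed
  have "x \<in> span A (\<Union>i\<in>I. \<Union>j\<in>I. C i j)"
    using carrier_span assms(1) by blast
  moreover have "(\<Union>i\<in>I. \<Union>j\<in>I. C i j) \<subseteq> carrier A"
    using comp_subset by blast
  ultimately show ?thesis
  proof (induction rule: span_induct)
    case (base z)
    then obtain i j where ij: "i \<in> I" "j \<in> I" "z \<in> C i j"
      by blast
    show ?case
    proof (cases "i = j")
      case True
      have "z \<in> C i i"
        using ij(3) True by simp
      then show ?thesis
        by (rule diag[OF ij(1)])
    next
      case False
      then show ?thesis
        using off ij by blast
    qed
  qed (use zero neg add in blast)+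
qed

lemma compI:
  assumes ij: "i \<in> I" "j \<in> I" and y: "y \<in> carrier A"
    and zero: "\<And>p q. p \<in> I \<Longrightarrow> q \<in> I \<Longrightarrow> p \<noteq> i \<or> q \<noteq> j \<Longrightarrow> l p (r q y) = \<zero>"
  shows "y \<in> C i j"
proof -
  have "l p y = \<zero>" if p: "p \<in> I" "p \<noteq> i" for p
  proof -
    have "l p y = (\<Oplus>q\<in>I. r q (l p y))"
      using p y by (simp add: r_sum)
    also have "\<dots> = (\<Oplus>q\<in>I. \<zero>)"
      using zero[of p] p y by (intro finsum_cong') (auto simp flip: l_r)
    finally show ?thesis
      by simp
  qed
  then have "l i y = y"
    using finsum_single[OF finite_I ij(1), of "\<lambda>p. l p y"] ij y l_sum[OF y] by simp
  moreover have "r q y = \<zero>" if q: "q \<in> I" "q \<noteq> j" for q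
  proof -
    have "r q y = (\<Oplus>p\<in>I. l p (r q y))"
      using q y by (simp add: l_sum)
    also have "\<dots> = (\<Oplus>p\<in>I. \<zero>)"
      using zero[of _ q] q y by (intro finsum_cong') auto
    finally show ?thesis
      by simp
  qed
  then have "r j y = y"
    using finsum_single[OF finite_I ij(2), of "\<lambda>p. r p y"] ij y r_sum[OF y] by simp
  ultimately show ?thesis
    using y by (simp add: peirce_comp_def)
qed

lemma commutators_closed: "commutators A \<subseteq> carrier A"
  unfolding commutators_def using span_closed[of "{bracket A x y | x y. x \<in> carrier A \<and> y \<in> carrier A}"] by blast

lemma bracket_in_commutators: "x \<in> carrier A \<Longrightarrow> y \<in> carrier A \<Longrightarrow> bracket A x y \<in> commutators A"
  unfolding commutators_def by (rule span_base) blast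

lemma bracket_comp: "i \<in> I \<Longrightarrow> j \<in> I \<Longrightarrow> i \<noteq> j \<Longrightarrow> a \<in> C i k \<Longrightarrow> b \<in> C k j \<Longrightarrow> bracket A a b = a \<otimes> b"
  using comp_mult_zero[of j i b k a k] comp_carrier[of a i k] comp_carrier[of b k j]
  by (simp add: bracket_def)

lemma comp_span_bracket:
  assumes "i \<in> I" "j \<in> I" "k \<in> I" "i \<noteq> j" and x: "x \<in> C i j"
  shows "x \<in> span A {bracket A a b | a b. a \<in> C i k \<and> b \<in> C k j}"
proof -
  have "{a \<otimes> b | a b. a \<in> C i k \<and> b \<in> C k j} = {bracket A a b | a b. a \<in> C i k \<and> b \<in> C k j}"
    using bracket_comp[OF assms(1,2,4), of _ k] by (intro Collect_cong) metis
  then show ?thesis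
    using comp_span[OF assms(1-3) x] by simp
qed

lemma comp_commutators:
  assumes "i \<in> I" "j \<in> I" "i \<noteq> j"
  shows "C i j \<subseteq> commutators A"
proof
  fix x assume "x \<in> C i j"
  then have "x \<in> span A {bracket A a b | a b. a \<in> C i i \<and> b \<in> C i j}"
    using assms by (intro comp_span_bracket)
  moreover have "{bracket A a b | a b. a \<in> C i i \<and> b \<in> C i j} \<subseteq>
      {bracket A x y | x y. x \<in> carrier A \<and> y \<in> carrier A}"
    by blast
  ultimately show "x \<in> commutators A"
    unfolding commutators_def using span_mono by blast
qed

text \<open>
  \<open>[A, A]\<close> is generated as a Lie ring by the off-diagonal components. The diagonal brackets
  \<open>[A\<^sub>i\<^sub>i, A\<^sub>i\<^sub>i]\<close> are covered because \<open>A\<^sub>i\<^sub>i = A\<^sub>i\<^sub>pA\<^sub>p\<^sub>i\<close> and \<open>[ab, y] = [a, by] + [b, ya]\<close>.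
\<close>

definition lie_gens :: "'a set"
  where "lie_gens = {x. \<exists>i\<in>I. \<exists>j\<in>I. i \<noteq> j \<and> x \<in> C i j} \<union>
    {bracket A x y | x y. \<exists>i\<in>I. \<exists>j\<in>I. i \<noteq> j \<and> x \<in> C i j \<and> y \<in> C j i}"

lemma lie_gens_closed: "lie_gens \<subseteq> carrier A"
  by (auto simp: lie_gens_def)

lemma lie_gens_comp: "i \<in> I \<Longrightarrow> j \<in> I \<Longrightarrow> i \<noteq> j \<Longrightarrow> x \<in> C i j \<Longrightarrow> x \<in> lie_gens"
  unfolding lie_gens_def by blast

lemma lie_gens_bracket:
  "i \<in> I \<Longrightarrow> j \<in> I \<Longrightarrow> i \<noteq> j \<Longrightarrow> x \<in> C i j \<Longrightarrow> y \<in> C j i \<Longrightarrow> bracket A x y \<in> lie_gens"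
  unfolding lie_gens_def by blast

lemma bracket_in_lie_gens:
  assumes ijkm: "i \<in> I" "j \<in> I" "k \<in> I" "m \<in> I" and x: "x \<in> C i j" and y: "y \<in> C k m"
  shows "bracket A x y \<in> span A lie_gens"
proof -
  have c: "x \<in> carrier A" "y \<in> carrier A"
    using x y by auto
  consider "j = k" "m \<noteq> i" | "j \<noteq> k" "m = i" | "j \<noteq> k" "m \<noteq> i" | "j = k" "m = i" "i \<noteq> j"
    | "j = k" "m = i" "i = j"
    by blast
  then show ?thesis
  proof cases
    case 1
    then have "bracket A x y \<in> C i m"
      using bracket_comp[of i m x j y] comp_mult[of i m x j y] ijkm x y by simp
    then show ?thesis
      using 1 ijkm by (intro span_base lie_gens_comp[of i m]) auto
  next
    case 2
    then have "bracket A y x \<in> C k j"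
      using bracket_comp[of k j y i x] comp_mult[of k j y i x] ijkm x y by auto
    then have "bracket A y x \<in> lie_gens"
      using 2 ijkm by (intro lie_gens_comp[of k j]) auto
    then have "\<ominus> bracket A y x \<in> span A lie_gens"
      by (intro span_neg lie_gens_closed span_base)
    then show ?thesis
      using c by (simp add: bracket_neg)
  next
    case 3
    then have "bracket A x y = \<zero>"
      using comp_mult_zero[of j k x i y m] comp_mult_zero[of m i y k x j] ijkm x y
      by (simp add: bracket_def minus_eq)
    then show ?thesis
      by (simp add: span_zero)
  next
    case 4
    then show ?thesis
      using ijkm x y by (intro span_base lie_gens_bracket[of i j]) auto
  next
    case 5
    obtain p where p: "p \<in> I" "p \<noteq> i"
      using fresh by blast
    have x': "x \<in> span A {a \<otimes> b | a b. a \<in> C i p \<and> b \<in> C p i}"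
      using comp_span[of i i p x] 5 ijkm p x by simp
    show ?thesis
    proof (rule span_bracket_right[OF x' _ lie_gens_closed c(2)])
      fix z assume "z \<in> {a \<otimes> b | a b. a \<in> C i p \<and> b \<in> C p i}"
      then obtain a b where ab: "a \<in> C i p" "b \<in> C p i" "z = a \<otimes> b"
        by blast
      have abc: "a \<in> carrier A" "b \<in> carrier A"
        using ab by auto
      have "bracket A z y = bracket A a (b \<otimes> y) \<oplus> bracket A b (y \<otimes> a)"
        using abc c minus_telescope[of "a \<otimes> (b \<otimes> y)" "b \<otimes> (y \<otimes> a)" "y \<otimes> (a \<otimes> b)"] ab
        by (simp add: bracket_def m_assoc)
      moreover have "bracket A a (b \<otimes> y) \<in> span A lie_gens" "bracket A b (y \<otimes> a) \<in> span A lie_gens"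
        using ab 5 ijkm p y comp_mult[of p i b i y] comp_mult[of i p y i a]
        by (intro span_base lie_gens_bracket[of i p] lie_gens_bracket[of p i]; simp)+
      ultimately show "bracket A z y \<in> span A lie_gens"
        by (simp add: span_add)
    qed auto
  qed
qed

lemma commutators_span: "commutators A \<subseteq> span A lie_gens"
proof -
  have S: "(\<Union>i\<in>I. \<Union>j\<in>I. C i j) \<subseteq> carrier A"
    by auto
  have "bracket A x y \<in> span A lie_gens" if x: "x \<in> carrier A" and y: "y \<in> carrier A" for x y
  proof -
    have span: "x \<in> span A (\<Union>i\<in>I. \<Union>j\<in>I. C i j)" "y \<in> span A (\<Union>i\<in>I. \<Union>j\<in>I. C i j)"
      using carrier_span x y by auto
    have "bracket A s y \<in> span A lie_gens" if s: "s \<in> (\<Union>i\<in>I. \<Union>j\<in>I. C i j)" for s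
      using s bracket_in_lie_gens S by (intro span_bracket_left[OF span(2) S lie_gens_closed]) auto
    then show ?thesis
      by (rule span_bracket_right[OF span(1) S lie_gens_closed y])
  qed
  then show ?thesis
    unfolding commutators_def by (intro span_subset lie_gens_closed) auto
qed

end

section \<open>Products of off-diagonal components under a Lie homomorphism\<close>

text \<open>
  An injective homomorphism of \<open>[A, A]\<close> onto a Lie ideal of \<open>B\<close>. Assumption \<open>f_ideal\<close> is the only trace of
  the fact that the image of a Lie isomorphism is all of \<open>[B, B]\<close>, and it is the source of all relations
  in \<open>B\<close> that are not relations in \<open>[A, A]\<close>.
\<close>

locale lie_ideal_map = peirce_ring A I l r + B: assoc_ring B
  for A :: "('a, 'm) ring_scheme" (structure) and I :: "'i set" and l r
    and B :: "('b, 'n) ring_scheme" +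
  fixes f :: "'a \<Rightarrow> 'b"
  assumes f_closed [simp]: "a \<in> commutators A \<Longrightarrow> f a \<in> carrier B"
    and f_add: "\<lbrakk>a \<in> commutators A; b \<in> commutators A\<rbrakk> \<Longrightarrow> f (a \<oplus> b) = f a \<oplus>\<^bsub>B\<^esub> f b"
    and f_bracket: "\<lbrakk>a \<in> commutators A; b \<in> commutators A\<rbrakk> \<Longrightarrow>
      f (bracket A a b) = bracket B (f a) (f b)"
    and f_inj: "inj_on f (commutators A)"
    and f_ideal: "\<lbrakk>s \<in> carrier B; a \<in> commutators A\<rbrakk> \<Longrightarrow> bracket B s (f a) \<in> f ` commutators A"
begin

abbreviation K :: "'a set"
  where "K \<equiv> commutators A"

lemma K_carrier [simp]: "a \<in> K \<Longrightarrow> a \<in> carrier A"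
  using commutators_closed by blast

lemma K_gens: "{bracket A x y | x y. x \<in> carrier A \<and> y \<in> carrier A} \<subseteq> carrier A"
  by auto

lemma K_zero [simp]: "\<zero> \<in> K"
  unfolding commutators_def by (rule span_zero)

lemma K_add [simp]: "a \<in> K \<Longrightarrow> b \<in> K \<Longrightarrow> a \<oplus> b \<in> K"
  unfolding commutators_def by (rule span_add)

lemma K_neg [simp]: "a \<in> K \<Longrightarrow> \<ominus> a \<in> K"
  unfolding commutators_def by (rule span_neg[OF K_gens])

lemma K_bracket [simp]: "a \<in> carrier A \<Longrightarrow> b \<in> carrier A \<Longrightarrow> bracket A a b \<in> K"
  by (rule bracket_in_commutators)

lemma comp_K: "i \<in> I \<Longrightarrow> j \<in> I \<Longrightarrow> i \<noteq> j \<Longrightarrow> a \<in> C i j \<Longrightarrow> a \<in> K"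
  using comp_commutators by blast

lemma f_zero [simp]: "f \<zero> = \<zero>\<^bsub>B\<^esub>"
  using f_add[of \<zero> \<zero>] by (intro B.zero_of_double) auto

lemma f_neg: "a \<in> K \<Longrightarrow> f (\<ominus> a) = \<ominus>\<^bsub>B\<^esub> f a"
  using f_add[of "\<ominus> a" a] B.minus_equality[of "f (\<ominus> a)" "f a"] by (simp add: l_neg)

lemma f_eq_iff: "a \<in> K \<Longrightarrow> b \<in> K \<Longrightarrow> f a = f b \<longleftrightarrow> a = b"
  using f_inj by (auto simp: inj_on_def)

text \<open>
  The derivation of \<open>[A, A]\<close> induced by an element of \<open>B\<close>.
\<close>

definition der :: "'b \<Rightarrow> 'a \<Rightarrow> 'a"
  where "der b a = inv_into K f (bracket B b (f a))"

lemma der_closed [simp]: "b \<in> carrier B \<Longrightarrow> a \<in> K \<Longrightarrow> der b a \<in> K"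
  unfolding der_def using f_ideal by (intro inv_into_into)

lemma f_der: "b \<in> carrier B \<Longrightarrow> a \<in> K \<Longrightarrow> f (der b a) = bracket B b (f a)"
  unfolding der_def using f_ideal by (intro f_inv_into_f)

lemma der_eqI: "b \<in> carrier B \<Longrightarrow> a \<in> K \<Longrightarrow> c \<in> K \<Longrightarrow> f c = bracket B b (f a) \<Longrightarrow> der b a = c"
  using f_eq_iff[of "der b a" c] by (simp add: f_der)

lemma der_zero [simp]: "b \<in> carrier B \<Longrightarrow> der b \<zero> = \<zero>"
  by (rule der_eqI) auto

lemma der_add: "b \<in> carrier B \<Longrightarrow> x \<in> K \<Longrightarrow> y \<in> K \<Longrightarrow> der b (x \<oplus> y) = der b x \<oplus> der b y"
  by (rule der_eqI) (auto simp: f_add f_der B.bracket_add_right)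

lemma der_neg: "b \<in> carrier B \<Longrightarrow> x \<in> K \<Longrightarrow> der b (\<ominus> x) = \<ominus> der b x"
  by (rule der_eqI) (auto simp: f_neg f_der B.bracket_minus_right)

lemma der_bracket:
  "b \<in> carrier B \<Longrightarrow> x \<in> K \<Longrightarrow> y \<in> K \<Longrightarrow>
    der b (bracket A x y) = bracket A (der b x) y \<oplus> bracket A x (der b y)"
  by (rule der_eqI) (auto simp: f_add f_bracket f_der B.bracket_leibniz[of b "f x" "f y"])

lemma entry_bracket:
  assumes "p \<in> I" "q \<in> I" "k \<in> I" "m \<in> I" "k \<noteq> p" "m \<noteq> q" and c: "c \<in> C p q" and x: "x \<in> carrier A"
  shows "l k (r m (bracket A x c)) = \<zero>" and "l k (r m (bracket A c x)) = \<zero>"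
proof -
  have cc: "c \<in> carrier A" "l k c = \<zero>" "r m c = \<zero>"
    using c comp_l[of p k c q] comp_r[of q m c p] assms by auto
  have "l k (r m (x \<otimes> c)) = \<zero>" "l k (r m (c \<otimes> x)) = \<zero>"
    using assms cc by (simp_all add: r_mult l_mult)
  then show "l k (r m (bracket A x c)) = \<zero>" "l k (r m (bracket A c x)) = \<zero>"
    using assms cc by (simp_all add: bracket_def r_map_diff l_map_diff)
qed

text \<open>
  Write \<open>a\<close> as a sum of brackets \<open>[x, y]\<close> with \<open>x \<in> A\<^sub>i\<^sub>m\<close>, \<open>y \<in> A\<^sub>m\<^sub>j\<close>. A bracket with \<open>y\<close> lives in row \<open>m\<close> and
  column \<open>j\<close>, a bracket with \<open>x\<close> in row \<open>i\<close> and column \<open>m\<close>, and this settles the claim whenever \<open>m\<close> can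
  be chosen different from \<open>k\<close> and \<open>q\<close> as well. Otherwise \<open>i, j, k, q\<close> exhaust the index set. In that case
  the diagonal entries of the derivative of \<open>[a, c] = 0\<close> with \<open>c \<in> A\<^sub>q\<^sub>k\<close> show that the entry is
  killed by \<open>A\<^sub>q\<^sub>k\<close> from both sides. This last step genuinely uses \<open>[A, A]\<close> and not its quotient by the
  center: for \<open>4 \<times> 4\<close> matrices in characteristic 2 that quotient has further derivations.
\<close>

lemma der_entry:
  assumes I: "i \<in> I" "j \<in> I" "k \<in> I" "q \<in> I" and ne: "i \<noteq> j" "k \<noteq> i" "q \<noteq> j"
    and a: "a \<in> C i j" and b: "b \<in> carrier B"
  shows "l k (r q (der b a)) = \<zero>"
proof (cases "\<exists>m\<in>I. m \<noteq> i \<and> m \<noteq> j \<and> m \<noteq> k \<and> m \<noteq> q")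
  case True
  then obtain m where m: "m \<in> I" "m \<noteq> i" "m \<noteq> j" "m \<noteq> k" "m \<noteq> q"
    by blast
  let ?S = "{bracket A x y | x y. x \<in> C i m \<and> y \<in> C m j}"
  have "a \<in> span A ?S"
    using I ne m a by (intro comp_span_bracket)
  moreover have "?S \<subseteq> carrier A"
    by auto
  ultimately have "a \<in> K \<and> l k (r q (der b a)) = \<zero>"
  proof (induction rule: span_induct)
    case (base z)
    then obtain x y where xy: "x \<in> C i m" "y \<in> C m j" "z = bracket A x y"
      by blast
    then have K: "x \<in> K" "y \<in> K"
      using I m comp_K[of i m x] comp_K[of m j y] by auto
    then show ?case
      using xy I ne m b entry_bracket[of m j k q y "der b x"] entry_bracket[of i m k q x "der b y"]
      by (simp add: der_bracket l_add r_add)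
  qed (use I b in \<open>auto simp: der_add der_neg l_add r_add l_map_neg r_map_neg\<close>)
  then show ?thesis ..
next
  case False
  have "I \<subseteq> {i, j, k, q}"
    using False by blast
  then have "card {i, j, k, q} \<ge> 4"
    using card_I card_mono[of "{i, j, k, q}" I] by simp
  then have dist: "k \<noteq> j" "k \<noteq> q" "q \<noteq> i"
    by (auto simp: card_insert_if split: if_splits)
  define x where "x = l k (r q (der b a))"
  have aK: "a \<in> K"
    using I ne a by (intro comp_K)
  then have X: "der b a \<in> carrier A"
    using b by simp
  have *: "x \<otimes> c = \<zero> \<and> c \<otimes> x = \<zero>" if c: "c \<in> C q k" for c
  proof -
    have cc: "c \<in> carrier A" "l q c = c" "r k c = c" "l k c = \<zero>" "r q c = \<zero>"
      using c comp_l[of q _ c k] comp_r[of k _ c q] I dist by auto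
    have cK: "c \<in> K"
      using I dist c by (intro comp_K[of q k]) auto
    have "bracket A a c = \<zero>"
      using comp_mult_zero[of j q a i c k] comp_mult_zero[of k i c q a j] I ne dist a c
      by (simp add: bracket_def)
    then have sum: "bracket A (der b a) c \<oplus> bracket A a (der b c) = \<zero>"
      using der_bracket[OF b aK cK] b by simp
    have 1: "l p (r p (bracket A (der b a) c)) = \<zero>" if p: "p \<in> I" "p \<noteq> i" "p \<noteq> j" for p
    proof -
      have "l p (r p (bracket A a (der b c))) = \<zero>"
        using I p a b cK by (intro entry_bracket(2)[of i j]) auto
      moreover have "l p (r p (bracket A (der b a) c \<oplus> bracket A a (der b c))) =
          l p (r p (bracket A (der b a) c)) \<oplus> l p (r p (bracket A a (der b c)))"
        using p(1) aK cK b by (simp add: l_add r_add)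
      ultimately show ?thesis
        unfolding sum using p(1) aK cK b by simp
    qed
    have "l k (r k (bracket A (der b a) c)) = l k (der b a) \<otimes> c"
      using X cc I by (simp add: bracket_def r_map_diff l_map_diff r_mult l_mult)
    also have "\<dots> = x \<otimes> c"
      using X cc I mid[of q "l k (der b a)" c] by (simp add: x_def l_r)
    finally have "x \<otimes> c = \<zero>"
      using 1[of k] I ne dist by simp
    moreover have "c \<otimes> x = \<zero>"
    proof -
      have "l q (r q (bracket A (der b a) c)) = \<ominus> (c \<otimes> r q (der b a))"
        using X cc I by (simp add: bracket_def r_map_diff l_map_diff l_map_neg r_mult l_mult)
      then have "\<ominus> (c \<otimes> r q (der b a)) = \<zero>"
        using 1[of q] I ne dist by simp
      then have "c \<otimes> r q (der b a) = \<zero>"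
        using X cc I minus_minus[of "c \<otimes> r q (der b a)"] by (simp add: neg_zero)
      then show ?thesis
        unfolding x_def using mid[of k c "r q (der b a)"] X cc I by simp
    qed
    ultimately show ?thesis
      by simp
  qed
  show ?thesis
    unfolding x_def[symmetric]
    by (rule nondegenerate[of k q k q]) (use I dist X * in \<open>auto simp: x_def intro: comp_entry\<close>)
qed

text \<open>
  The way in which products with \<open>f b\<close> are computed: \<open>b\<close> is replaced by a bracket through an auxiliary
  index \<open>m\<close> that suits the other factor.
\<close>

lemma f_comp_induct:
  assumes "i \<in> I" "j \<in> I" "m \<in> I" "i \<noteq> j" "m \<noteq> i" "m \<noteq> j" and b: "b \<in> C i j"
    and zero: "P \<zero>\<^bsub>B\<^esub>"
    and neg: "\<And>x. x \<in> carrier B \<Longrightarrow> P x \<Longrightarrow> P (\<ominus>\<^bsub>B\<^esub> x)"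
    and add: "\<And>x y. x \<in> carrier B \<Longrightarrow> y \<in> carrier B \<Longrightarrow> P x \<Longrightarrow> P y \<Longrightarrow> P (x \<oplus>\<^bsub>B\<^esub> y)"
    and base: "\<And>x y. x \<in> C i m \<Longrightarrow> y \<in> C m j \<Longrightarrow> P (bracket B (f x) (f y))"
  shows "P (f b)"
proof -
  let ?S = "{bracket A x y | x y. x \<in> C i m \<and> y \<in> C m j}"
  have "b \<in> span A ?S"
    using assms by (intro comp_span_bracket)
  moreover have "?S \<subseteq> carrier A"
    by auto
  ultimately have "b \<in> K \<and> P (f b)"
  proof (induction rule: span_induct)
    case (base z)
    then obtain x y where xy: "x \<in> C i m" "y \<in> C m j" "z = bracket A x y"
      by blast
    then have "x \<in> K" "y \<in> K"
      using assms comp_K[of i m x] comp_K[of m j y] by auto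
    then show ?case
      using xy assms(11)[of x y] by (simp add: f_bracket)
  qed (use zero neg add in \<open>auto simp: f_add f_neg\<close>)
  then show ?thesis ..
qed

lemma f_comp_closed: "i \<in> I \<Longrightarrow> j \<in> I \<Longrightarrow> i \<noteq> j \<Longrightarrow> a \<in> C i j \<Longrightarrow> f a \<in> carrier B"
  by (blast intro: comp_K f_closed)

lemma f_commute:
  assumes "i \<in> I" "j \<in> I" "k \<in> I" "q \<in> I" "i \<noteq> j" "k \<noteq> q" "j \<noteq> k" "i \<noteq> q" "a \<in> C i j" "b \<in> C k q"
  shows "f a \<otimes>\<^bsub>B\<^esub> f b = f b \<otimes>\<^bsub>B\<^esub> f a"
proof -
  have "a \<in> K" "b \<in> K"
    using assms comp_K[of i j a] comp_K[of k q b] by auto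
  moreover have "bracket A a b = \<zero>"
    using comp_mult_zero[of j k a i b q] comp_mult_zero[of q i b k a j] assms
    by (simp add: bracket_def)
  ultimately have "bracket B (f a) (f b) = \<zero>\<^bsub>B\<^esub>"
    using f_bracket[of a b] by simp
  then show ?thesis
    unfolding bracket_def using \<open>a \<in> K\<close> \<open>b \<in> K\<close> by (intro B.minus_eq_zeroD[of "f a \<otimes>\<^bsub>B\<^esub> f b" "f b \<otimes>\<^bsub>B\<^esub> f a"] B.m_closed f_closed)
qed

text \<open>
  The images of the commutators supported in the union of row \<open>p\<close> and column \<open>q\<close>, which is where
  \<open>[B, f A\<^sub>p\<^sub>q]\<close> lies by \<open>der_entry\<close>.
\<close>

definition hook :: "'i \<Rightarrow> 'i \<Rightarrow> 'b set"
  where "hook p q = f ` {y \<in> K. \<forall>k\<in>I. \<forall>m\<in>I. k \<noteq> p \<longrightarrow> m \<noteq> q \<longrightarrow> l k (r m y) = \<zero>}"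

lemma hook_zero: "\<zero>\<^bsub>B\<^esub> \<in> hook p q"
  unfolding hook_def by (rule image_eqI[of _ _ \<zero>]) auto

lemma hook_neg: "x \<in> hook p q \<Longrightarrow> \<ominus>\<^bsub>B\<^esub> x \<in> hook p q"
  unfolding hook_def by (auto simp: f_neg[symmetric] l_map_neg r_map_neg neg_zero intro!: imageI)

lemma hook_add: "x \<in> hook p q \<Longrightarrow> y \<in> hook p q \<Longrightarrow> x \<oplus>\<^bsub>B\<^esub> y \<in> hook p q"
  unfolding hook_def by (auto simp: f_add[symmetric] l_add r_add intro!: imageI)

lemma hook_entry:
  "\<lbrakk>f y \<in> hook p q; y \<in> K; k \<in> I; m \<in> I; k \<noteq> p; m \<noteq> q\<rbrakk> \<Longrightarrow> l k (r m y) = \<zero>"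
  unfolding hook_def using f_eq_iff by auto

lemma bracket_hook:
  assumes "p \<in> I" "q \<in> I" "p \<noteq> q" "a \<in> C p q" "b \<in> carrier B"
  shows "bracket B b (f a) \<in> hook p q" and "bracket B (f a) b \<in> hook p q"
proof -
  have "a \<in> K"
    using assms comp_K by blast
  then show 1: "bracket B b (f a) \<in> hook p q"
    unfolding hook_def using assms by (intro image_eqI[of _ _ "der b a"]) (auto simp: f_der der_entry)
  show "bracket B (f a) b \<in> hook p q"
    using hook_neg[OF 1] assms \<open>a \<in> K\<close> by (simp add: B.bracket_neg)
qed

text \<open>
  The product lies in three hooks, and they meet in the place \<open>(i, j)\<close> only.
\<close>

lemma f_mult_in_comp:
  assumes I: "i \<in> I" "k \<in> I" "j \<in> I" and ne: "i \<noteq> k" "k \<noteq> j" "i \<noteq> j"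
    and a: "a \<in> C i k" and b: "b \<in> C k j"
  shows "f a \<otimes>\<^bsub>B\<^esub> f b \<in> f ` C i j"
proof -
  obtain m where m: "m \<in> I" "m \<noteq> i" "m \<noteq> k" "m \<noteq> j"
    using fresh by blast
  note cl = f_comp_closed
  have fa: "f a \<in> carrier B" and fb: "f b \<in> carrier B"
    using I ne a b cl[of i k a] cl[of k j b] by auto
  \<comment> \<open>through \<open>b = [x, y]\<close> with \<open>y \<in> A\<^sub>m\<^sub>j\<close>, which commutes with \<open>a\<close>\<close>
  have "f a \<otimes>\<^bsub>B\<^esub> f b \<in> hook m j"
  proof (rule f_comp_induct[where b = b and i = k and j = j and m = m])
    fix x y assume xy: "x \<in> C k m" "y \<in> C m j"
    have "f a \<otimes>\<^bsub>B\<^esub> bracket B (f x) (f y) = bracket B (f a \<otimes>\<^bsub>B\<^esub> f x) (f y)"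
      using I ne m a xy fa cl[of k m x] cl[of m j y] f_commute[of i k m j a y]
      by (intro B.mult_bracket_left) auto
    then show "f a \<otimes>\<^bsub>B\<^esub> bracket B (f x) (f y) \<in> hook m j"
      using bracket_hook(1)[of m j y] I ne m xy fa cl[of k m x] by auto
  qed (use I ne m b fa in \<open>auto simp: hook_zero hook_neg hook_add B.r_distr B.r_minus\<close>)
  \<comment> \<open>through \<open>b = [x, y]\<close> with \<open>y \<in> A\<^sub>i\<^sub>j\<close>, which commutes with \<open>a\<close>\<close>
  moreover have "f a \<otimes>\<^bsub>B\<^esub> f b \<in> hook i j"
  proof (rule f_comp_induct[where b = b and i = k and j = j and m = i])
    fix x y assume xy: "x \<in> C k i" "y \<in> C i j"
    have "f a \<otimes>\<^bsub>B\<^esub> bracket B (f x) (f y) = bracket B (f a \<otimes>\<^bsub>B\<^esub> f x) (f y)"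
      using I ne m a xy fa cl[of k i x] cl[of i j y] f_commute[of i k i j a y]
      by (intro B.mult_bracket_left) auto
    then show "f a \<otimes>\<^bsub>B\<^esub> bracket B (f x) (f y) \<in> hook i j"
      using bracket_hook(1)[of i j y] I ne m xy fa cl[of k i x] by auto
  qed (use I ne m b fa in \<open>auto simp: hook_zero hook_neg hook_add B.r_distr B.r_minus\<close>)
  \<comment> \<open>through \<open>a = [x, y]\<close> with \<open>x \<in> A\<^sub>i\<^sub>m\<close>, which commutes with \<open>b\<close>\<close>
  moreover have "f a \<otimes>\<^bsub>B\<^esub> f b \<in> hook i m"
  proof (rule f_comp_induct[where b = a and i = i and j = k and m = m])
    fix x y assume xy: "x \<in> C i m" "y \<in> C m k"
    have "bracket B (f x) (f y) \<otimes>\<^bsub>B\<^esub> f b = bracket B (f x) (f y \<otimes>\<^bsub>B\<^esub> f b)"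
      using I ne m b xy fb cl[of i m x] cl[of m k y] f_commute[of i m k j x b]
      by (intro B.bracket_mult_left) auto
    then show "bracket B (f x) (f y) \<otimes>\<^bsub>B\<^esub> f b \<in> hook i m"
      using bracket_hook(2)[of i m x] I ne m xy fb cl[of m k y] by auto
  qed (use I ne m a fb in \<open>auto simp: hook_zero hook_neg hook_add B.l_distr B.l_minus\<close>)
  ultimately have hooks: "f a \<otimes>\<^bsub>B\<^esub> f b \<in> hook m j" "f a \<otimes>\<^bsub>B\<^esub> f b \<in> hook i j" "f a \<otimes>\<^bsub>B\<^esub> f b \<in> hook i m"
    by blast+
  then obtain y where y: "y \<in> K" "f a \<otimes>\<^bsub>B\<^esub> f b = f y"
    unfolding hook_def by blast
  have "l p (r q y) = \<zero>" if "p \<in> I" "q \<in> I" "p \<noteq> i \<or> q \<noteq> j" for p q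
  proof (cases "q = j")
    case True
    then show ?thesis
      using hook_entry[of y i m p q] hooks(3) y that m by simp
  next
    case False
    then show ?thesis
      using hook_entry[of y m j p q] hook_entry[of y i j p q] hooks(1,2) y that m by (cases "p = i") auto
  qed
  then have "y \<in> C i j"
    using I y(1) by (intro compI K_carrier) blast+
  then show ?thesis
    using y by auto
qed

text \<open>
  With \<open>b = [x, y]\<close>, \<open>x \<in> A\<^sub>k\<^sub>j\<close> and \<open>y \<in> A\<^sub>j\<^sub>q\<close>, the product is the bracket of \<open>f x\<close> with an element of
  \<open>f A\<^sub>i\<^sub>j \<cdot> f A\<^sub>j\<^sub>q \<subseteq> f A\<^sub>i\<^sub>q\<close>, and \<open>A\<^sub>k\<^sub>j\<close> commutes with \<open>A\<^sub>i\<^sub>q\<close>. The remaining cases reduce to this one through a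
  fourth index.
\<close>

lemma f_mult_zero_distinct:
  assumes I: "i \<in> I" "j \<in> I" "k \<in> I" "q \<in> I"
    and ne: "i \<noteq> j" "i \<noteq> k" "i \<noteq> q" "j \<noteq> k" "j \<noteq> q" "k \<noteq> q" and a: "a \<in> C i j" and b: "b \<in> C k q"
  shows "f a \<otimes>\<^bsub>B\<^esub> f b = \<zero>\<^bsub>B\<^esub>"
proof -
  have fa: "f a \<in> carrier B"
    using I ne a f_comp_closed by blast
  show ?thesis
  proof (rule f_comp_induct[where b = b and i = k and j = q and m = j])
    fix x y assume xy: "x \<in> C k j" "y \<in> C j q"
    have fx: "f x \<in> carrier B" "f y \<in> carrier B"
      using xy I ne f_comp_closed[of k j x] f_comp_closed[of j q y] by auto
    obtain c where c: "c \<in> C i q" "f a \<otimes>\<^bsub>B\<^esub> f y = f c"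
      using f_mult_in_comp[of i j q a y] I ne a xy by auto
    have "f a \<otimes>\<^bsub>B\<^esub> bracket B (f x) (f y) = bracket B (f x) (f a \<otimes>\<^bsub>B\<^esub> f y)"
      using I ne a xy fa fx f_commute[of i j k j a x] by (intro B.mult_bracket_right) auto
    also have "\<dots> = \<zero>\<^bsub>B\<^esub>"
      using f_commute[of k j i q x c] c xy fx f_comp_closed[of i q c] I ne
      by (simp add: bracket_def B.minus_self)
    finally show "f a \<otimes>\<^bsub>B\<^esub> bracket B (f x) (f y) = \<zero>\<^bsub>B\<^esub>" .
  qed (use I ne b fa in \<open>auto simp: B.r_distr B.r_minus B.neg_zero\<close>)
qed

lemma f_mult_zero_row:
  assumes I: "i \<in> I" "j \<in> I" "q \<in> I" and ne: "i \<noteq> j" "i \<noteq> q" "j \<noteq> q" and a: "a \<in> C i j" and b: "b \<in> C i q"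
  shows "f a \<otimes>\<^bsub>B\<^esub> f b = \<zero>\<^bsub>B\<^esub>"
proof -
  obtain m where m: "m \<in> I" "m \<noteq> i" "m \<noteq> j" "m \<noteq> q"
    using fresh by blast
  have fa: "f a \<in> carrier B"
    using I ne a f_comp_closed by blast
  show ?thesis
  proof (rule f_comp_induct[where b = b and i = i and j = q and m = m])
    fix x y assume xy: "x \<in> C i m" "y \<in> C m q"
    have fx: "f x \<in> carrier B" "f y \<in> carrier B"
      using xy I ne m f_comp_closed[of i m x] f_comp_closed[of m q y] by auto
    have "f a \<otimes>\<^bsub>B\<^esub> bracket B (f x) (f y) = bracket B (f x) (f a \<otimes>\<^bsub>B\<^esub> f y)"
      using I ne m a xy fa fx f_commute[of i j i m a x] by (intro B.mult_bracket_right) auto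
    then show "f a \<otimes>\<^bsub>B\<^esub> bracket B (f x) (f y) = \<zero>\<^bsub>B\<^esub>"
      using f_mult_zero_distinct[of i j m q a y] a xy fx I ne m by simp
  qed (use I ne m b fa in \<open>auto simp: B.r_distr B.r_minus B.neg_zero\<close>)
qed

lemma f_mult_zero_column:
  assumes I: "i \<in> I" "j \<in> I" "k \<in> I" and ne: "i \<noteq> j" "k \<noteq> j" and a: "a \<in> C i j" and b: "b \<in> C k j"
  shows "f a \<otimes>\<^bsub>B\<^esub> f b = \<zero>\<^bsub>B\<^esub>"
proof -
  obtain m where m: "m \<in> I" "m \<noteq> i" "m \<noteq> j" "m \<noteq> k"
    using fresh by blast
  have fa: "f a \<in> carrier B"
    using I ne a f_comp_closed by blast
  show ?thesis
  proof (rule f_comp_induct[where b = b and i = k and j = j and m = m])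
    fix x y assume xy: "x \<in> C k m" "y \<in> C m j"
    have fx: "f x \<in> carrier B" "f y \<in> carrier B"
      using xy I ne m f_comp_closed[of k m x] f_comp_closed[of m j y] by auto
    have "f a \<otimes>\<^bsub>B\<^esub> bracket B (f x) (f y) = bracket B (f a \<otimes>\<^bsub>B\<^esub> f x) (f y)"
      using I ne m a xy fa fx f_commute[of i j m j a y] by (intro B.mult_bracket_left) auto
    moreover have "f a \<otimes>\<^bsub>B\<^esub> f x = \<zero>\<^bsub>B\<^esub>"
    proof (cases "k = i")
      case True
      then show ?thesis
        using f_mult_zero_row[of i j m a x] a xy I ne m by simp
    next
      case False
      then show ?thesis
        using f_mult_zero_distinct[of i j k m a x] a xy I ne m by simp
    qed
    ultimately show "f a \<otimes>\<^bsub>B\<^esub> bracket B (f x) (f y) = \<zero>\<^bsub>B\<^esub>"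
      using fx by simp
  qed (use I ne m b fa in \<open>auto simp: B.r_distr B.r_minus B.neg_zero\<close>)
qed

lemma f_mult_zero:
  assumes "i \<in> I" "j \<in> I" "k \<in> I" "q \<in> I" "i \<noteq> j" "k \<noteq> q" "j \<noteq> k" "i \<noteq> q" "a \<in> C i j" "b \<in> C k q"
  shows "f a \<otimes>\<^bsub>B\<^esub> f b = \<zero>\<^bsub>B\<^esub>"
proof -
  consider "i = k" "j = q" | "i = k" "j \<noteq> q" | "i \<noteq> k" "j = q" | "i \<noteq> k" "j \<noteq> q"
    by blast
  then show ?thesis
  proof cases
    case 1
    show ?thesis
      using f_mult_zero_column[OF assms(1,2,3,5) _ assms(9)] assms(6,10) unfolding 1 by blast
  next
    case 2
    show ?thesis
      using f_mult_zero_row[OF assms(1,2,4,5,8) 2(2) assms(9)] assms(10) unfolding 2(1) by blast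
  next
    case 3
    show ?thesis
      using f_mult_zero_column[OF assms(1,2,3,5) _ assms(9)] assms(6,10) unfolding 3 by blast
  next
    case 4
    show ?thesis
      using f_mult_zero_distinct[OF assms(1-4,5) 4(1) assms(8,7) 4(2) assms(6,9,10)] .
  qed
qed

end

section \<open>Direct products\<close>

lemma RDirProd_simps [simp]:
  "carrier (RDirProd R S) = carrier R \<times> carrier S"
  "zero (RDirProd R S) = (zero R, zero S)"
  "x \<oplus>\<^bsub>RDirProd R S\<^esub> y = (fst x \<oplus>\<^bsub>R\<^esub> fst y, snd x \<oplus>\<^bsub>S\<^esub> snd y)"
  "x \<otimes>\<^bsub>RDirProd R S\<^esub> y = (fst x \<otimes>\<^bsub>R\<^esub> fst y, snd x \<otimes>\<^bsub>S\<^esub> snd y)"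
  by (auto simp: RDirProd_def DirProd_def monoid.defs case_prod_unfold)

lemma abelian_group_RDirProd:
  assumes "abelian_group R" and "abelian_group S"
  shows "abelian_group (RDirProd R S)"
proof -
  interpret R: abelian_group R by fact
  interpret S: abelian_group S by fact
  show ?thesis
  proof (rule abelian_groupI)
    fix x assume "x \<in> carrier (RDirProd R S)"
    then show "\<exists>y\<in>carrier (RDirProd R S). y \<oplus>\<^bsub>RDirProd R S\<^esub> x = \<zero>\<^bsub>RDirProd R S\<^esub>"
      by (intro bexI[of _ "(\<ominus>\<^bsub>R\<^esub> fst x, \<ominus>\<^bsub>S\<^esub> snd x)"]) (auto simp: R.l_neg S.l_neg)
  qed (auto simp: R.a_ac S.a_ac)
qed

lemma RDirProd_neg:
  assumes "abelian_group R" and "abelian_group S" and x: "x \<in> carrier R \<times> carrier S"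
  shows "\<ominus>\<^bsub>RDirProd R S\<^esub> x = (\<ominus>\<^bsub>R\<^esub> fst x, \<ominus>\<^bsub>S\<^esub> snd x)"
proof -
  interpret R: abelian_group R by fact
  interpret S: abelian_group S by fact
  interpret RS: abelian_group "RDirProd R S"
    by (rule abelian_group_RDirProd) fact+
  have "(\<ominus>\<^bsub>R\<^esub> fst x, \<ominus>\<^bsub>S\<^esub> snd x) \<oplus>\<^bsub>RDirProd R S\<^esub> x = \<zero>\<^bsub>RDirProd R S\<^esub>"
    using x by (auto simp: R.l_neg S.l_neg)
  then show ?thesis
    using x by (intro RS.minus_equality) auto
qed

lemma assoc_ring_RDirProd:
  assumes "assoc_ring R" and "assoc_ring S"
  shows "assoc_ring (RDirProd R S)"
proof -
  interpret R: assoc_ring R by fact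
  interpret S: assoc_ring S by fact
  show ?thesis
    by (intro assoc_ring.intro nonassoc_ring.intro nonassoc_ring_axioms.intro assoc_ring_axioms.intro
        abelian_group_RDirProd R.abelian_group_axioms S.abelian_group_axioms)
      (auto simp: R.l_distr S.l_distr R.r_distr S.r_distr R.m_assoc S.m_assoc)
qed

section \<open>Products of three images\<close>

context lie_ideal_map
begin

lemma f_mult_eq:
  assumes I: "i \<in> I" "k \<in> I" "j \<in> I" and ne: "i \<noteq> k" "k \<noteq> j" "i \<noteq> j" and a: "a \<in> C i k" and b: "b \<in> C k j"
  shows "f (a \<otimes> b) = f a \<otimes>\<^bsub>B\<^esub> f b \<ominus>\<^bsub>B\<^esub> f b \<otimes>\<^bsub>B\<^esub> f a"
proof -
  have "a \<in> K" "b \<in> K"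
    using I ne a b comp_K[of i k a] comp_K[of k j b] by auto
  then show ?thesis
    using f_bracket[of a b] bracket_comp[of i j a k b] I ne a b by (simp add: bracket_def)
qed

text \<open>
  The product \<open>f a \<cdot> f b\<close> behaves like an element of place \<open>(i, j)\<close> in an associative ring: on the right it
  is compatible with row \<open>j\<close> only. If \<open>q = k\<close> the factors \<open>f b\<close> and \<open>f c\<close> do not annihilate each other, but
  exchanging them costs only \<open>f (cb)\<close>, which \<open>f a\<close> annihilates.
\<close>

lemma f_triple_right:
  assumes I: "i \<in> I" "k \<in> I" "j \<in> I" "p \<in> I" "q \<in> I"
    and ne: "i \<noteq> k" "k \<noteq> j" "i \<noteq> j" "p \<noteq> q" "p \<noteq> j"
    and a: "a \<in> C i k" and b: "b \<in> C k j" and c: "c \<in> C p q"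
  shows "f a \<otimes>\<^bsub>B\<^esub> f b \<otimes>\<^bsub>B\<^esub> f c = \<zero>\<^bsub>B\<^esub>"
proof -
  have cl: "f a \<in> carrier B" "f b \<in> carrier B" "f c \<in> carrier B"
    using f_comp_closed[OF I(1,2) ne(1) a] f_comp_closed[OF I(2,3) ne(2) b]
      f_comp_closed[OF I(4,5) ne(4) c] .
  show ?thesis
  proof (cases "q = k")
    case False
    then have "f b \<otimes>\<^bsub>B\<^esub> f c = \<zero>\<^bsub>B\<^esub>"
      using f_mult_zero[of k j p q b c] I ne b c by simp
    then show ?thesis
      using cl by (simp add: B.m_assoc)
  next
    case True
    have c': "c \<in> C p k" and pk: "p \<noteq> k"
      using c ne(4) unfolding True .
    have cb: "c \<otimes> b \<in> C p j"
      using comp_mult[OF I(4,3) c' b] .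
    have cbl: "f (c \<otimes> b) \<in> carrier B"
      using f_comp_closed[OF I(4,3) ne(5) cb] .
    have "f a \<otimes>\<^bsub>B\<^esub> f (c \<otimes> b) = \<zero>\<^bsub>B\<^esub>" "f a \<otimes>\<^bsub>B\<^esub> f c = \<zero>\<^bsub>B\<^esub>"
      using f_mult_zero[OF I(1,2,4,3) ne(1,5) _ ne(3) a cb] f_mult_zero[OF I(1,2,4,2) ne(1) pk _ ne(1) a c'] pk
      by auto
    moreover have "f a \<otimes>\<^bsub>B\<^esub> f (c \<otimes> b) = f a \<otimes>\<^bsub>B\<^esub> f c \<otimes>\<^bsub>B\<^esub> f b \<ominus>\<^bsub>B\<^esub> f a \<otimes>\<^bsub>B\<^esub> f b \<otimes>\<^bsub>B\<^esub> f c"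
      using f_mult_eq[OF I(4,2,3) pk ne(2,5) c' b] cl by (simp add: B.r_diff B.m_assoc)
    ultimately have "\<ominus>\<^bsub>B\<^esub> (f a \<otimes>\<^bsub>B\<^esub> f b \<otimes>\<^bsub>B\<^esub> f c) = \<zero>\<^bsub>B\<^esub>"
      using cl by simp
    then show ?thesis
      using cl B.minus_minus[of "f a \<otimes>\<^bsub>B\<^esub> f b \<otimes>\<^bsub>B\<^esub> f c"] by (simp add: B.neg_zero)
  qed
qed

abbreviation R :: "('a \<times> 'b) ring"
  where "R \<equiv> RDirProd A B"

sublocale R: assoc_ring "RDirProd A B"
  by (rule assoc_ring_RDirProd) unfold_locales

lemma R_neg: "x \<in> carrier R \<Longrightarrow> \<ominus>\<^bsub>R\<^esub> x = (\<ominus> fst x, \<ominus>\<^bsub>B\<^esub> snd x)"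
  by (rule RDirProd_neg) (auto intro: abelian_group_axioms B.abelian_group_axioms)

definition graph_gens :: "'i \<Rightarrow> 'i \<Rightarrow> 'i \<Rightarrow> ('a \<times> 'b) set"
  where "graph_gens i k j = {(a \<otimes> b, f a \<otimes>\<^bsub>B\<^esub> f b) | a b. a \<in> C i k \<and> b \<in> C k j}"

text \<open>
  The graph of the associative part of \<open>f\<close> on \<open>A\<^sub>i\<^sub>j\<close>. Working with graphs in \<open>A \<times> B\<close> makes additivity and
  multiplicativity of this part automatic; that the graph is single valued is \<open>graph_inj\<close>.
\<close>

definition graph :: "'i \<Rightarrow> 'i \<Rightarrow> ('a \<times> 'b) set"
  where "graph i j = span R (\<Union>k\<in>I - {i, j}. graph_gens i k j)"

lemma graph_gens_closed:
  assumes "i \<in> I" "k \<in> I" "j \<in> I" "i \<noteq> k" "k \<noteq> j"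
  shows "graph_gens i k j \<subseteq> carrier R"
  using f_comp_closed[OF assms(1,2,4)] f_comp_closed[OF assms(2,3,5)]
  by (auto simp: graph_gens_def)

lemma graph_all_gens_closed:
  assumes "i \<in> I" "j \<in> I"
  shows "(\<Union>k\<in>I - {i, j}. graph_gens i k j) \<subseteq> carrier R"
proof (rule UN_least)
  fix k assume "k \<in> I - {i, j}"
  then show "graph_gens i k j \<subseteq> carrier R"
    using assms by (intro graph_gens_closed) auto
qed

lemma graph_closed: "i \<in> I \<Longrightarrow> j \<in> I \<Longrightarrow> g \<in> graph i j \<Longrightarrow> g \<in> carrier R"
  unfolding graph_def using R.span_closed[OF graph_all_gens_closed] .

lemma graph_zero: "\<zero>\<^bsub>R\<^esub> \<in> graph i j"
  unfolding graph_def by (rule R.span_zero)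

lemma graph_add: "g \<in> graph i j \<Longrightarrow> h \<in> graph i j \<Longrightarrow> g \<oplus>\<^bsub>R\<^esub> h \<in> graph i j"
  unfolding graph_def by (rule R.span_add)

lemma graph_neg: "i \<in> I \<Longrightarrow> j \<in> I \<Longrightarrow> g \<in> graph i j \<Longrightarrow> \<ominus>\<^bsub>R\<^esub> g \<in> graph i j"
  unfolding graph_def by (rule R.span_neg[OF graph_all_gens_closed])

lemma graph_base:
  "\<lbrakk>k \<in> I; k \<noteq> i; k \<noteq> j; a \<in> C i k; b \<in> C k j\<rbrakk> \<Longrightarrow> (a \<otimes> b, f a \<otimes>\<^bsub>B\<^esub> f b) \<in> graph i j"
  unfolding graph_def by (rule R.span_base) (auto simp: graph_gens_def)

lemma graph_induct [consumes 3, case_names zero base neg add]: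
  assumes "g \<in> graph i j" and I: "i \<in> I" "j \<in> I"
    and "P \<zero>\<^bsub>R\<^esub>"
    and "\<And>k a b. \<lbrakk>k \<in> I; k \<noteq> i; k \<noteq> j; a \<in> C i k; b \<in> C k j\<rbrakk> \<Longrightarrow> P (a \<otimes> b, f a \<otimes>\<^bsub>B\<^esub> f b)"
    and "\<And>x. x \<in> carrier R \<Longrightarrow> P x \<Longrightarrow> P (\<ominus>\<^bsub>R\<^esub> x)"
    and "\<And>x y. x \<in> carrier R \<Longrightarrow> y \<in> carrier R \<Longrightarrow> P x \<Longrightarrow> P y \<Longrightarrow> P (x \<oplus>\<^bsub>R\<^esub> y)"
  shows "P g"
  using assms(1) graph_all_gens_closed[OF I] unfolding graph_def
proof (induction rule: R.span_induct)
  case (base x)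
  then show ?case
    using assms(5) by (auto simp: graph_gens_def)
qed (use assms(4,6,7) in blast)+

lemma graph_fst:
  assumes "g \<in> graph i j" and I: "i \<in> I" "j \<in> I"
  shows "fst g \<in> C i j"
  using assms
proof (induction rule: graph_induct)
  case (base k a b)
  then show ?case
    using comp_mult[of i j a k b] I by simp
next
  case (neg x)
  then show ?case
    using R_neg[OF neg(1)] I by (simp add: comp_neg)
qed (use I in \<open>auto simp: comp_add\<close>)

lemma graph_snd:
  assumes "g \<in> graph i j" and I: "i \<in> I" "j \<in> I" and ne: "i \<noteq> j"
  shows "snd g \<in> f ` C i j"
  using assms(1-3)
proof (induction rule: graph_induct)
  case zero
  then show ?case
    using I by (intro image_eqI[of _ _ \<zero>]) auto
next
  case (base k a b)
  then show ?case
    using f_mult_in_comp[of i k j a b] I ne by simp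
next
  case (neg x)
  then obtain y where y: "y \<in> C i j" "snd x = f y"
    by blast
  then show ?case
    using R_neg[OF neg(1)] f_neg[of y] comp_K[OF I ne y(1)] comp_neg[OF I y(1)]
    by (intro image_eqI[of _ _ "\<ominus> y"]) auto
next
  case (add x z)
  then obtain y y' where y: "y \<in> C i j" "snd x = f y" "y' \<in> C i j" "snd z = f y'"
    by blast
  then show ?case
    using f_add[of y y'] comp_K[OF I ne y(1)] comp_K[OF I ne y(3)] comp_add[OF I y(1,3)]
    by (intro image_eqI[of _ _ "y \<oplus> y'"]) auto
qed

text \<open>
  Next to a factor \<open>f c\<close> of a place \<open>(j, q)\<close>, the associative part of \<open>f\<close> cannot be told from \<open>f\<close> itself,
  because the antiassociative part is annihilated there.
\<close>

lemma graph_mult_f: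
  assumes "g \<in> graph i j" and I: "i \<in> I" "j \<in> I" "q \<in> I" and ne: "i \<noteq> j" "q \<noteq> i" "q \<noteq> j" and c: "c \<in> C j q"
  shows "snd g \<otimes>\<^bsub>B\<^esub> f c = f (fst g) \<otimes>\<^bsub>B\<^esub> f c" and "f c \<otimes>\<^bsub>B\<^esub> snd g = \<zero>\<^bsub>B\<^esub>"
proof -
  have fc: "f c \<in> carrier B"
    using f_comp_closed[OF I(2,3) _ c] ne by blast
  have "fst g \<in> K \<and> snd g \<otimes>\<^bsub>B\<^esub> f c = f (fst g) \<otimes>\<^bsub>B\<^esub> f c \<and> f c \<otimes>\<^bsub>B\<^esub> snd g = \<zero>\<^bsub>B\<^esub>"
    using assms(1-3)
  proof (induction rule: graph_induct)
    case (base k a b)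
    have cl: "f a \<in> carrier B" "f b \<in> carrier B"
      using f_comp_closed[of i k a] f_comp_closed[of k j b] base I by auto
    have 1: "f a \<otimes>\<^bsub>B\<^esub> f c = \<zero>\<^bsub>B\<^esub>" "f c \<otimes>\<^bsub>B\<^esub> f a = \<zero>\<^bsub>B\<^esub>"
      using f_mult_zero[of i k j q a c] f_mult_zero[of j q i k c a] base I ne c by auto
    have "f (a \<otimes> b) \<otimes>\<^bsub>B\<^esub> f c = f a \<otimes>\<^bsub>B\<^esub> f b \<otimes>\<^bsub>B\<^esub> f c \<ominus>\<^bsub>B\<^esub> f b \<otimes>\<^bsub>B\<^esub> (f a \<otimes>\<^bsub>B\<^esub> f c)"
      using f_mult_eq[of i k j a b] base I ne cl fc by (simp add: B.l_diff B.m_assoc)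
    moreover have "f c \<otimes>\<^bsub>B\<^esub> (f a \<otimes>\<^bsub>B\<^esub> f b) = (f c \<otimes>\<^bsub>B\<^esub> f a) \<otimes>\<^bsub>B\<^esub> f b"
      using cl fc by (simp add: B.m_assoc)
    moreover have "a \<otimes> b \<in> K"
      using base I ne comp_mult[of i j a k b] comp_K[of i j "a \<otimes> b"] by simp
    ultimately show ?case
      using cl fc 1 by simp
  next
    case (neg x)
    then show ?case
      using R_neg[OF neg(1)] fc by (auto simp: f_neg B.l_minus B.r_minus B.neg_zero)
  qed (use fc in \<open>auto simp: f_add B.l_distr B.r_distr\<close>)
  then show "snd g \<otimes>\<^bsub>B\<^esub> f c = f (fst g) \<otimes>\<^bsub>B\<^esub> f c" "f c \<otimes>\<^bsub>B\<^esub> snd g = \<zero>\<^bsub>B\<^esub>"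
    by blast+
qed

end

section \<open>Two symmetries\<close>

context lie_ideal_map
begin

text \<open>
  Passing to the opposite ring of \<open>A\<close> alone, with a change of sign, exchanges the associative and the
  antiassociative part.
\<close>

lemma lie_ideal_map_dual: "lie_ideal_map (op_ring A) I r l B (\<lambda>a. \<ominus>\<^bsub>B\<^esub> f a)"
proof (intro lie_ideal_map.intro lie_ideal_map_axioms.intro peirce_ring_op B.assoc_ring_axioms)
  show "inj_on (\<lambda>a. \<ominus>\<^bsub>B\<^esub> f a) (commutators (op_ring A))"
  proof (rule inj_onI)
    fix x y assume "x \<in> commutators (op_ring A)" "y \<in> commutators (op_ring A)"
      and eq: "\<ominus>\<^bsub>B\<^esub> f x = \<ominus>\<^bsub>B\<^esub> f y"
    then have xy: "x \<in> K" "y \<in> K"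
      by simp_all
    have "f x = f y"
      using arg_cong[OF eq, of "a_inv B"] unfolding B.minus_minus[OF f_closed[OF xy(1)]] B.minus_minus[OF f_closed[OF xy(2)]] .
    then show "x = y"
      using f_eq_iff[OF xy] by blast
  qed
next
  fix a b assume "a \<in> commutators (op_ring A)" "b \<in> commutators (op_ring A)"
  then have ab: "a \<in> K" "b \<in> K"
    by simp_all
  have "bracket B (\<ominus>\<^bsub>B\<^esub> f a) (\<ominus>\<^bsub>B\<^esub> f b) = bracket B (f a) (f b)"
    using ab by (simp add: B.bracket_minus_left B.bracket_minus_right B.minus_minus)
  also have "\<dots> = \<ominus>\<^bsub>B\<^esub> f (bracket A b a)"
    using ab by (simp add: f_bracket B.bracket_neg)
  finally show "\<ominus>\<^bsub>B\<^esub> f (bracket (op_ring A) a b) = bracket B (\<ominus>\<^bsub>B\<^esub> f a) (\<ominus>\<^bsub>B\<^esub> f b)"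
    by simp
next
  fix s a assume s: "s \<in> carrier B" and "a \<in> commutators (op_ring A)"
  then have a: "a \<in> K"
    by simp
  obtain c where c: "c \<in> K" "bracket B s (f a) = f c"
    using f_ideal[OF s a] by blast
  have "bracket B s (\<ominus>\<^bsub>B\<^esub> f a) = \<ominus>\<^bsub>B\<^esub> f c"
    using B.bracket_minus_right[OF s f_closed[OF a]] c by simp
  then show "bracket B s (\<ominus>\<^bsub>B\<^esub> f a) \<in> (\<lambda>a. \<ominus>\<^bsub>B\<^esub> f a) ` commutators (op_ring A)"
    using c(1) by (intro image_eqI[of _ _ c]) simp_all
next
  fix a b assume "a \<in> commutators (op_ring A)" "b \<in> commutators (op_ring A)"
  then show "\<ominus>\<^bsub>B\<^esub> f (a \<oplus>\<^bsub>op_ring A\<^esub> b) = \<ominus>\<^bsub>B\<^esub> f a \<oplus>\<^bsub>B\<^esub> \<ominus>\<^bsub>B\<^esub> f b"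
    by (simp add: f_add B.minus_add)
qed simp

text \<open>
  Passing to the opposite rings on both sides exchanges left and right but preserves the two parts.
\<close>

lemma lie_ideal_map_mirror: "lie_ideal_map (op_ring A) I r l (op_ring B) f"
proof (intro lie_ideal_map.intro lie_ideal_map_axioms.intro peirce_ring_op B.assoc_ring_op)
  fix s a assume s: "s \<in> carrier (op_ring B)" and "a \<in> commutators (op_ring A)"
  then have a: "a \<in> K" and sB: "s \<in> carrier B"
    by simp_all
  obtain c where c: "c \<in> K" "bracket B s (f a) = f c"
    using f_ideal[OF sB a] by blast
  have "bracket B (f a) s = f (\<ominus> c)"
    using B.bracket_neg[OF sB f_closed[OF a]] c f_neg[OF c(1)] by simp
  then show "bracket (op_ring B) s (f a) \<in> f ` commutators (op_ring A)"
    using c(1) by simp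
qed (use f_inj in \<open>simp_all add: f_add f_bracket\<close>)

lemma span_mirror: "span (RDirProd (op_ring A) (op_ring B)) S = span R S"
proof -
  have "add (RDirProd (op_ring A) (op_ring B)) = add R"
    by (intro ext) simp
  then show ?thesis
    unfolding span_def by simp
qed

lemma mult_mirror: "x \<otimes>\<^bsub>RDirProd (op_ring A) (op_ring B)\<^esub> y = y \<otimes>\<^bsub>R\<^esub> x"
  by simp

lemma zero_mirror: "\<zero>\<^bsub>RDirProd (op_ring A) (op_ring B)\<^esub> = \<zero>\<^bsub>R\<^esub>"
  by simp

interpretation mirror: lie_ideal_map "op_ring A" I r l "op_ring B" f
  by (rule lie_ideal_map_mirror)

lemma f_triple_left:
  assumes "i \<in> I" "k \<in> I" "j \<in> I" "p \<in> I" "q \<in> I"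
    and "i \<noteq> k" "k \<noteq> j" "i \<noteq> j" "p \<noteq> q" "q \<noteq> i"
    and "a \<in> C i k" "b \<in> C k j" "c \<in> C p q"
  shows "f c \<otimes>\<^bsub>B\<^esub> (f a \<otimes>\<^bsub>B\<^esub> f b) = \<zero>\<^bsub>B\<^esub>"
  using mirror.f_triple_right[of j k i q p b a c] assms by simp

lemma graph_mirror: "mirror.graph i j = graph j i"
proof -
  have "mirror.graph_gens i k j = graph_gens j k i" for k
    unfolding mirror.graph_gens_def graph_gens_def by auto
  moreover have "{i, j} = {j, i}"
    by blast
  ultimately show ?thesis
    unfolding mirror.graph_def graph_def span_mirror by simp
qed

lemma f_mult_graph:
  assumes "g \<in> graph i j" and I: "i \<in> I" "j \<in> I" "q \<in> I" and ne: "i \<noteq> j" "q \<noteq> i" "q \<noteq> j" and c: "c \<in> C q i"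
  shows "f c \<otimes>\<^bsub>B\<^esub> snd g = f c \<otimes>\<^bsub>B\<^esub> f (fst g)" and "snd g \<otimes>\<^bsub>B\<^esub> f c = \<zero>\<^bsub>B\<^esub>"
  using mirror.graph_mult_f[of g j i q c, unfolded graph_mirror] assms by simp_all

end

section \<open>The graph of the associative part\<close>

context lie_ideal_map
begin

text \<open>
  If \<open>(0, f z)\<close> with \<open>z \<in> A\<^sub>i\<^sub>j\<close> belongs to the graph, then \<open>f z\<close> annihilates \<open>f A\<^sub>j\<^sub>q\<close> and \<open>f A\<^sub>q\<^sub>i\<close> from both
  sides, so \<open>z\<close> commutes with \<open>A\<^sub>j\<^sub>q\<close> and \<open>A\<^sub>q\<^sub>i\<close> and vanishes by nondegeneracy.
\<close>

lemma graph_inj: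
  assumes g: "g \<in> graph i j" and I: "i \<in> I" "j \<in> I" and ne: "i \<noteq> j" and zero: "fst g = \<zero>"
  shows "g = \<zero>\<^bsub>R\<^esub>"
proof -
  obtain z where z: "z \<in> C i j" "snd g = f z"
    using graph_snd[OF g I ne] by blast
  obtain q where q: "q \<in> I" "q \<noteq> i" "q \<noteq> j"
    using fresh by blast
  have zK: "z \<in> K"
    using comp_K[OF I ne z(1)] .
  have "z \<otimes> c = \<zero>" if c: "c \<in> C j q" for c
  proof -
    have cK: "c \<in> K"
      using comp_K[OF I(2) q(1) _ c] q by blast
    have "f (bracket A z c) = \<zero>\<^bsub>B\<^esub>"
      using graph_mult_f[OF g I q(1) ne q(2,3) c] z zero f_bracket[OF zK cK] cK by (simp add: bracket_def)
    then have "bracket A z c = \<zero>"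
      using f_eq_iff[of "bracket A z c" \<zero>] zK cK by simp
    then show ?thesis
      using bracket_comp[of i q z j c] I q z c by simp
  qed
  moreover have "c \<otimes> z = \<zero>" if c: "c \<in> C q i" for c
  proof -
    have cK: "c \<in> K"
      using comp_K[OF q(1) I(1) _ c] q by blast
    have "f (bracket A c z) = \<zero>\<^bsub>B\<^esub>"
      using f_mult_graph[OF g I q(1) ne q(2,3) c] z zero f_bracket[OF cK zK] cK by (simp add: bracket_def)
    then have "bracket A c z = \<zero>"
      using f_eq_iff[of "bracket A c z" \<zero>] zK cK by simp
    then show ?thesis
      using bracket_comp[of q j c i z] I q z c by simp
  qed
  ultimately have "z = \<zero>"
    using nondegenerate[OF I ne q(1,1) z(1)] by blast
  then show ?thesis
    using zero z by (simp add: prod_eq_iff)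
qed

lemma span_lift:
  assumes x: "x \<in> span A S" and S: "S \<subseteq> carrier A" and T: "T \<subseteq> carrier R"
    and base: "\<And>s. s \<in> S \<Longrightarrow> \<exists>t\<in>T. fst t = s"
  shows "\<exists>t\<in>span R T. fst t = x"
  using x S
proof (induction rule: span_induct)
  case zero
  then show ?case
    by (intro bexI[of _ "\<zero>\<^bsub>R\<^esub>"] R.span_zero) simp
next
  case (base s)
  then show ?case
    using assms(4)[of s] R.span_base[of _ T] by blast
next
  case (neg z)
  then obtain g where g: "g \<in> span R T" "fst g = z"
    by blast
  then show ?case
    using R_neg[OF R.span_closed[OF T g(1)]] R.span_neg[OF T g(1)]
    by (intro bexI[of _ "\<ominus>\<^bsub>R\<^esub> g"]) auto
next
  case (add z w)
  then obtain g h where g: "g \<in> span R T" "fst g = z" "h \<in> span R T" "fst h = w"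
    by blast
  then show ?case
    using R.span_add[OF g(1,3)] by (intro bexI[of _ "g \<oplus>\<^bsub>R\<^esub> h"]) auto
qed

lemma graph_surj:
  assumes I: "i \<in> I" "j \<in> I" "k \<in> I" and ne: "k \<noteq> i" "k \<noteq> j" and a: "x \<in> C i j"
  shows "\<exists>g\<in>span R (graph_gens i k j). fst g = x"
proof -
  have cl: "graph_gens i k j \<subseteq> carrier R"
    using graph_gens_closed[of i k j] I ne by auto
  show ?thesis
  proof (rule span_lift[OF comp_span[OF I a] _ cl])
    show "{a \<otimes> b | a b. a \<in> C i k \<and> b \<in> C k j} \<subseteq> carrier A"
      by auto
    show "\<exists>t\<in>graph_gens i k j. fst t = z" if "z \<in> {a \<otimes> b | a b. a \<in> C i k \<and> b \<in> C k j}" for z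
      using that unfolding graph_gens_def by fastforce
  qed
qed

lemma graph_gens_subset:
  assumes "i \<in> I" "j \<in> I" "k \<in> I" "k \<noteq> i" "k \<noteq> j"
  shows "span R (graph_gens i k j) \<subseteq> graph i j"
  unfolding graph_def using assms by (intro R.span_mono) auto

lemma graph_unique:
  assumes I: "i \<in> I" "j \<in> I" and ne: "i \<noteq> j" and g: "g \<in> graph i j" and h: "h \<in> graph i j" and eq: "fst g = fst h"
  shows "g = h"
proof -
  have c: "g \<in> carrier R" "h \<in> carrier R"
    using graph_closed[OF I g] graph_closed[OF I h] .
  have "g \<ominus>\<^bsub>R\<^esub> h \<in> graph i j"
    using g h I by (simp only: R.minus_eq graph_add graph_neg)
  moreover have "fst (g \<ominus>\<^bsub>R\<^esub> h) = \<zero>"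
    using c R_neg[OF c(2)] eq by (auto simp: R.minus_eq r_neg)
  ultimately have "g \<ominus>\<^bsub>R\<^esub> h = \<zero>\<^bsub>R\<^esub>"
    using graph_inj[OF _ I ne] by blast
  then show ?thesis
    by (rule R.minus_eq_zeroD[OF c])
qed

text \<open>
  Over a given element of \<open>A\<^sub>i\<^sub>j\<close> there is a pair that uses the index \<open>k\<close> only, and pairs are unique.
\<close>

lemma graph_via:
  assumes I: "i \<in> I" "j \<in> I" "k \<in> I" and ne: "i \<noteq> j" "k \<noteq> i" "k \<noteq> j" and g: "g \<in> graph i j"
  shows "g \<in> span R (graph_gens i k j)"
proof -
  obtain h where h: "h \<in> span R (graph_gens i k j)" "fst h = fst g"
    using graph_surj[OF I ne(2,3) graph_fst[OF g I(1,2)]] by blast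
  then have "h = g"
    using graph_gens_subset[OF I ne(2,3)] g by (intro graph_unique[OF I(1,2) ne(1)]) auto
  then show ?thesis
    using h by simp
qed

text \<open>
  With \<open>g\<close> written through an index \<open>m\<close> different from \<open>j\<close>, both second coordinates can be replaced by the
  values of \<open>f\<close> itself, so the product is one of the generators of \<open>graph i j\<close>.
\<close>

lemma graph_mult:
  assumes I: "i \<in> I" "k \<in> I" "j \<in> I" and ne: "i \<noteq> k" "k \<noteq> j" "i \<noteq> j"
    and g: "g \<in> graph i k" and h: "h \<in> graph k j"
  shows "g \<otimes>\<^bsub>R\<^esub> h \<in> graph i j"
proof -
  obtain m where m: "m \<in> I" "m \<noteq> i" "m \<noteq> k" "m \<noteq> j"
    using fresh by blast
  have hc: "snd h \<in> carrier B" "fst h \<in> C k j"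
    using graph_closed[OF I(2,3) h] graph_fst[OF h I(2,3)] by auto
  have fh: "f (fst h) \<in> carrier B"
    using f_comp_closed[OF I(2,3) ne(2) hc(2)] .
  have cl: "graph_gens i m k \<subseteq> carrier R"
    using graph_gens_closed[of i m k] I m by auto
  have "g \<in> span R (graph_gens i m k)"
    using graph_via[OF I(1,2) m(1) ne(1) m(2,3) g] .
  then have "fst g \<in> K \<and> snd g \<otimes>\<^bsub>B\<^esub> snd h = f (fst g) \<otimes>\<^bsub>B\<^esub> f (fst h)"
    using cl
  proof (induction rule: R.span_induct)
    case (base x)
    then obtain a b where ab: "a \<in> C i m" "b \<in> C m k" "x = (a \<otimes> b, f a \<otimes>\<^bsub>B\<^esub> f b)"
      unfolding graph_gens_def by blast
    have c: "f a \<in> carrier B" "f b \<in> carrier B"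
      using f_comp_closed[of i m a] f_comp_closed[of m k b] ab I m by auto
    have x: "x \<in> graph i k"
      using graph_base[of m i k a b] ab m by simp
    have "snd x \<otimes>\<^bsub>B\<^esub> snd h = f a \<otimes>\<^bsub>B\<^esub> (f b \<otimes>\<^bsub>B\<^esub> f (fst h))"
      using ab c hc f_mult_graph(1)[OF h I(2,3) m(1) ne(2) m(3,4) ab(2)] by (simp add: B.m_assoc)
    also have "\<dots> = snd x \<otimes>\<^bsub>B\<^esub> f (fst h)"
      using ab c fh by (simp add: B.m_assoc)
    also have "\<dots> = f (fst x) \<otimes>\<^bsub>B\<^esub> f (fst h)"
      using graph_mult_f(1)[OF x I ne(1) _ _ hc(2)] ne by blast
    finally show ?case
      using comp_K[OF I(1,2) ne(1) graph_fst[OF x I(1,2)]] by blast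
  next
    case (neg x)
    then show ?case
      using R_neg[OF neg(1)] hc fh by (auto simp: f_neg B.l_minus)
  qed (use hc fh in \<open>auto simp: f_add B.l_distr\<close>)
  then have "g \<otimes>\<^bsub>R\<^esub> h = (fst g \<otimes> fst h, f (fst g) \<otimes>\<^bsub>B\<^esub> f (fst h))"
    by simp
  then show ?thesis
    using graph_base[OF I(2) _ ne(2) graph_fst[OF g I(1,2)] hc(2)] ne by simp
qed

lemma graph_mult_zero:
  assumes I: "i \<in> I" "j \<in> I" "p \<in> I" "q \<in> I" and ne: "i \<noteq> j" "p \<noteq> q" "j \<noteq> p"
    and g: "g \<in> graph i j" and h: "h \<in> graph p q"
  shows "g \<otimes>\<^bsub>R\<^esub> h = \<zero>\<^bsub>R\<^esub>"
proof -
  have gc: "g \<in> carrier R"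
    using graph_closed[OF I(1,2) g] .
  have zero: "snd g \<otimes>\<^bsub>B\<^esub> f c = \<zero>\<^bsub>B\<^esub>" if c: "c \<in> C p m" and m: "m \<in> I" "m \<noteq> p" for c m
  proof -
    have fc: "f c \<in> carrier B"
      using f_comp_closed[OF I(3) m(1) _ c] m by blast
    show ?thesis
      using g I(1,2)
    proof (induction rule: graph_induct)
      case (base k a b)
      then show ?case
        using f_triple_right[of i k j p m a b c] I ne c m by simp
    next
      case (neg x)
      then show ?case
        using R_neg[OF neg(1)] fc by (auto simp: B.l_minus B.neg_zero)
    qed (use fc in \<open>auto simp: B.l_distr\<close>)
  qed
  show ?thesis
    using h I(3,4)
  proof (induction rule: graph_induct)
    case (base k c d)
    have cl: "f c \<in> carrier B" "f d \<in> carrier B"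
      using f_comp_closed[of p k c] f_comp_closed[of k q d] base I by auto
    have "snd g \<otimes>\<^bsub>B\<^esub> (f c \<otimes>\<^bsub>B\<^esub> f d) = (snd g \<otimes>\<^bsub>B\<^esub> f c) \<otimes>\<^bsub>B\<^esub> f d"
      using cl gc by (auto simp: B.m_assoc)
    moreover have "fst g \<otimes> (c \<otimes> d) = \<zero>"
      using comp_mult_zero[OF I(2,3) ne(3) graph_fst[OF g I(1,2)] comp_mult[OF I(3,4) base(4,5)]] .
    ultimately show ?case
      using zero[OF base(4,1,2)] cl by simp
  next
    case (neg x)
    then show ?case
      using R.r_minus[OF neg(1) gc] R.r_minus[OF gc neg(1)] R.neg_zero by simp
  next
    case (add x y)
    then show ?case
      using R.r_distr[OF add(1,2) gc] by simp
  qed (use R.r_null[OF gc] in simp)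
qed

lemma graph_split:
  assumes I: "i \<in> I" "k \<in> I" "j \<in> I" and ne: "i \<noteq> k" "k \<noteq> j" "i \<noteq> j" and x: "x \<in> graph i j"
  shows "x \<in> span R {g \<otimes>\<^bsub>R\<^esub> h | g h. g \<in> graph i k \<and> h \<in> graph k j}"
proof -
  let ?S = "{g \<otimes>\<^bsub>R\<^esub> h | g h. g \<in> graph i k \<and> h \<in> graph k j}"
  have S: "?S \<subseteq> graph i j"
    using graph_mult[OF I ne] by blast
  then have Sc: "?S \<subseteq> carrier R"
    using graph_closed[OF I(1,3)] by blast
  have Sg: "y \<in> graph i j" if "y \<in> span R ?S" for y
    using that Sc
  proof (induction rule: R.span_induct)
    case (neg x)
    then show ?case
      using graph_neg[OF I(1,3)] by blast
  next
    case (add x y)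
    then show ?case
      using graph_add by blast
  qed (use S graph_zero in blast)+
  have "\<exists>y\<in>span R ?S. fst y = fst x"
  proof (rule span_lift[OF comp_span[OF I(1,3,2) graph_fst[OF x I(1,3)]] _ Sc])
    show "{a \<otimes> b | a b. a \<in> C i k \<and> b \<in> C k j} \<subseteq> carrier A"
      by auto
    fix z assume "z \<in> {a \<otimes> b | a b. a \<in> C i k \<and> b \<in> C k j}"
    then obtain a b where ab: "z = a \<otimes> b" "a \<in> C i k" "b \<in> C k j"
      by blast
    obtain m n where mn: "m \<in> I" "m \<noteq> i" "m \<noteq> k" "n \<in> I" "n \<noteq> k" "n \<noteq> j"
      using fresh by metis
    obtain g where g: "g \<in> graph i k" "fst g = a"
      using graph_surj[OF I(1,2) mn(1-3) ab(2)] graph_gens_subset[OF I(1,2) mn(1-3)] by blast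
    obtain h where h: "h \<in> graph k j" "fst h = b"
      using graph_surj[OF I(2,3) mn(4-6) ab(3)] graph_gens_subset[OF I(2,3) mn(4-6)] by blast
    have "g \<otimes>\<^bsub>R\<^esub> h \<in> ?S" "fst (g \<otimes>\<^bsub>R\<^esub> h) = z"
      using g h ab by (blast, simp)
    then show "\<exists>t\<in>?S. fst t = z"
      by blast
  qed
  then obtain y where y: "y \<in> span R ?S" "fst y = fst x"
    by blast
  then have "y = x"
    using graph_unique[OF I(1,3) ne(3) Sg[OF y(1)] x] by simp
  then show ?thesis
    using y by simp
qed

end

section \<open>The annihilator extension of A generated by the graphs\<close>

context assoc_ring
begin

lemma assoc_ring_subring:
  assumes T: "T \<subseteq> carrier R" "\<zero> \<in> T" "\<And>x. x \<in> T \<Longrightarrow> \<ominus> x \<in> T"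
    "\<And>x y. x \<in> T \<Longrightarrow> y \<in> T \<Longrightarrow> x \<oplus> y \<in> T" "\<And>x y. x \<in> T \<Longrightarrow> y \<in> T \<Longrightarrow> x \<otimes> y \<in> T"
  shows "assoc_ring (R\<lparr>carrier := T\<rparr>)"
proof -
  have c: "x \<in> T \<Longrightarrow> x \<in> carrier R" for x
    using T(1) by blast
  have "abelian_group (R\<lparr>carrier := T\<rparr>)"
  proof (rule abelian_groupI)
    fix x assume "x \<in> carrier (R\<lparr>carrier := T\<rparr>)"
    then show "\<exists>y\<in>carrier (R\<lparr>carrier := T\<rparr>). y \<oplus>\<^bsub>R\<lparr>carrier := T\<rparr>\<^esub> x = \<zero>\<^bsub>R\<lparr>carrier := T\<rparr>\<^esub>"
      using T(3) c by (intro bexI[of _ "\<ominus> x"]) (auto simp: l_neg)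
  qed (use T c in \<open>auto simp: a_ac\<close>)
  then show ?thesis
    by (intro assoc_ring.intro nonassoc_ring.intro nonassoc_ring_axioms.intro assoc_ring_axioms.intro)
      (use T c in \<open>auto simp: l_distr r_distr m_assoc\<close>)
qed

lemma span_subring:
  assumes T: "T \<subseteq> carrier R" "\<zero> \<in> T" "\<And>x. x \<in> T \<Longrightarrow> \<ominus> x \<in> T"
    "\<And>x y. x \<in> T \<Longrightarrow> y \<in> T \<Longrightarrow> x \<oplus> y \<in> T" and S: "S \<subseteq> T"
  shows "span (R\<lparr>carrier := T\<rparr>) S = span R S"
proof -
  have "subgroup T (add_monoid R)"
    using T by (intro add.subgroupI[simplified]) (auto simp: a_inv_def)
  then have "generate (add_monoid R\<lparr>carrier := T\<rparr>) S = generate (add_monoid R) S"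
    using add.generate_consistent[OF S] by simp
  then show ?thesis
    by (simp add: span_def)
qed

end

lemma (in abelian_group) finsum_neg:
  assumes "finite J" and g: "\<And>j. j \<in> J \<Longrightarrow> g j \<in> carrier G"
  shows "(\<Oplus>j\<in>J. \<ominus> g j) = \<ominus> (\<Oplus>j\<in>J. g j)"
proof -
  have "(\<Oplus>j\<in>J. \<ominus> g j) \<oplus> (\<Oplus>j\<in>J. g j) = (\<Oplus>j\<in>J. \<ominus> g j \<oplus> g j)"
    using g by (intro finsum_addf[symmetric]) auto
  also have "\<dots> = (\<Oplus>j\<in>J. \<zero>)"
    using g by (intro finsum_cong') (auto simp: l_neg)
  finally have "(\<Oplus>j\<in>J. \<ominus> g j) \<oplus> (\<Oplus>j\<in>J. g j) = \<zero>"
    by simp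
  then show ?thesis
    using g by (intro minus_equality[symmetric] finsum_closed) auto
qed

context peirce_ring
begin

lemma idempotent_ring: "idempotent_ring A"
proof -
  have "carrier A \<subseteq> span_prod A (carrier A) (carrier A)"
  proof
    fix x assume "x \<in> carrier A"
    then have "x \<in> span A (\<Union>i\<in>I. \<Union>j\<in>I. C i j)"
      using carrier_span by blast
    moreover have "(\<Union>i\<in>I. \<Union>j\<in>I. C i j) \<subseteq> span_prod A (carrier A) (carrier A)"
    proof (intro UN_least subsetI)
      fix i j x assume ij: "i \<in> I" "j \<in> I" and x: "x \<in> C i j"
      have "{a \<otimes> b | a b. a \<in> C i i \<and> b \<in> C i j} \<subseteq> {x \<otimes> y | x y. x \<in> carrier A \<and> y \<in> carrier A}"
        by blast
      then show "x \<in> span_prod A (carrier A) (carrier A)"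
        unfolding span_prod_eq_span using comp_span[OF ij ij(1) x] span_mono by blast
    qed
    ultimately show "x \<in> span_prod A (carrier A) (carrier A)"
      unfolding span_prod_eq_span using span_subset[of "\<Union>i\<in>I. \<Union>j\<in>I. C i j"] comp_subset by blast
  qed
  then show ?thesis
    using span_prod_closed[of "carrier A" "carrier A"] assoc_ring_axioms
    by (auto simp: idempotent_ring_def)
qed

end

context lie_ideal_map
begin

definition diag_gens :: "'i \<Rightarrow> ('a \<times> 'b) set"
  where "diag_gens i = {g \<otimes>\<^bsub>R\<^esub> h | g h. \<exists>k\<in>I. k \<noteq> i \<and> g \<in> graph i k \<and> h \<in> graph k i}"

text \<open>
  Over the diagonal place \<open>(i, i)\<close> the graph is replaced by the span of products of graphs. It
  projects onto \<open>A\<^sub>i\<^sub>i\<close>, but the projection need not be injective, and this is why the cover is an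
  extension of \<open>A\<close>.
\<close>

definition cell :: "'i \<Rightarrow> 'i \<Rightarrow> ('a \<times> 'b) set"
  where "cell i j = (if i = j then span R (diag_gens i) else graph i j)"

definition cover :: "('a \<times> 'b) set"
  where "cover = span R (\<Union>i\<in>I. \<Union>j\<in>I. cell i j)"

lemma diag_gens_closed: "i \<in> I \<Longrightarrow> diag_gens i \<subseteq> carrier R"
  unfolding diag_gens_def using graph_closed R.m_closed by blast

lemma cell_closed: "i \<in> I \<Longrightarrow> j \<in> I \<Longrightarrow> g \<in> cell i j \<Longrightarrow> g \<in> carrier R"
  using R.span_closed[OF diag_gens_closed] graph_closed by (auto simp: cell_def split: if_splits)

lemma cells_closed: "(\<Union>i\<in>I. \<Union>j\<in>I. cell i j) \<subseteq> carrier R"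
  using cell_closed by blast

lemma cell_zero: "\<zero>\<^bsub>R\<^esub> \<in> cell i j"
  unfolding cell_def using R.span_zero graph_zero by (cases "i = j") (simp_all only: if_True if_False refl)

lemma cell_add: "g \<in> cell i j \<Longrightarrow> h \<in> cell i j \<Longrightarrow> g \<oplus>\<^bsub>R\<^esub> h \<in> cell i j"
  unfolding cell_def using R.span_add graph_add by (cases "i = j") (simp_all only: if_True if_False refl)

lemma cell_neg: "i \<in> I \<Longrightarrow> j \<in> I \<Longrightarrow> g \<in> cell i j \<Longrightarrow> \<ominus>\<^bsub>R\<^esub> g \<in> cell i j"
  unfolding cell_def using R.span_neg[OF diag_gens_closed] graph_neg
  by (cases "i = j") (simp_all only: if_True if_False refl)

lemma cell_fst:
  assumes I: "i \<in> I" "j \<in> I" and g: "g \<in> cell i j"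
  shows "fst g \<in> C i j"
proof (cases "i = j")
  case True
  have "g \<in> span R (diag_gens i)"
    using g True by (simp add: cell_def)
  then have "fst g \<in> C i i"
    using diag_gens_closed[OF I(1)]
  proof (induction rule: R.span_induct)
    case (base x)
    then obtain u v k where uv: "x = u \<otimes>\<^bsub>R\<^esub> v" "k \<in> I" "u \<in> graph i k" "v \<in> graph k i"
      unfolding diag_gens_def by blast
    have "fst u \<otimes> fst v \<in> C i i"
      using comp_mult[OF I(1,1) graph_fst[OF uv(3) I(1) uv(2)] graph_fst[OF uv(4) uv(2) I(1)]] .
    then show ?case
      using uv by simp
  next
    case (neg x)
    then show ?case
      using R_neg[OF neg(1)] I by (simp add: comp_neg)
  qed (use I in \<open>auto simp: comp_add\<close>)
  then show ?thesis
    using True by simp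
next
  case False
  then show ?thesis
    using g graph_fst I by (simp add: cell_def)
qed

text \<open>
  For \<open>d = gh\<close> with \<open>h \<in> graph k i\<close> one multiplies from the inside. If \<open>k = j\<close> the inner product would be
  diagonal, and \<open>w\<close> is first split as \<open>w\<^sub>1w\<^sub>2\<close> through a further index.
\<close>

lemma diag_mult_graph:
  assumes I: "i \<in> I" "j \<in> I" and ne: "i \<noteq> j" and d: "d \<in> span R (diag_gens i)" and w: "w \<in> graph i j"
  shows "d \<otimes>\<^bsub>R\<^esub> w \<in> graph i j"
proof -
  have wc: "w \<in> carrier R"
    using graph_closed[OF I w] .
  have "x \<otimes>\<^bsub>R\<^esub> w \<in> graph i j" if x: "x \<in> diag_gens i" for x
  proof -
    obtain g h k where gh: "x = g \<otimes>\<^bsub>R\<^esub> h" "k \<in> I" "k \<noteq> i" "g \<in> graph i k" "h \<in> graph k i"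
      using x unfolding diag_gens_def by blast
    have ghc: "g \<in> carrier R" "h \<in> carrier R"
      using graph_closed[OF I(1) gh(2,4)] graph_closed[OF gh(2) I(1) gh(5)] .
    show ?thesis
    proof (cases "k = j")
      case False
      have "h \<otimes>\<^bsub>R\<^esub> w \<in> graph k j"
        using graph_mult[OF gh(2) I(1,2) gh(3) ne False gh(5) w] .
      then have "g \<otimes>\<^bsub>R\<^esub> (h \<otimes>\<^bsub>R\<^esub> w) \<in> graph i j"
        using graph_mult[OF I(1) gh(2) I(2) gh(3)[symmetric] False ne gh(4)] by blast
      then show ?thesis
        unfolding gh(1) using R.m_assoc[OF ghc wc] by simp
    next
      case True
      have g: "g \<in> graph i j" and h: "h \<in> graph j i"
        using gh(4,5) unfolding True .
      obtain m where m: "m \<in> I" "m \<noteq> i" "m \<noteq> j"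
        using fresh by blast
      let ?S = "{g \<otimes>\<^bsub>R\<^esub> h | g h. g \<in> graph i m \<and> h \<in> graph m j}"
      have split: "w \<in> span R ?S"
        using graph_split[OF I(1) m(1) I(2) m(2)[symmetric] m(3) ne w] .
      have S: "?S \<subseteq> carrier R"
        using graph_closed[OF I(1) m(1)] graph_closed[OF m(1) I(2)] R.m_closed by blast
      have "x \<otimes>\<^bsub>R\<^esub> y \<in> graph i j" if yS: "y \<in> ?S" for y
      proof -
        obtain w1 w2 where y: "y = w1 \<otimes>\<^bsub>R\<^esub> w2" "w1 \<in> graph i m" "w2 \<in> graph m j"
          using yS by blast
        have wc: "w1 \<in> carrier R" "w2 \<in> carrier R"
          using graph_closed[OF I(1) m(1) y(2)] graph_closed[OF m(1) I(2) y(3)] .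
        have "h \<otimes>\<^bsub>R\<^esub> w1 \<in> graph j m"
          using graph_mult[OF I(2,1) m(1) ne[symmetric] m(2)[symmetric] m(3)[symmetric] h y(2)] .
        then have "g \<otimes>\<^bsub>R\<^esub> (h \<otimes>\<^bsub>R\<^esub> w1) \<in> graph i m"
          using graph_mult[OF I(1,2) m(1) ne m(3)[symmetric] m(2)[symmetric] g] by blast
        then have "g \<otimes>\<^bsub>R\<^esub> (h \<otimes>\<^bsub>R\<^esub> w1) \<otimes>\<^bsub>R\<^esub> w2 \<in> graph i j"
          using graph_mult[OF I(1) m(1) I(2) m(2)[symmetric] m(3) ne _ y(3)] by blast
        moreover have "x \<otimes>\<^bsub>R\<^esub> y = g \<otimes>\<^bsub>R\<^esub> (h \<otimes>\<^bsub>R\<^esub> w1) \<otimes>\<^bsub>R\<^esub> w2"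
          unfolding gh(1) y(1) by (simp only: R.m_assoc R.m_closed ghc wc)
        ultimately show ?thesis
          by simp
      qed
      moreover have "x \<in> carrier R"
        unfolding gh(1) using R.m_closed[OF ghc] .
      ultimately show ?thesis
        using R.span_mult_left[OF split S graph_all_gens_closed[OF I], folded graph_def] by blast
    qed
  qed
  then show ?thesis
    by (rule R.span_mult_right[OF d diag_gens_closed[OF I(1)] graph_all_gens_closed[OF I] wc, folded graph_def])
qed

lemma diag_mult_graph_zero:
  assumes I: "i \<in> I" "p \<in> I" "q \<in> I" and ne: "p \<noteq> q" "p \<noteq> i"
    and d: "d \<in> span R (diag_gens i)" and w: "w \<in> graph p q"
  shows "d \<otimes>\<^bsub>R\<^esub> w = \<zero>\<^bsub>R\<^esub>"
proof (rule R.span_mult_right_zero[OF d diag_gens_closed[OF I(1)]])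
  show wc: "w \<in> carrier R"
    using graph_closed[OF I(2,3) w] .
  show "x \<otimes>\<^bsub>R\<^esub> w = \<zero>\<^bsub>R\<^esub>" if x: "x \<in> diag_gens i" for x
  proof -
    obtain g h k where gh: "x = g \<otimes>\<^bsub>R\<^esub> h" "k \<in> I" "k \<noteq> i" "g \<in> graph i k" "h \<in> graph k i"
      using x unfolding diag_gens_def by blast
    have ghc: "g \<in> carrier R" "h \<in> carrier R"
      using graph_closed[OF I(1) gh(2,4)] graph_closed[OF gh(2) I(1) gh(5)] .
    have "h \<otimes>\<^bsub>R\<^esub> w = \<zero>\<^bsub>R\<^esub>"
      using graph_mult_zero[OF gh(2) I gh(3) ne(1) ne(2)[symmetric] gh(5) w] .
    then show ?thesis
      unfolding gh(1) using R.m_assoc[OF ghc wc] R.r_null[OF ghc(1)] by simp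
  qed
qed

end

context lie_ideal_map
begin

interpretation mirror: lie_ideal_map "op_ring A" I r l "op_ring B" f
  by (rule lie_ideal_map_mirror)

lemma diag_gens_mirror: "mirror.diag_gens i = diag_gens i"
  unfolding mirror.diag_gens_def diag_gens_def graph_mirror mult_mirror by blast

lemma graph_mult_diag:
  assumes "i \<in> I" "j \<in> I" "j \<noteq> i" "d \<in> span R (diag_gens i)" "w \<in> graph j i"
  shows "w \<otimes>\<^bsub>R\<^esub> d \<in> graph j i"
  using mirror.diag_mult_graph[of i j d w, unfolded graph_mirror span_mirror diag_gens_mirror mult_mirror] assms
  by blast

lemma graph_mult_diag_zero:
  assumes "i \<in> I" "p \<in> I" "q \<in> I" "p \<noteq> q" "q \<noteq> i" "d \<in> span R (diag_gens i)" "w \<in> graph p q"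
  shows "w \<otimes>\<^bsub>R\<^esub> d = \<zero>\<^bsub>R\<^esub>"
  using mirror.diag_mult_graph_zero[of i q p d w,
      unfolded graph_mirror span_mirror diag_gens_mirror mult_mirror zero_mirror] assms
  by blast

lemma cover_closed: "x \<in> cover \<Longrightarrow> x \<in> carrier R"
  unfolding cover_def using R.span_closed[OF cells_closed] .

lemma cover_zero: "\<zero>\<^bsub>R\<^esub> \<in> cover"
  unfolding cover_def by (rule R.span_zero)

lemma cover_neg: "x \<in> cover \<Longrightarrow> \<ominus>\<^bsub>R\<^esub> x \<in> cover"
  unfolding cover_def by (rule R.span_neg[OF cells_closed])

lemma cover_add: "x \<in> cover \<Longrightarrow> y \<in> cover \<Longrightarrow> x \<oplus>\<^bsub>R\<^esub> y \<in> cover"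
  unfolding cover_def by (rule R.span_add)

lemma cell_cover: "i \<in> I \<Longrightarrow> j \<in> I \<Longrightarrow> x \<in> cell i j \<Longrightarrow> x \<in> cover"
  unfolding cover_def by (rule R.span_base) blast

lemma graph_cover: "i \<in> I \<Longrightarrow> j \<in> I \<Longrightarrow> i \<noteq> j \<Longrightarrow> x \<in> graph i j \<Longrightarrow> x \<in> cover"
  using cell_cover[of i j x] by (simp add: cell_def)

lemma graph_mult_graph_cover:
  "\<lbrakk>i \<in> I; k \<in> I; k \<noteq> i; g \<in> graph i k; h \<in> graph k i\<rbrakk> \<Longrightarrow> g \<otimes>\<^bsub>R\<^esub> h \<in> cell i i"
  unfolding cell_def diag_gens_def if_P[OF refl] by (rule R.span_base) blast

lemma cover_induct [consumes 1, case_names zero graph diag neg add]: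
  assumes "x \<in> cover" and zero: "P \<zero>\<^bsub>R\<^esub>"
    and graph: "\<And>i j x. i \<in> I \<Longrightarrow> j \<in> I \<Longrightarrow> i \<noteq> j \<Longrightarrow> x \<in> graph i j \<Longrightarrow> P x"
    and diag: "\<And>i k g h. i \<in> I \<Longrightarrow> k \<in> I \<Longrightarrow> k \<noteq> i \<Longrightarrow> g \<in> graph i k \<Longrightarrow> h \<in> graph k i \<Longrightarrow> P (g \<otimes>\<^bsub>R\<^esub> h)"
    and neg: "\<And>x. x \<in> carrier R \<Longrightarrow> P x \<Longrightarrow> P (\<ominus>\<^bsub>R\<^esub> x)"
    and add: "\<And>x y. x \<in> carrier R \<Longrightarrow> y \<in> carrier R \<Longrightarrow> P x \<Longrightarrow> P y \<Longrightarrow> P (x \<oplus>\<^bsub>R\<^esub> y)"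
  shows "P x"
  using assms(1) cells_closed unfolding cover_def
proof (induction rule: R.span_induct)
  case (base x)
  then obtain i j where ij: "i \<in> I" "j \<in> I" "x \<in> cell i j"
    by blast
  show ?case
  proof (cases "i = j")
    case True
    then have "x \<in> span R (diag_gens i)"
      using ij by (simp add: cell_def)
    then show ?thesis
      using diag_gens_closed[OF ij(1)]
    proof (induction rule: R.span_induct)
      case (base x)
      then obtain g h k where gh: "x = g \<otimes>\<^bsub>R\<^esub> h" "k \<in> I" "k \<noteq> i" "g \<in> graph i k" "h \<in> graph k i"
        unfolding diag_gens_def by blast
      show ?case
        unfolding gh(1) using diag[OF ij(1) gh(2-5)] .
    qed (use zero neg add in blast)+
  next
    case False
    then show ?thesis
      using graph[OF ij(1,2)] ij(3) by (simp add: cell_def)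
  qed
qed (use zero neg add in blast)+

lemma cover_mult_graph:
  assumes I: "p \<in> I" "q \<in> I" and ne: "p \<noteq> q" and x: "x \<in> cover" and w: "w \<in> graph p q"
  shows "x \<otimes>\<^bsub>R\<^esub> w \<in> cover"
proof -
  have wc: "w \<in> carrier R"
    using graph_closed[OF I w] .
  have "x \<otimes>\<^bsub>R\<^esub> w \<in> cover" if cells: "x \<in> (\<Union>i\<in>I. \<Union>j\<in>I. cell i j)" for x
  proof -
    obtain i j where ij: "i \<in> I" "j \<in> I" "x \<in> cell i j"
      using cells by blast
    show ?thesis
    proof (cases "i = j")
      case True
      then have d: "x \<in> span R (diag_gens i)"
        using ij by (simp add: cell_def)
      show ?thesis
      proof (cases "p = i")
        case True
        have "w \<in> graph i q" "i \<noteq> q"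
          using w ne unfolding True .
        then show ?thesis
          using graph_cover[OF ij(1) I(2) _ diag_mult_graph[OF ij(1) I(2) _ d]] by blast
      next
        case False
        then show ?thesis
          using diag_mult_graph_zero[OF ij(1) I ne _ d w] cover_zero by metis
      qed
    next
      case False
      then have g: "x \<in> graph i j"
        using ij by (simp add: cell_def)
      show ?thesis
      proof (cases "p = j")
        case True
        have w': "w \<in> graph j q" "j \<noteq> q"
          using w ne unfolding True .
        show ?thesis
        proof (cases "i = q")
          case True
          have "w \<in> graph j i"
            using w' unfolding True by blast
          then show ?thesis
            using cell_cover[OF ij(1,1) graph_mult_graph_cover[OF ij(1,2) _ g]] False by blast
        next
          case ne': False
          then show ?thesis
            using graph_cover[OF ij(1) I(2) _ graph_mult[OF ij(1,2) I(2) False w'(2) ne' g w'(1)]] by blast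
        qed
      next
        case ne': False
        then show ?thesis
          using graph_mult_zero[OF ij(1,2) I False ne _ g w] cover_zero by metis
      qed
    qed
  qed
  then show ?thesis
    by (rule R.span_mult_right[OF x[unfolded cover_def] cells_closed cells_closed wc, folded cover_def])
qed

lemma cover_mult:
  assumes x: "x \<in> cover" and y: "y \<in> cover"
  shows "x \<otimes>\<^bsub>R\<^esub> y \<in> cover"
proof -
  have xc: "x \<in> carrier R"
    using cover_closed[OF x] .
  show ?thesis
    using y
  proof (induction rule: cover_induct)
    case zero
    then show ?case
      unfolding R.r_null[OF xc] by (rule cover_zero)
  next
    case (graph i j w)
    then show ?case
      using cover_mult_graph x by blast
  next
    case (diag i k g h)
    have c: "g \<in> carrier R" "h \<in> carrier R"
      using graph_closed[OF diag(1,2,4)] graph_closed[OF diag(2,1,5)] .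
    have "x \<otimes>\<^bsub>R\<^esub> g \<in> cover"
      using cover_mult_graph[OF diag(1,2) _ x diag(4)] diag(3) by blast
    then have "x \<otimes>\<^bsub>R\<^esub> g \<otimes>\<^bsub>R\<^esub> h \<in> cover"
      using cover_mult_graph[OF diag(2,1,3) _ diag(5)] by blast
    then show ?case
      by (simp only: R.m_assoc[OF xc c])
  next
    case (neg y)
    then show ?case
      unfolding R.r_minus[OF xc neg(1)] by (intro cover_neg)
  next
    case (add y z)
    then show ?case
      unfolding R.r_distr[OF add(1,2) xc] by (intro cover_add)
  qed
qed

abbreviation Cover :: "('a \<times> 'b) ring"
  where "Cover \<equiv> R\<lparr>carrier := cover\<rparr>"

lemma cover_subset: "cover \<subseteq> carrier R"
  using cover_closed by blast

lemma assoc_ring_Cover: "assoc_ring Cover"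
  using R.assoc_ring_subring[OF cover_subset cover_zero cover_neg cover_add cover_mult] .

lemma idempotent_Cover: "idempotent_ring Cover"
proof -
  interpret Cov: assoc_ring Cover
    by (rule assoc_ring_Cover)
  let ?S = "{x \<otimes>\<^bsub>R\<^esub> y | x y. x \<in> cover \<and> y \<in> cover}"
  have S: "?S \<subseteq> cover"
    using cover_mult by blast
  then have Sc: "?S \<subseteq> carrier R"
    using cover_subset by blast
  have "cover \<subseteq> span R ?S"
  proof
    fix x assume "x \<in> cover"
    then show "x \<in> span R ?S"
    proof (induction rule: cover_induct)
      case zero
      then show ?case
        by (rule R.span_zero)
    next
      case (graph i j x)
      obtain m where m: "m \<in> I" "m \<noteq> i" "m \<noteq> j"
        using fresh by blast
      have "{g \<otimes>\<^bsub>R\<^esub> h | g h. g \<in> graph i m \<and> h \<in> graph m j} \<subseteq> ?S"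
        using graph_cover[OF graph(1) m(1) m(2)[symmetric]] graph_cover[OF m(1) graph(2) m(3)] by blast
      then show ?case
        using graph_split[OF graph(1) m(1) graph(2) m(2)[symmetric] m(3) graph(3,4)] R.span_mono by blast
    next
      case (diag i k g h)
      then have "g \<in> cover" "h \<in> cover"
        using graph_cover[OF diag(1,2) _ diag(4)] graph_cover[OF diag(2,1,3,5)] by auto
      then show ?case
        by (intro R.span_base) blast
    next
      case (neg x)
      then show ?case
        by (intro R.span_neg[OF Sc])
    next
      case (add x y)
      then show ?case
        by (intro R.span_add)
    qed
  qed
  moreover have "span_prod Cover cover cover = span R ?S"
    using R.span_subring[OF cover_subset cover_zero cover_neg cover_add S]
    by (simp add: span_prod_eq_span)
  moreover have "span_prod Cover cover cover \<subseteq> cover"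
    using Cov.span_prod_closed[of cover cover] by simp
  ultimately show ?thesis
    using assoc_ring_Cover by (auto simp: idempotent_ring_def)
qed

lemma cover_fst_surj: "fst ` cover = carrier A"
proof
  show "fst ` cover \<subseteq> carrier A"
    using cover_closed by force
  show "carrier A \<subseteq> fst ` cover"
  proof
    fix a assume "a \<in> carrier A"
    then show "a \<in> fst ` cover"
    proof (induction rule: peirce_induct)
      case zero
      then show ?case
        using cover_zero by force
    next
      case (off i j x)
      obtain m where m: "m \<in> I" "m \<noteq> i" "m \<noteq> j"
        using fresh by blast
      then obtain g where "g \<in> graph i j" "fst g = x"
        using graph_surj[OF off(1,2) m off(4)] graph_gens_subset[OF off(1,2) m] by blast
      then show ?case
        using graph_cover[OF off(1-3)] by blast
    next
      case (mult x y)
      then obtain t s where "t \<in> cover" "x = fst t" "s \<in> cover" "y = fst s"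
        by blast
      then show ?case
        using cover_mult[of t s] by (intro image_eqI[of _ _ "t \<otimes>\<^bsub>R\<^esub> s"]) auto
    next
      case (neg x)
      then obtain t where "t \<in> cover" "x = fst t"
        by blast
      then show ?case
        using cover_neg[of t] R_neg[OF cover_closed[of t]] by (intro image_eqI[of _ _ "\<ominus>\<^bsub>R\<^esub> t"]) auto
    next
      case (add x y)
      then obtain t s where "t \<in> cover" "x = fst t" "s \<in> cover" "y = fst s"
        by blast
      then show ?case
        using cover_add[of t s] by (intro image_eqI[of _ _ "t \<oplus>\<^bsub>R\<^esub> s"]) auto
    qed
  qed
qed

text \<open>
  The Peirce decomposition of the cover, which lies over that of \<open>A\<close>.
\<close>

lemma cover_decomp:
  assumes "t \<in> cover"
  shows "\<exists>g. (\<forall>i\<in>I. \<forall>j\<in>I. g (i, j) \<in> cell i j \<and> fst (g (i, j)) = l i (r j (fst t))) \<and>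
    t = finsum R g (I \<times> I)"
  using assms cells_closed unfolding cover_def
proof (induction rule: R.span_induct)
  case zero
  show ?case
  proof (intro exI[of _ "\<lambda>_. \<zero>\<^bsub>R\<^esub>"] conjI ballI)
    show "\<zero>\<^bsub>R\<^esub> = (\<Oplus>\<^bsub>R\<^esub>_\<in>I \<times> I. \<zero>\<^bsub>R\<^esub>)"
      by (rule R.finsum_zero[symmetric])
  qed (auto simp del: RDirProd_simps(2) intro: cell_zero, simp)
next
  case (base x)
  then obtain i j where ij: "i \<in> I" "j \<in> I" "x \<in> cell i j"
    by blast
  define g where "g = (\<lambda>p. if p = (i, j) then x else \<zero>\<^bsub>R\<^esub>)"
  have x: "fst x \<in> C i j" "x \<in> carrier R"
    using cell_fst[OF ij] cell_closed[OF ij] .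
  have "finsum R g (I \<times> I) = g (i, j)"
    using ij x finite_I by (intro R.finsum_single) (auto simp: g_def)
  moreover have "g (p, q) \<in> cell p q \<and> fst (g (p, q)) = l p (r q (fst x))" if pq: "p \<in> I" "q \<in> I" for p q
  proof (cases "p = i \<and> q = j")
    case True
    then show ?thesis
      using x ij by (simp add: g_def peirce_comp_def)
  next
    case False
    have "l p (r q (fst x)) = \<zero>"
      using comp_l[OF ij(1) pq(1) x(1)] comp_r[OF ij(2) pq(2) x(1)] False pq by auto
    then show ?thesis
      using False cell_zero[of p q] by (auto simp: g_def)
  qed
  ultimately show ?case
    by (intro exI[of _ g]) (simp add: g_def)
next
  case (neg t)
  then obtain g where g: "\<forall>i\<in>I. \<forall>j\<in>I. g (i, j) \<in> cell i j \<and> fst (g (i, j)) = l i (r j (fst t))"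
    "t = finsum R g (I \<times> I)"
    by blast
  have gc: "g p \<in> carrier R" if "p \<in> I \<times> I" for p
    using g(1) that cell_closed by (cases p) blast
  have tc: "fst t \<in> carrier A"
    using neg(1) by auto
  have "finsum R (\<lambda>p. \<ominus>\<^bsub>R\<^esub> g p) (I \<times> I) = \<ominus>\<^bsub>R\<^esub> t"
    unfolding g(2) using gc finite_I by (intro R.finsum_neg) auto
  moreover have "\<ominus>\<^bsub>R\<^esub> g (i, j) \<in> cell i j \<and> fst (\<ominus>\<^bsub>R\<^esub> g (i, j)) = l i (r j (fst (\<ominus>\<^bsub>R\<^esub> t)))"
    if ij: "i \<in> I" "j \<in> I" for i j
  proof -
    have "fst (\<ominus>\<^bsub>R\<^esub> g (i, j)) = \<ominus> fst (g (i, j))" "fst (\<ominus>\<^bsub>R\<^esub> t) = \<ominus> fst t"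
      using R_neg[OF gc[of "(i, j)"]] R_neg[OF neg(1)] ij by auto
    then show ?thesis
      using g(1) cell_neg[OF ij] ij tc by (simp add: l_map_neg r_map_neg)
  qed
  ultimately show ?case
    by (intro exI[of _ "\<lambda>p. \<ominus>\<^bsub>R\<^esub> g p"]) metis
next
  case (add t s)
  then obtain g h where g: "\<forall>i\<in>I. \<forall>j\<in>I. g (i, j) \<in> cell i j \<and> fst (g (i, j)) = l i (r j (fst t))"
    "t = finsum R g (I \<times> I)"
    and h: "\<forall>i\<in>I. \<forall>j\<in>I. h (i, j) \<in> cell i j \<and> fst (h (i, j)) = l i (r j (fst s))"
    "s = finsum R h (I \<times> I)"
    by blast
  have gc: "g p \<in> carrier R" "h p \<in> carrier R" if "p \<in> I \<times> I" for p
    using g(1) h(1) that cell_closed by (cases p; blast)+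
  have tc: "fst t \<in> carrier A" "fst s \<in> carrier A"
    using add(1,2) by auto
  have "finsum R (\<lambda>p. g p \<oplus>\<^bsub>R\<^esub> h p) (I \<times> I) = t \<oplus>\<^bsub>R\<^esub> s"
    unfolding g(2) h(2) using gc by (intro R.finsum_addf) auto
  moreover have "g (i, j) \<oplus>\<^bsub>R\<^esub> h (i, j) \<in> cell i j \<and>
      fst (g (i, j) \<oplus>\<^bsub>R\<^esub> h (i, j)) = l i (r j (fst (t \<oplus>\<^bsub>R\<^esub> s)))"
    if ij: "i \<in> I" "j \<in> I" for i j
    using g(1) h(1) ij cell_add[of "g (i, j)" i j "h (i, j)"] tc by (simp add: l_add r_add)
  ultimately show ?case
    by (intro exI[of _ "\<lambda>p. g p \<oplus>\<^bsub>R\<^esub> h p"]) metis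
qed

text \<open>
  Off the diagonal \<open>x = 0\<close>. On the diagonal, \<open>xw\<close> lies in a graph again and projects to \<open>0\<close>.
\<close>

lemma cell_kernel_graph:
  assumes I: "i \<in> I" "j \<in> I" "p \<in> I" "q \<in> I" and ne: "p \<noteq> q"
    and x: "x \<in> cell i j" "fst x = \<zero>" and w: "w \<in> graph p q"
  shows "x \<otimes>\<^bsub>R\<^esub> w = \<zero>\<^bsub>R\<^esub>" and "w \<otimes>\<^bsub>R\<^esub> x = \<zero>\<^bsub>R\<^esub>"
proof -
  have wc: "w \<in> carrier R" and fw: "fst w \<in> carrier A"
    using graph_closed[OF I(3,4) w] by auto
  have "x \<otimes>\<^bsub>R\<^esub> w = \<zero>\<^bsub>R\<^esub> \<and> w \<otimes>\<^bsub>R\<^esub> x = \<zero>\<^bsub>R\<^esub>"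
  proof (cases "i = j")
    case False
    then have "x = \<zero>\<^bsub>R\<^esub>"
      using graph_inj[OF _ I(1,2) False x(2)] x(1) by (simp add: cell_def)
    then show ?thesis
      using R.l_null[OF wc] R.r_null[OF wc] by metis
  next
    case True
    then have d: "x \<in> span R (diag_gens i)"
      using x by (simp add: cell_def)
    have "x \<otimes>\<^bsub>R\<^esub> w = \<zero>\<^bsub>R\<^esub>"
    proof (cases "p = i")
      case True
      have w': "w \<in> graph i q" "i \<noteq> q"
        using w ne unfolding True .
      show ?thesis
        using graph_inj[OF diag_mult_graph[OF I(1,4) w'(2) d w'(1)] I(1,4) w'(2)] x(2) fw by simp
    next
      case False
      then show ?thesis
        using diag_mult_graph_zero[OF I(1,3,4) ne _ d w] by blast
    qed
    moreover have "w \<otimes>\<^bsub>R\<^esub> x = \<zero>\<^bsub>R\<^esub>"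
    proof (cases "q = i")
      case True
      have w': "w \<in> graph p i" "p \<noteq> i"
        using w ne unfolding True .
      show ?thesis
        using graph_inj[OF graph_mult_diag[OF I(1,3) w'(2) d w'(1)] I(3,1) w'(2)] x(2) fw by simp
    next
      case False
      then show ?thesis
        using graph_mult_diag_zero[OF I(1,3,4) ne _ d w] by blast
    qed
    ultimately show ?thesis ..
  qed
  then show "x \<otimes>\<^bsub>R\<^esub> w = \<zero>\<^bsub>R\<^esub>" "w \<otimes>\<^bsub>R\<^esub> x = \<zero>\<^bsub>R\<^esub>"
    by blast+
qed

lemma cover_kernel:
  assumes t: "t \<in> cover" "fst t = \<zero>" and y: "y \<in> cover"
  shows "t \<otimes>\<^bsub>R\<^esub> y = \<zero>\<^bsub>R\<^esub>" and "y \<otimes>\<^bsub>R\<^esub> t = \<zero>\<^bsub>R\<^esub>"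
proof -
  obtain g where g: "\<forall>i\<in>I. \<forall>j\<in>I. g (i, j) \<in> cell i j \<and> fst (g (i, j)) = l i (r j (fst t))"
    "t = finsum R g (I \<times> I)"
    using cover_decomp[OF t(1)] by blast
  let ?N = "{x. \<exists>i\<in>I. \<exists>j\<in>I. x \<in> cell i j \<and> fst x = \<zero>}"
  have N: "?N \<subseteq> carrier R"
    using cell_closed by blast
  have gN: "g (i, j) \<in> ?N" if "i \<in> I" "j \<in> I" for i j
    using g(1) that t(2) by auto
  have tN: "t \<in> span R ?N"
    unfolding g(2)
  proof (rule R.finsum_in_span[OF N])
    fix p assume "p \<in> I \<times> I"
    then show "g p \<in> span R ?N"
      using gN by (cases p) (auto intro!: R.span_base)
  qed (use finite_I in simp)
  have tc: "t \<in> carrier R"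
    using cover_closed[OF t(1)] .
  have *: "t \<otimes>\<^bsub>R\<^esub> w = \<zero>\<^bsub>R\<^esub> \<and> w \<otimes>\<^bsub>R\<^esub> t = \<zero>\<^bsub>R\<^esub>"
    if pq: "p \<in> I" "q \<in> I" "p \<noteq> q" and w: "w \<in> graph p q" for p q w
  proof -
    have wc: "w \<in> carrier R"
      using graph_closed[OF pq(1,2) w] .
    have "x \<otimes>\<^bsub>R\<^esub> w = \<zero>\<^bsub>R\<^esub>" "w \<otimes>\<^bsub>R\<^esub> x = \<zero>\<^bsub>R\<^esub>" if "x \<in> ?N" for x
      using that cell_kernel_graph[OF _ _ pq _ _ w] by blast+
    then show ?thesis
      using R.span_mult_right_zero[OF tN N wc] R.span_mult_left_zero[OF tN N wc] by blast
  qed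
  have "t \<otimes>\<^bsub>R\<^esub> y = \<zero>\<^bsub>R\<^esub> \<and> y \<otimes>\<^bsub>R\<^esub> t = \<zero>\<^bsub>R\<^esub>"
    using y
  proof (induction rule: cover_induct)
    case zero
    then show ?case
      using R.l_null[OF tc] R.r_null[OF tc] by blast
  next
    case (graph i j x)
    then show ?case
      using * by blast
  next
    case (diag i k g h)
    have c: "g \<in> carrier R" "h \<in> carrier R"
      using graph_closed[OF diag(1,2,4)] graph_closed[OF diag(2,1,5)] .
    have "t \<otimes>\<^bsub>R\<^esub> g = \<zero>\<^bsub>R\<^esub>" "h \<otimes>\<^bsub>R\<^esub> t = \<zero>\<^bsub>R\<^esub>"
      using *[OF diag(1,2) _ diag(4)] *[OF diag(2,1,3,5)] diag(3) by auto
    then show ?case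
      using R.m_assoc[OF tc c] R.m_assoc[OF c tc] R.l_null[OF c(2)] R.r_null[OF c(1)] by metis
  next
    case (neg x)
    then show ?case
      using R.l_minus[OF neg(1) tc] R.r_minus[OF tc neg(1)] R.neg_zero by metis
  next
    case (add x y)
    then show ?case
      using R.l_distr[OF add(1,2) tc] R.r_distr[OF add(1,2) tc] R.l_zero[OF R.zero_closed] by metis
  qed
  then show "t \<otimes>\<^bsub>R\<^esub> y = \<zero>\<^bsub>R\<^esub>" "y \<otimes>\<^bsub>R\<^esub> t = \<zero>\<^bsub>R\<^esub>"
    by blast+
qed

theorem annihilator_extension_Cover: "annihilator_extension Cover fst A"
proof -
  have "fst \<in> rng_hom Cover A"
    using cover_fst_surj by (auto simp: rng_hom_def hom_def)
  moreover have "a_kernel Cover A fst \<subseteq> annihilator Cover"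
  proof
    fix x assume "x \<in> a_kernel Cover A fst"
    then have x: "x \<in> cover" "fst x = \<zero>"
      by (auto simp: a_kernel_def')
    have "x \<otimes>\<^bsub>R\<^esub> y = \<zero>\<^bsub>R\<^esub> \<and> y \<otimes>\<^bsub>R\<^esub> x = \<zero>\<^bsub>R\<^esub>" if "y \<in> cover" for y
      using cover_kernel[OF x that] by blast
    then show "x \<in> annihilator Cover"
      using x by (simp add: annihilator_def)
  qed
  ultimately show ?thesis
    using idempotent_Cover idempotent_ring cover_fst_surj by (simp add: annihilator_extension_def)
qed

end

section \<open>Orthogonality of the associative and the antiassociative part\<close>

context lie_ideal_map
begin

interpretation dual: lie_ideal_map "op_ring A" I r l B "\<lambda>a. \<ominus>\<^bsub>B\<^esub> f a"
  by (rule lie_ideal_map_dual)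

lemma neg_mult_neg: "x \<in> carrier B \<Longrightarrow> y \<in> carrier B \<Longrightarrow> (\<ominus>\<^bsub>B\<^esub> x) \<otimes>\<^bsub>B\<^esub> (\<ominus>\<^bsub>B\<^esub> y) = x \<otimes>\<^bsub>B\<^esub> y"
  by (simp add: B.l_minus B.r_minus B.minus_minus)

lemma f_reverse_triple_left:
  assumes I: "i \<in> I" "k \<in> I" "j \<in> I" "p \<in> I" "q \<in> I"
    and ne: "i \<noteq> k" "k \<noteq> j" "i \<noteq> j" "p \<noteq> q" "q \<noteq> i"
    and a: "a \<in> C k i" and b: "b \<in> C j k" and c: "c \<in> C q p"
  shows "f c \<otimes>\<^bsub>B\<^esub> (f a \<otimes>\<^bsub>B\<^esub> f b) = \<zero>\<^bsub>B\<^esub>"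
proof -
  have cl: "f a \<in> carrier B" "f b \<in> carrier B" "f c \<in> carrier B"
    using f_comp_closed[OF I(2,1) ne(1)[symmetric] a] f_comp_closed[OF I(3,2) ne(2)[symmetric] b]
      f_comp_closed[OF I(5,4) ne(4)[symmetric] c] .
  have "\<ominus>\<^bsub>B\<^esub> (f c \<otimes>\<^bsub>B\<^esub> (f a \<otimes>\<^bsub>B\<^esub> f b)) = \<zero>\<^bsub>B\<^esub>"
    using dual.f_triple_left[OF I ne, of a b c] a b c cl neg_mult_neg by (simp add: B.l_minus)
  then show ?thesis
    using cl B.minus_minus[of "f c \<otimes>\<^bsub>B\<^esub> (f a \<otimes>\<^bsub>B\<^esub> f b)"] by (simp add: B.neg_zero)
qed

text \<open>
  The forward product \<open>f a \<cdot> f b\<close> of place \<open>(i, j)\<close> tolerates on its right only factors from row \<open>j\<close>, and the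
  backward product \<open>f c \<cdot> f d\<close> tolerates on its left only factors from row \<open>q\<close>. In the remaining case
  \<open>c \<in> A\<^sub>j\<^sub>k\<close> is factored through a further index, and then one of the neighbours fails to fit.
\<close>

lemma f_orthogonal_right:
  assumes I: "i \<in> I" "k \<in> I" "j \<in> I" "p \<in> I" "m \<in> I" "q \<in> I"
    and ne: "i \<noteq> k" "k \<noteq> j" "i \<noteq> j" "p \<noteq> m" "m \<noteq> q" "p \<noteq> q"
    and a: "a \<in> C i k" and b: "b \<in> C k j" and c: "c \<in> C m q" and d: "d \<in> C p m"
  shows "f a \<otimes>\<^bsub>B\<^esub> f b \<otimes>\<^bsub>B\<^esub> (f c \<otimes>\<^bsub>B\<^esub> f d) = \<zero>\<^bsub>B\<^esub>"
proof -
  have cl: "f a \<in> carrier B" "f b \<in> carrier B" "f c \<in> carrier B" "f d \<in> carrier B"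
    using f_comp_closed[OF I(1,2) ne(1) a] f_comp_closed[OF I(2,3) ne(2) b]
      f_comp_closed[OF I(5,6) ne(5) c] f_comp_closed[OF I(4,5) ne(4) d] .
  consider "m \<noteq> j" | "k \<noteq> q" | "m = j" "k = q"
    by blast
  then show ?thesis
  proof cases
    case 1
    have "f a \<otimes>\<^bsub>B\<^esub> f b \<otimes>\<^bsub>B\<^esub> f c = \<zero>\<^bsub>B\<^esub>"
      using f_triple_right[OF I(1-3,5,6) ne(1-3,5) 1 a b c] .
    then show ?thesis
      using cl by (simp flip: B.m_assoc)
  next
    case 2
    have "f b \<otimes>\<^bsub>B\<^esub> (f c \<otimes>\<^bsub>B\<^esub> f d) = \<zero>\<^bsub>B\<^esub>"
      using f_reverse_triple_left[OF I(6,5,4,3,2) ne(5)[symmetric] ne(4)[symmetric] ne(6)[symmetric] ne(2)[symmetric] 2 c d b] .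
    then show ?thesis
      using cl by (simp add: B.m_assoc)
  next
    case 3
    have c': "c \<in> C j k" and d': "d \<in> C p j" and ne': "p \<noteq> j" "p \<noteq> k"
      using c d ne(4,6) unfolding 3 by auto
    obtain n where n: "n \<in> I" "n \<noteq> j" "n \<noteq> k"
      using fresh by blast
    show ?thesis
    proof (rule f_comp_induct[where b = c and i = j and j = k and m = n])
      fix x y assume xy: "x \<in> C j n" "y \<in> C n k"
      have xyc: "f x \<in> carrier B" "f y \<in> carrier B"
        using f_comp_closed[OF I(3) n(1) n(2)[symmetric] xy(1)] f_comp_closed[OF n(1) I(2) n(3) xy(2)] .
      have 1: "f a \<otimes>\<^bsub>B\<^esub> f b \<otimes>\<^bsub>B\<^esub> f y = \<zero>\<^bsub>B\<^esub>"
        using f_triple_right[OF I(1-3) n(1) I(2) ne(1-3) n(3,2) a b xy(2)] .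
      have 2: "f y \<otimes>\<^bsub>B\<^esub> f d = \<zero>\<^bsub>B\<^esub>"
        using f_mult_zero[OF n(1) I(2,4,3) n(3) ne'(1) ne'(2)[symmetric] n(2) xy(2) d'] .
      have "f a \<otimes>\<^bsub>B\<^esub> f b \<otimes>\<^bsub>B\<^esub> (bracket B (f x) (f y) \<otimes>\<^bsub>B\<^esub> f d) =
          f a \<otimes>\<^bsub>B\<^esub> f b \<otimes>\<^bsub>B\<^esub> (f x \<otimes>\<^bsub>B\<^esub> (f y \<otimes>\<^bsub>B\<^esub> f d)) \<ominus>\<^bsub>B\<^esub>
          f a \<otimes>\<^bsub>B\<^esub> f b \<otimes>\<^bsub>B\<^esub> f y \<otimes>\<^bsub>B\<^esub> (f x \<otimes>\<^bsub>B\<^esub> f d)"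
        using cl xyc by (simp add: bracket_def B.l_diff B.r_diff B.m_assoc)
      also have "\<dots> = \<zero>\<^bsub>B\<^esub>"
        unfolding 1 2 using cl xyc by (simp add: B.neg_zero)
      finally show "f a \<otimes>\<^bsub>B\<^esub> f b \<otimes>\<^bsub>B\<^esub> (bracket B (f x) (f y) \<otimes>\<^bsub>B\<^esub> f d) = \<zero>\<^bsub>B\<^esub>" .
    qed (use I ne n c' cl in \<open>auto simp: B.l_distr B.r_distr B.l_minus B.r_minus B.neg_zero\<close>)
  qed
qed

end

context lie_ideal_map
begin

interpretation mirror: lie_ideal_map "op_ring A" I r l "op_ring B" f
  by (rule lie_ideal_map_mirror)

lemma f_orthogonal_left:
  assumes "i \<in> I" "k \<in> I" "j \<in> I" "p \<in> I" "m \<in> I" "q \<in> I"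
    and "i \<noteq> k" "k \<noteq> j" "i \<noteq> j" "p \<noteq> m" "m \<noteq> q" "p \<noteq> q"
    and "a \<in> C i k" "b \<in> C k j" "c \<in> C m q" "d \<in> C p m"
  shows "f c \<otimes>\<^bsub>B\<^esub> f d \<otimes>\<^bsub>B\<^esub> (f a \<otimes>\<^bsub>B\<^esub> f b) = \<zero>\<^bsub>B\<^esub>"
  using mirror.f_orthogonal_right[of j k i q m p b a d c] assms by simp

lemma cover_kill:
  assumes s: "s \<in> carrier B"
    and kill: "\<And>i k j a b. \<lbrakk>i \<in> I; k \<in> I; j \<in> I; i \<noteq> k; k \<noteq> j; i \<noteq> j; a \<in> C i k; b \<in> C k j\<rbrakk> \<Longrightarrow>
      f a \<otimes>\<^bsub>B\<^esub> f b \<otimes>\<^bsub>B\<^esub> s = \<zero>\<^bsub>B\<^esub> \<and> s \<otimes>\<^bsub>B\<^esub> (f a \<otimes>\<^bsub>B\<^esub> f b) = \<zero>\<^bsub>B\<^esub>"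
    and t: "t \<in> cover"
  shows "snd t \<otimes>\<^bsub>B\<^esub> s = \<zero>\<^bsub>B\<^esub> \<and> s \<otimes>\<^bsub>B\<^esub> snd t = \<zero>\<^bsub>B\<^esub>"
proof -
  have gr: "snd g \<otimes>\<^bsub>B\<^esub> s = \<zero>\<^bsub>B\<^esub> \<and> s \<otimes>\<^bsub>B\<^esub> snd g = \<zero>\<^bsub>B\<^esub>"
    if g: "g \<in> graph i j" and ij: "i \<in> I" "j \<in> I" "i \<noteq> j" for g i j
    using g ij(1,2)
  proof (induction rule: graph_induct)
    case (base k a b)
    then show ?case
      using kill[OF ij(1) base(1) ij(2) base(2)[symmetric] base(3) ij(3) base(4,5)] by simp
  next
    case (neg x)
    then show ?case
      using R_neg[OF neg(1)] s by (auto simp: B.l_minus B.r_minus B.neg_zero)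
  qed (use s in \<open>auto simp: B.l_distr B.r_distr\<close>)
  show ?thesis
    using t
  proof (induction rule: cover_induct)
    case (graph i j x)
    then show ?case
      using gr by blast
  next
    case (diag i k g h)
    have c: "snd g \<in> carrier B" "snd h \<in> carrier B"
      using graph_closed[OF diag(1,2,4)] graph_closed[OF diag(2,1,5)] by auto
    have "snd h \<otimes>\<^bsub>B\<^esub> s = \<zero>\<^bsub>B\<^esub>" "s \<otimes>\<^bsub>B\<^esub> snd g = \<zero>\<^bsub>B\<^esub>"
      using gr[OF diag(4,1,2)] gr[OF diag(5,2,1)] diag(3) by auto
    then show ?case
      using B.m_assoc[OF c s] B.m_assoc[OF s c] c by simp
  next
    case (neg x)
    then show ?case
      using R_neg[OF neg(1)] s by (auto simp: B.l_minus B.r_minus B.neg_zero)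
  qed (use s in \<open>auto simp: B.l_distr B.r_distr\<close>)
qed

end

context lie_ideal_map
begin

interpretation dual: lie_ideal_map "op_ring A" I r l B "\<lambda>a. \<ominus>\<^bsub>B\<^esub> f a"
  by (rule lie_ideal_map_dual)

lemma cover_orthogonal:
  assumes t: "t \<in> cover" and t': "t' \<in> dual.cover"
  shows "snd t \<otimes>\<^bsub>B\<^esub> snd t' = \<zero>\<^bsub>B\<^esub>" and "snd t' \<otimes>\<^bsub>B\<^esub> snd t = \<zero>\<^bsub>B\<^esub>"
proof -
  have tc: "snd t \<in> carrier B"
    using cover_closed[OF t] by auto
  have "snd t' \<otimes>\<^bsub>B\<^esub> snd t = \<zero>\<^bsub>B\<^esub> \<and> snd t \<otimes>\<^bsub>B\<^esub> snd t' = \<zero>\<^bsub>B\<^esub>"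
  proof (rule dual.cover_kill[OF tc _ t'])
    fix q m p c d
    assume I: "q \<in> I" "m \<in> I" "p \<in> I" and ne: "q \<noteq> m" "m \<noteq> p" "q \<noteq> p"
      and "c \<in> dual.C q m" "d \<in> dual.C m p"
    then have cd: "c \<in> C m q" "d \<in> C p m"
      by auto
    have cl: "f c \<in> carrier B" "f d \<in> carrier B"
      using f_comp_closed[OF I(2,1) ne(1)[symmetric] cd(1)] f_comp_closed[OF I(3,2) ne(2)[symmetric] cd(2)] .
    have "snd t \<otimes>\<^bsub>B\<^esub> (f c \<otimes>\<^bsub>B\<^esub> f d) = \<zero>\<^bsub>B\<^esub> \<and> f c \<otimes>\<^bsub>B\<^esub> f d \<otimes>\<^bsub>B\<^esub> snd t = \<zero>\<^bsub>B\<^esub>"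
      using f_orthogonal_right[OF _ _ _ I(3,2,1) _ _ _ ne(2)[symmetric] ne(1)[symmetric] ne(3)[symmetric] _ _ cd]
        f_orthogonal_left[OF _ _ _ I(3,2,1) _ _ _ ne(2)[symmetric] ne(1)[symmetric] ne(3)[symmetric] _ _ cd]
      by (intro cover_kill[OF _ _ t] B.m_closed cl) blast
    then show "(\<ominus>\<^bsub>B\<^esub> f c) \<otimes>\<^bsub>B\<^esub> (\<ominus>\<^bsub>B\<^esub> f d) \<otimes>\<^bsub>B\<^esub> snd t = \<zero>\<^bsub>B\<^esub> \<and>
        snd t \<otimes>\<^bsub>B\<^esub> ((\<ominus>\<^bsub>B\<^esub> f c) \<otimes>\<^bsub>B\<^esub> (\<ominus>\<^bsub>B\<^esub> f d)) = \<zero>\<^bsub>B\<^esub>"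
      unfolding neg_mult_neg[OF cl] by blast
  qed
  then show "snd t \<otimes>\<^bsub>B\<^esub> snd t' = \<zero>\<^bsub>B\<^esub>" "snd t' \<otimes>\<^bsub>B\<^esub> snd t = \<zero>\<^bsub>B\<^esub>"
    by blast+
qed

end

section \<open>Homomorphisms and annihilator extensions\<close>

lemma rng_homD:
  assumes "h \<in> rng_hom R S" and "x \<in> carrier R"
  shows "h x \<in> carrier S"
    and "y \<in> carrier R \<Longrightarrow> h (x \<otimes>\<^bsub>R\<^esub> y) = h x \<otimes>\<^bsub>S\<^esub> h y"
    and "y \<in> carrier R \<Longrightarrow> h (x \<oplus>\<^bsub>R\<^esub> y) = h x \<oplus>\<^bsub>S\<^esub> h y"
  using assms by (auto simp: rng_hom_def hom_def)

lemma rng_hom_zero_neg: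
  assumes R: "abelian_group R" and S: "abelian_group S" and h: "h \<in> rng_hom R S"
  shows "h \<zero>\<^bsub>R\<^esub> = \<zero>\<^bsub>S\<^esub>" and "x \<in> carrier R \<Longrightarrow> h (\<ominus>\<^bsub>R\<^esub> x) = \<ominus>\<^bsub>S\<^esub> h x"
proof -
  interpret R: abelian_group R by fact
  interpret S: abelian_group S by fact
  show 0: "h \<zero>\<^bsub>R\<^esub> = \<zero>\<^bsub>S\<^esub>"
    using rng_homD[OF h, of "\<zero>\<^bsub>R\<^esub>"] by (intro S.zero_of_double) auto
  assume x: "x \<in> carrier R"
  then have "h (\<ominus>\<^bsub>R\<^esub> x) \<oplus>\<^bsub>S\<^esub> h x = \<zero>\<^bsub>S\<^esub>"
    using rng_homD(3)[OF h, of "\<ominus>\<^bsub>R\<^esub> x" x] 0 by (simp add: R.l_neg)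
  then show "h (\<ominus>\<^bsub>R\<^esub> x) = \<ominus>\<^bsub>S\<^esub> h x"
    using x rng_homD(1)[OF h] by (intro S.minus_equality[symmetric]) auto
qed

lemma rng_hom_bracket:
  assumes R: "nonassoc_ring R" and S: "nonassoc_ring S" and h: "h \<in> rng_hom R S"
    and x: "x \<in> carrier R" and y: "y \<in> carrier R"
  shows "h (bracket R x y) = bracket S (h x) (h y)"
proof -
  interpret R: nonassoc_ring R by fact
  interpret S: nonassoc_ring S by fact
  show ?thesis
    using x y rng_homD[OF h] rng_hom_zero_neg(2)[OF R.abelian_group_axioms S.abelian_group_axioms h]
    by (simp add: bracket_def R.minus_eq S.minus_eq)
qed

text \<open>
  Changing a factor by an element of the annihilator does not change the product.
\<close>

lemma annihilator_extension_mult_eq: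
  assumes ext: "annihilator_extension E \<psi> C" and x: "x \<in> carrier E" "x' \<in> carrier E" "\<psi> x = \<psi> x'"
    and y: "y \<in> carrier E" "y' \<in> carrier E" "\<psi> y = \<psi> y'"
  shows "x \<otimes>\<^bsub>E\<^esub> y = x' \<otimes>\<^bsub>E\<^esub> y'"
proof -
  interpret E: assoc_ring E
    using ext by (simp add: annihilator_extension_def idempotent_ring_def)
  interpret C: assoc_ring C
    using ext by (simp add: annihilator_extension_def idempotent_ring_def)
  have hom: "\<psi> \<in> rng_hom E C" and ker: "a_kernel E C \<psi> \<subseteq> annihilator E"
    using ext by (auto simp: annihilator_extension_def)
  have ann: "a \<ominus>\<^bsub>E\<^esub> b \<in> annihilator E" if "a \<in> carrier E" "b \<in> carrier E" "\<psi> a = \<psi> b" for a b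
    using rng_hom_kernel_diff[OF E.abelian_group_axioms C.abelian_group_axioms hom that] ker by blast
  have "x \<otimes>\<^bsub>E\<^esub> y \<ominus>\<^bsub>E\<^esub> x' \<otimes>\<^bsub>E\<^esub> y = \<zero>\<^bsub>E\<^esub>"
    using ann[OF x] x(1,2) y(1) by (simp add: annihilator_def flip: E.l_diff)
  then have "x \<otimes>\<^bsub>E\<^esub> y = x' \<otimes>\<^bsub>E\<^esub> y"
    by (rule E.minus_eq_zeroD[OF E.m_closed[OF x(1) y(1)] E.m_closed[OF x(2) y(1)]])
  moreover have "x' \<otimes>\<^bsub>E\<^esub> y \<ominus>\<^bsub>E\<^esub> x' \<otimes>\<^bsub>E\<^esub> y' = \<zero>\<^bsub>E\<^esub>"
    using ann[OF y] x(1,2) y(1,2) by (simp add: annihilator_def flip: E.r_diff)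
  then have "x' \<otimes>\<^bsub>E\<^esub> y = x' \<otimes>\<^bsub>E\<^esub> y'"
    by (rule E.minus_eq_zeroD[OF E.m_closed[OF x(2) y(1)] E.m_closed[OF x(2) y(2)]])
  ultimately show ?thesis
    by simp
qed

lemma idempotent_RDirProd:
  assumes R: "idempotent_ring R" and S: "idempotent_ring S"
  shows "idempotent_ring (RDirProd R S)"
proof -
  have R': "assoc_ring R" and S': "assoc_ring S"
    using R S by (auto simp: idempotent_ring_def)
  interpret R: assoc_ring R by fact
  interpret S: assoc_ring S by fact
  interpret RS: assoc_ring "RDirProd R S"
    by (rule assoc_ring_RDirProd) fact+
  let ?P = "{x \<otimes>\<^bsub>RDirProd R S\<^esub> y | x y. x \<in> carrier (RDirProd R S) \<and> y \<in> carrier (RDirProd R S)}"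
  have P: "?P \<subseteq> carrier (RDirProd R S)"
    using RS.m_closed by blast
  have 1: "(x, \<zero>\<^bsub>S\<^esub>) \<in> span (RDirProd R S) ?P" if "x \<in> carrier R" for x
  proof (rule span_hom[where h = "\<lambda>x. (x, \<zero>\<^bsub>S\<^esub>)", OF R.abelian_group_axioms RS.abelian_group_axioms _ P])
    show "x \<in> span R {a \<otimes>\<^bsub>R\<^esub> b | a b. a \<in> carrier R \<and> b \<in> carrier R}"
      using R that by (simp add: idempotent_ring_def span_prod_eq_span)
    fix y assume "y \<in> {a \<otimes>\<^bsub>R\<^esub> b | a b. a \<in> carrier R \<and> b \<in> carrier R}"
    then obtain a b where ab: "a \<in> carrier R" "b \<in> carrier R" "y = a \<otimes>\<^bsub>R\<^esub> b"
      by blast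
    then have "(y, \<zero>\<^bsub>S\<^esub>) = (a, \<zero>\<^bsub>S\<^esub>) \<otimes>\<^bsub>RDirProd R S\<^esub> (b, \<zero>\<^bsub>S\<^esub>)"
      by simp
    moreover have "(a, \<zero>\<^bsub>S\<^esub>) \<in> carrier (RDirProd R S)" "(b, \<zero>\<^bsub>S\<^esub>) \<in> carrier (RDirProd R S)"
      using ab by auto
    ultimately show "(y, \<zero>\<^bsub>S\<^esub>) \<in> span (RDirProd R S) ?P"
      by (intro RS.span_base) blast
  qed auto
  have 2: "(\<zero>\<^bsub>R\<^esub>, x) \<in> span (RDirProd R S) ?P" if "x \<in> carrier S" for x
  proof (rule span_hom[where h = "\<lambda>x. (\<zero>\<^bsub>R\<^esub>, x)", OF S.abelian_group_axioms RS.abelian_group_axioms _ P])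
    show "x \<in> span S {a \<otimes>\<^bsub>S\<^esub> b | a b. a \<in> carrier S \<and> b \<in> carrier S}"
      using S that by (simp add: idempotent_ring_def span_prod_eq_span)
    fix y assume "y \<in> {a \<otimes>\<^bsub>S\<^esub> b | a b. a \<in> carrier S \<and> b \<in> carrier S}"
    then obtain a b where ab: "a \<in> carrier S" "b \<in> carrier S" "y = a \<otimes>\<^bsub>S\<^esub> b"
      by blast
    then have "(\<zero>\<^bsub>R\<^esub>, y) = (\<zero>\<^bsub>R\<^esub>, a) \<otimes>\<^bsub>RDirProd R S\<^esub> (\<zero>\<^bsub>R\<^esub>, b)"
      by simp
    moreover have "(\<zero>\<^bsub>R\<^esub>, a) \<in> carrier (RDirProd R S)" "(\<zero>\<^bsub>R\<^esub>, b) \<in> carrier (RDirProd R S)"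
      using ab by auto
    ultimately show "(\<zero>\<^bsub>R\<^esub>, y) \<in> span (RDirProd R S) ?P"
      by (intro RS.span_base) blast
  qed auto
  have "x \<in> span (RDirProd R S) ?P" if "x \<in> carrier (RDirProd R S)" for x
  proof -
    have "(fst x, \<zero>\<^bsub>S\<^esub>) \<oplus>\<^bsub>RDirProd R S\<^esub> (\<zero>\<^bsub>R\<^esub>, snd x) \<in> span (RDirProd R S) ?P"
      using that by (intro RS.span_add 1 2) auto
    then show ?thesis
      using that by auto
  qed
  then show ?thesis
    using RS.assoc_ring_axioms RS.span_prod_closed[of "carrier (RDirProd R S)" "carrier (RDirProd R S)"]
    unfolding idempotent_ring_def span_prod_eq_span by blast
qed

lemma annihilator_extension_RDirProd:
  assumes E: "annihilator_extension E \<psi> C" and E': "annihilator_extension E' \<psi>' C'"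
  shows "annihilator_extension (RDirProd E E') (map_prod \<psi> \<psi>') (RDirProd C C')"
proof -
  have idem: "idempotent_ring E" "idempotent_ring E'" "idempotent_ring C" "idempotent_ring C'"
    and hom: "\<psi> \<in> rng_hom E C" "\<psi>' \<in> rng_hom E' C'"
    and sur: "\<psi> ` carrier E = carrier C" "\<psi>' ` carrier E' = carrier C'"
    and ker: "a_kernel E C \<psi> \<subseteq> annihilator E" "a_kernel E' C' \<psi>' \<subseteq> annihilator E'"
    using E E' by (auto simp: annihilator_extension_def)
  have "map_prod \<psi> \<psi>' \<in> rng_hom (RDirProd E E') (RDirProd C C')"
    using hom by (auto simp: rng_hom_def hom_def)
  moreover have "map_prod \<psi> \<psi>' ` carrier (RDirProd E E') = carrier (RDirProd C C')"
    using sur by (simp add: map_prod_surj_on)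
  moreover have "a_kernel (RDirProd E E') (RDirProd C C') (map_prod \<psi> \<psi>') \<subseteq> annihilator (RDirProd E E')"
  proof
    fix x assume "x \<in> a_kernel (RDirProd E E') (RDirProd C C') (map_prod \<psi> \<psi>')"
    then have "fst x \<in> a_kernel E C \<psi>" "snd x \<in> a_kernel E' C' \<psi>'"
      by (auto simp: a_kernel_def')
    then have "fst x \<in> annihilator E" "snd x \<in> annihilator E'"
      using ker by auto
    then show "x \<in> annihilator (RDirProd E E')"
      by (auto simp: annihilator_def mem_Times_iff)
  qed
  ultimately show ?thesis
    using idempotent_RDirProd[OF idem(1,2)] idempotent_RDirProd[OF idem(3,4)] idem by (simp add: annihilator_extension_def)
qed

section \<open>The double cover\<close>

context peirce_ring
begin

text \<open>
  For \<open>a \<in> A\<^sub>i\<^sub>k\<close> and \<open>b \<in> A\<^sub>k\<^sub>j\<close> with \<open>i \<noteq> j\<close> one has \<open>ba = 0\<close>, so \<open>(a, -a) \<cdot> (b, -b) = (ab, 0)\<close> and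
  \<open>(b, -b) \<cdot> (a, -a) = (0, ab)\<close>. Hence the elements \<open>(a, -a)\<close> separate the two summands.
\<close>

lemma double_generated:
  assumes D: "D \<subseteq> carrier (double_ring A)" and zero: "\<zero>\<^bsub>double_ring A\<^esub> \<in> D"
    and neg: "\<And>x. x \<in> D \<Longrightarrow> \<ominus>\<^bsub>double_ring A\<^esub> x \<in> D"
    and add: "\<And>x y. x \<in> D \<Longrightarrow> y \<in> D \<Longrightarrow> x \<oplus>\<^bsub>double_ring A\<^esub> y \<in> D"
    and mult: "\<And>x y. x \<in> D \<Longrightarrow> y \<in> D \<Longrightarrow> x \<otimes>\<^bsub>double_ring A\<^esub> y \<in> D"
    and gens: "\<And>i j a. \<lbrakk>i \<in> I; j \<in> I; i \<noteq> j; a \<in> C i j\<rbrakk> \<Longrightarrow> (a, \<ominus> a) \<in> D"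
  shows "D = carrier (double_ring A)"
proof -
  interpret op: assoc_ring "op_ring A"
    by (rule assoc_ring_op)
  have neg': "\<ominus>\<^bsub>double_ring A\<^esub> (x, y) = (\<ominus> x, \<ominus> y)" if "x \<in> carrier A" "y \<in> carrier A" for x y
    using RDirProd_neg[OF abelian_group_axioms op.abelian_group_axioms, of "(x, y)"] that by simp
  have off_diag: "(x, \<zero>) \<in> D \<and> (\<zero>, x) \<in> D" if ij: "i \<in> I" "j \<in> I" "i \<noteq> j" and x: "x \<in> C i j" for i j x
  proof -
    obtain k where k: "k \<in> I" "k \<noteq> i" "k \<noteq> j"
      using fresh by blast
    have "x \<in> span A {a \<otimes> b | a b. a \<in> C i k \<and> b \<in> C k j}"
      using comp_span[OF ij(1,2) k(1) x] .
    moreover have "{a \<otimes> b | a b. a \<in> C i k \<and> b \<in> C k j} \<subseteq> carrier A"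
      by auto
    ultimately show ?thesis
    proof (induction rule: span_induct)
      case zero
      then show ?case
        using assms(2) by simp
    next
      case (base z)
      then obtain a b where ab: "z = a \<otimes> b" "a \<in> C i k" "b \<in> C k j"
        by blast
      have c: "a \<in> carrier A" "b \<in> carrier A" and ba: "b \<otimes> a = \<zero>"
        using ab comp_mult_zero[of j i b k a k] ij by auto
      have "(a, \<ominus> a) \<in> D" "(b, \<ominus> b) \<in> D"
        using gens[OF ij(1) k(1) _ ab(2)] gens[OF k(1) ij(2) _ ab(3)] k by auto
      then have "(a, \<ominus> a) \<otimes>\<^bsub>double_ring A\<^esub> (b, \<ominus> b) \<in> D" "(b, \<ominus> b) \<otimes>\<^bsub>double_ring A\<^esub> (a, \<ominus> a) \<in> D"
        using mult by blast+
      then show ?case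
        using c ba ab(1) by (simp add: l_minus r_minus minus_minus)
    next
      case (neg z)
      then show ?case
        using assms(3)[of "(z, \<zero>)"] assms(3)[of "(\<zero>, z)"] neg' by (simp add: neg_zero)
    next
      case (add z w)
      then show ?case
        using assms(4)[of "(z, \<zero>)" "(w, \<zero>)"] assms(4)[of "(\<zero>, z)" "(\<zero>, w)"] by simp
    qed
  qed
  have all: "(x, \<zero>) \<in> D \<and> (\<zero>, x) \<in> D" if "x \<in> carrier A" for x
    using that
  proof (induction rule: peirce_induct)
    case zero
    then show ?case
      using assms(2) by simp
  next
    case (off i j x)
    show ?case
      using off_diag[OF off] .
  next
    case (mult x y)
    then show ?case
      using assms(5)[of "(x, \<zero>)" "(y, \<zero>)"] assms(5)[of "(\<zero>, y)" "(\<zero>, x)"] by simp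
  next
    case (neg z)
    then show ?case
      using assms(3)[of "(z, \<zero>)"] assms(3)[of "(\<zero>, z)"] neg' by (simp add: neg_zero)
  next
    case (add z w)
    then show ?case
      using assms(4)[of "(z, \<zero>)" "(w, \<zero>)"] assms(4)[of "(\<zero>, z)" "(\<zero>, w)"] by simp
  qed
  have "(x, y) \<in> D" if xy: "x \<in> carrier A" "y \<in> carrier A" for x y
  proof -
    have "(x, \<zero>) \<oplus>\<^bsub>double_ring A\<^esub> (\<zero>, y) \<in> D"
      using all xy add by blast
    then show ?thesis
      using xy by simp
  qed
  then show ?thesis
    using D by (intro equalityI) auto
qed

end

context lie_ideal_map
begin

interpretation dual: lie_ideal_map "op_ring A" I r l B "\<lambda>a. \<ominus>\<^bsub>B\<^esub> f a"
  by (rule lie_ideal_map_dual)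

definition "Double = RDirProd Cover dual.Cover"

text \<open>
  The sum of the associative and the antiassociative value in \<open>B\<close>; it is multiplicative because values of
  the two kinds annihilate each other.
\<close>

definition collapse :: "('a \<times> 'b) \<times> ('a \<times> 'b) \<Rightarrow> 'b"
  where "collapse t = snd (fst t) \<oplus>\<^bsub>B\<^esub> snd (snd t)"

lemma annihilator_extension_Double:
  "annihilator_extension Double (map_prod fst fst) (double_ring A)"
  unfolding Double_def
  using annihilator_extension_RDirProd[OF annihilator_extension_Cover dual.annihilator_extension_Cover] .

lemma Double_carrier: "carrier Double = cover \<times> dual.cover"
  by (simp add: Double_def)

lemma collapse_hom: "collapse \<in> rng_hom Double B"
proof -
  have c: "snd t \<in> carrier B" if "t \<in> cover" for t
    using cover_closed[OF that] by auto
  have c': "snd t \<in> carrier B" if "t \<in> dual.cover" for t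
    using dual.cover_closed[OF that] by auto
  have "collapse (x \<otimes>\<^bsub>Double\<^esub> y) = collapse x \<otimes>\<^bsub>B\<^esub> collapse y"
    if "x \<in> carrier Double" "y \<in> carrier Double" for x y
  proof -
    have x: "fst x \<in> cover" "snd x \<in> dual.cover" "fst y \<in> cover" "snd y \<in> dual.cover"
      using that by (auto simp: Double_carrier)
    have "collapse x \<otimes>\<^bsub>B\<^esub> collapse y =
        (snd (fst x) \<otimes>\<^bsub>B\<^esub> snd (fst y) \<oplus>\<^bsub>B\<^esub> snd (fst x) \<otimes>\<^bsub>B\<^esub> snd (snd y)) \<oplus>\<^bsub>B\<^esub>
        (snd (snd x) \<otimes>\<^bsub>B\<^esub> snd (fst y) \<oplus>\<^bsub>B\<^esub> snd (snd x) \<otimes>\<^bsub>B\<^esub> snd (snd y))"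
      using c[OF x(1)] c[OF x(3)] c'[OF x(2)] c'[OF x(4)]
      by (simp add: collapse_def B.l_distr B.r_distr B.a_ac)
    also have "\<dots> = snd (fst x) \<otimes>\<^bsub>B\<^esub> snd (fst y) \<oplus>\<^bsub>B\<^esub> snd (snd x) \<otimes>\<^bsub>B\<^esub> snd (snd y)"
      using cover_orthogonal(1)[OF x(1,4)] cover_orthogonal(2)[OF x(3,2)]
        c[OF x(1)] c[OF x(3)] c'[OF x(2)] c'[OF x(4)] by simp
    finally show ?thesis
      by (simp add: collapse_def Double_def)
  qed
  moreover have "collapse (x \<oplus>\<^bsub>Double\<^esub> y) = collapse x \<oplus>\<^bsub>B\<^esub> collapse y"
    if "x \<in> carrier Double" "y \<in> carrier Double" for x y
  proof -
    have x: "fst x \<in> cover" "snd x \<in> dual.cover" "fst y \<in> cover" "snd y \<in> dual.cover"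
      using that by (auto simp: Double_carrier)
    then show ?thesis
      using c[OF x(1)] c[OF x(3)] c'[OF x(2)] c'[OF x(4)]
      by (simp add: collapse_def Double_def B.a_ac)
  qed
  moreover have "collapse x \<in> carrier B" if "x \<in> carrier Double" for x
    using that c c' by (auto simp: Double_carrier collapse_def)
  ultimately show ?thesis
    by (simp add: rng_hom_def hom_def)
qed

lemma assoc_ring_Double: "assoc_ring Double"
  using annihilator_extension_Double by (simp add: annihilator_extension_def idempotent_ring_def)

text \<open>
  For \<open>a = [x, y]\<close> the lift consists of \<open>(xy, f x \<cdot> f y)\<close> and \<open>(-xy, - f y \<cdot> f x)\<close>. Lifts are compatible with sums
  and brackets, and such \<open>a\<close> generate \<open>[A, A]\<close> as a Lie ring.
\<close>

lemma exists_lift: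
  assumes "a \<in> K"
  shows "\<exists>t\<in>carrier Double. map_prod fst fst t = (a, \<ominus> a) \<and> collapse t = f a"
proof -
  interpret D: assoc_ring Double
    by (rule assoc_ring_Double)
  interpret dbl: assoc_ring "double_ring A"
    by (rule assoc_ring_RDirProd) unfold_locales
  have hom: "map_prod fst fst \<in> rng_hom Double (double_ring A)"
    using annihilator_extension_Double by (simp add: annihilator_extension_def)
  let ?M = "\<lambda>a. a \<in> K \<and> (\<exists>t\<in>carrier Double. map_prod fst fst t = (a, \<ominus> a) \<and> collapse t = f a)"
  have M_I: "?M a" if "a \<in> K" "t \<in> carrier Double" "map_prod fst fst t = (a, \<ominus> a)" "collapse t = f a" for a t
    using that by blast
  have dneg: "\<ominus>\<^bsub>double_ring A\<^esub> (x, y) = (\<ominus> x, \<ominus> y)" if "x \<in> carrier A" "y \<in> carrier A" for x y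
    using RDirProd_neg[OF abelian_group_axioms dual.abelian_group_axioms, of "(x, y)"] that by simp
  have M_zero: "?M \<zero>"
  proof -
    have "map_prod fst fst \<zero>\<^bsub>Double\<^esub> = (\<zero>, \<ominus> \<zero>)" "collapse \<zero>\<^bsub>Double\<^esub> = f \<zero>"
      using rng_hom_zero_neg(1)[OF D.abelian_group_axioms dbl.abelian_group_axioms hom]
        rng_hom_zero_neg(1)[OF D.abelian_group_axioms B.abelian_group_axioms collapse_hom]
      by (simp_all add: neg_zero)
    then show ?thesis
      using D.zero_closed K_zero by blast
  qed
  have M_add: "?M (a \<oplus> b)" if Ma: "?M a" and Mb: "?M b" for a b
  proof -
    have ab: "a \<in> K" "b \<in> K"
      by (rule conjunct1[OF Ma], rule conjunct1[OF Mb])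
    obtain t where t: "t \<in> carrier Double" "map_prod fst fst t = (a, \<ominus> a)" "collapse t = f a"
      using conjunct2[OF Ma] by blast
    obtain s where s: "s \<in> carrier Double" "map_prod fst fst s = (b, \<ominus> b)" "collapse s = f b"
      using conjunct2[OF Mb] by blast
    note ts = t s
    have "map_prod fst fst (t \<oplus>\<^bsub>Double\<^esub> s) = (a, \<ominus> a) \<oplus>\<^bsub>double_ring A\<^esub> (b, \<ominus> b)"
      using rng_homD(3)[OF hom ts(1,4)] unfolding ts(2,5) .
    also have "\<dots> = (a \<oplus> b, \<ominus> (a \<oplus> b))"
      using ab by (simp add: minus_add)
    finally have "map_prod fst fst (t \<oplus>\<^bsub>Double\<^esub> s) = (a \<oplus> b, \<ominus> (a \<oplus> b))" .
    moreover have "collapse (t \<oplus>\<^bsub>Double\<^esub> s) = f (a \<oplus> b)"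
      using rng_homD(3)[OF collapse_hom ts(1,4)] unfolding ts(3,6) f_add[OF ab] .
    ultimately show ?thesis
      by (rule M_I[OF K_add[OF ab] D.a_closed[OF ts(1,4)]])
  qed
  have M_neg: "?M (\<ominus> a)" if Ma: "?M a" for a
  proof -
    have a: "a \<in> K"
      by (rule conjunct1[OF Ma])
    obtain t where t: "t \<in> carrier Double" "map_prod fst fst t = (a, \<ominus> a)" "collapse t = f a"
      using conjunct2[OF Ma] by blast
    have "map_prod fst fst (\<ominus>\<^bsub>Double\<^esub> t) = (\<ominus> a, \<ominus> (\<ominus> a))"
      using rng_hom_zero_neg(2)[OF D.abelian_group_axioms dbl.abelian_group_axioms hom t(1)] t(2) a
        dneg[of a "\<ominus> a"] by simp
    moreover have "collapse (\<ominus>\<^bsub>Double\<^esub> t) = f (\<ominus> a)"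
      using rng_hom_zero_neg(2)[OF D.abelian_group_axioms B.abelian_group_axioms collapse_hom t(1)] t(3)
        f_neg[OF a] by simp
    ultimately show ?thesis
      by (rule M_I[OF K_neg[OF a] D.a_inv_closed[OF t(1)]])
  qed
  have M_bracket: "?M (bracket A a b)" if Ma: "?M a" and Mb: "?M b" for a b
  proof -
    have ab: "a \<in> K" "b \<in> K"
      by (rule conjunct1[OF Ma], rule conjunct1[OF Mb])
    obtain t where t: "t \<in> carrier Double" "map_prod fst fst t = (a, \<ominus> a)" "collapse t = f a"
      using conjunct2[OF Ma] by blast
    obtain s where s: "s \<in> carrier Double" "map_prod fst fst s = (b, \<ominus> b)" "collapse s = f b"
      using conjunct2[OF Mb] by blast
    note ts = t s
    have "map_prod fst fst (bracket Double t s) = bracket (double_ring A) (a, \<ominus> a) (b, \<ominus> b)"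
      using rng_hom_bracket[OF D.nonassoc_ring_axioms dbl.nonassoc_ring_axioms hom ts(1,4)] ts by simp
    also have "\<dots> = (bracket A a b, \<ominus> bracket A a b)"
      using ab dneg[of "b \<otimes> a" "a \<otimes> b"]
      by (simp add: bracket_def dbl.minus_eq l_minus r_minus minus_minus minus_eq minus_add a_comm)
    finally have "map_prod fst fst (bracket Double t s) = (bracket A a b, \<ominus> bracket A a b)" .
    moreover have "collapse (bracket Double t s) = f (bracket A a b)"
      using rng_hom_bracket[OF D.nonassoc_ring_axioms B.nonassoc_ring_axioms collapse_hom ts(1,4)] ts
        f_bracket[OF ab] by simp
    ultimately show ?thesis
      by (rule M_I[OF K_bracket[OF K_carrier[OF ab(1)] K_carrier[OF ab(2)]] D.bracket_closed[OF ts(1,4)]])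
  qed
  have M_comp: "?M a" if a: "a \<in> C i j" and ij: "i \<in> I" "j \<in> I" "i \<noteq> j" for a i j
  proof -
    obtain k where k: "k \<in> I" "k \<noteq> i" "k \<noteq> j"
      using fresh by blast
    have "a \<in> span A {bracket A x y | x y. x \<in> C i k \<and> y \<in> C k j}"
      using comp_span_bracket[OF ij(1,2) k(1) ij(3) a] .
    moreover have "{bracket A x y | x y. x \<in> C i k \<and> y \<in> C k j} \<subseteq> carrier A"
      by auto
    ultimately show ?thesis
    proof (induction rule: span_induct)
      case (base z)
      then obtain x y where xy: "z = bracket A x y" "x \<in> C i k" "y \<in> C k j"
        by blast
      have z: "z = x \<otimes> y"
        using bracket_comp[OF ij xy(2,3)] xy(1) by simp
      have K: "x \<in> K" "y \<in> K"
        using comp_K[OF ij(1) k(1) k(2)[symmetric] xy(2)] comp_K[OF k(1) ij(2) k(3) xy(3)] .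
      have g: "(x \<otimes> y, f x \<otimes>\<^bsub>B\<^esub> f y) \<in> cover"
        using graph_cover[OF ij graph_base[OF k xy(2,3)]] .
      have "(y \<otimes>\<^bsub>op_ring A\<^esub> x, (\<ominus>\<^bsub>B\<^esub> f y) \<otimes>\<^bsub>B\<^esub> (\<ominus>\<^bsub>B\<^esub> f x)) \<in> dual.graph j i"
        using k xy(2,3) by (intro dual.graph_base[of k]) simp_all
      then have "(x \<otimes> y, f y \<otimes>\<^bsub>B\<^esub> f x) \<in> dual.graph j i"
        using neg_mult_neg[of "f y" "f x"] K by simp
      then have h0: "(x \<otimes> y, f y \<otimes>\<^bsub>B\<^esub> f x) \<in> dual.cover"
        using dual.graph_cover[OF ij(2,1)] ij(3) by blast
      have h: "(\<ominus> (x \<otimes> y), \<ominus>\<^bsub>B\<^esub> (f y \<otimes>\<^bsub>B\<^esub> f x)) \<in> dual.cover"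
        using dual.cover_neg[OF h0] dual.R_neg[OF dual.cover_closed[OF h0]] by simp
      let ?t = "((x \<otimes> y, f x \<otimes>\<^bsub>B\<^esub> f y), (\<ominus> (x \<otimes> y), \<ominus>\<^bsub>B\<^esub> (f y \<otimes>\<^bsub>B\<^esub> f x)))"
      have "z \<in> K"
        using K xy(1) by simp
      moreover have "?t \<in> carrier Double" "map_prod fst fst ?t = (z, \<ominus> z)"
        using g h z by (simp_all add: Double_carrier)
      moreover have "collapse ?t = f z"
        unfolding xy(1) f_bracket[OF K] by (simp add: collapse_def bracket_def B.minus_eq)
      ultimately show ?case
        by (rule M_I)
    next
      case zero
      show ?case
        by (rule M_zero)
    next
      case (neg x)
      show ?case
        using neg(2) by (rule M_neg)
    next
      case (add x y)
      show ?case
        using add(3,4) by (rule M_add)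
    qed
  qed
  have "a \<in> span A lie_gens"
    using commutators_span assms by blast
  then have "?M a"
    using lie_gens_closed
  proof (induction rule: span_induct)
    case (base x)
    then consider i j where "i \<in> I" "j \<in> I" "i \<noteq> j" "x \<in> C i j"
      | y z i j where "x = bracket A y z" "i \<in> I" "j \<in> I" "i \<noteq> j" "y \<in> C i j" "z \<in> C j i"
      unfolding lie_gens_def by blast
    then show ?case
    proof cases
      case 1
      then show ?thesis
        by (intro M_comp[of x i j])
    next
      case (2 y z i j)
      show ?thesis
        unfolding 2(1) by (rule M_bracket[OF M_comp[OF 2(5,2,3,4)] M_comp[OF 2(6,3,2) 2(4)[symmetric]]])
    qed
  next
    case zero
    show ?case
      by (rule M_zero)
  next
    case (neg x)
    show ?case
      using neg(2) by (rule M_neg)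
  next
    case (add x y)
    show ?case
      using add(3,4) by (rule M_add)
  qed
  then show ?thesis
    by blast
qed

text \<open>
  Existence: the universal property lifts \<open>\<omega>\<close> to the double cover, and \<open>collapse\<close> continues to \<open>B\<close>. Uniqueness:
  two candidates agree on a subring of \<open>W\<close> that maps onto \<open>A \<oplus> A\<^sup>o\<^sup>p\<close>, hence on all products in \<open>W\<close>.
\<close>

theorem unique_hom_extending:
  fixes U :: "('l, 'p) ring_scheme" and W :: "('c, 'q) ring_scheme"
  assumes W: "universal_annihilator_extension W \<omega> (double_ring A)"
    and U: "nonassoc_ring U" "span_prod U (carrier U) (carrier U) = carrier U"
    and u: "u ` carrier U = K"
      "\<And>x y. x \<in> carrier U \<Longrightarrow> y \<in> carrier U \<Longrightarrow> u (x \<oplus>\<^bsub>U\<^esub> y) = u x \<oplus> u y"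
      "\<And>x y. x \<in> carrier U \<Longrightarrow> y \<in> carrier U \<Longrightarrow> u (x \<otimes>\<^bsub>U\<^esub> y) = bracket A (u x) (u y)"
    and \<kappa>: "\<And>x. x \<in> carrier U \<Longrightarrow> \<kappa> x \<in> carrier W"
      "\<And>x. x \<in> carrier U \<Longrightarrow> \<omega> (\<kappa> x) = (u x, \<ominus> u x)"
      "\<And>x y. x \<in> carrier U \<Longrightarrow> y \<in> carrier U \<Longrightarrow> \<kappa> (x \<oplus>\<^bsub>U\<^esub> y) = \<kappa> x \<oplus>\<^bsub>W\<^esub> \<kappa> y"
      "\<And>x y. x \<in> carrier U \<Longrightarrow> y \<in> carrier U \<Longrightarrow> \<kappa> (x \<otimes>\<^bsub>U\<^esub> y) = bracket W (\<kappa> x) (\<kappa> y)"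
  shows "\<exists>!\<chi>. \<chi> \<in> rng_hom W B \<and> \<chi> \<in> extensional (carrier W) \<and> (\<forall>x\<in>carrier U. \<chi> (\<kappa> x) = f (u x))"
proof -
  have extW: "annihilator_extension W \<omega> (double_ring A)"
    using W by (simp add: universal_annihilator_extension_def)
  interpret U: nonassoc_ring U by fact
  interpret W: assoc_ring W
    using extW by (simp add: annihilator_extension_def idempotent_ring_def)
  interpret D: assoc_ring Double
    by (rule assoc_ring_Double)
  interpret dbl: assoc_ring "double_ring A"
    using extW by (simp add: annihilator_extension_def idempotent_ring_def)
  have \<omega>: "\<omega> \<in> rng_hom W (double_ring A)" and sur: "\<omega> ` carrier W = carrier (double_ring A)"
    using extW by (auto simp: annihilator_extension_def)
  have uK: "u x \<in> K" if "x \<in> carrier U" for x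
    using u(1) that by blast
  let ?P = "{x \<otimes>\<^bsub>U\<^esub> y | x y. x \<in> carrier U \<and> y \<in> carrier U}"
  have U_span: "carrier U = span U ?P" and P: "?P \<subseteq> carrier U"
    using U(2) by (auto simp: span_prod_eq_span)
  obtain \<rho> where \<rho>: "\<rho> \<in> rng_hom W Double" "\<forall>x\<in>carrier W. map_prod fst fst (\<rho> x) = \<omega> x"
    using universal_annihilator_extension_lift[OF W annihilator_extension_Double] by blast
  define \<chi> where "\<chi> = (\<lambda>x. collapse (\<rho> x))"
  have \<chi>: "\<chi> \<in> rng_hom W B"
    unfolding \<chi>_def using rng_hom_comp[OF \<rho>(1) collapse_hom] .
  have \<chi>\<kappa>_bracket: "\<chi> (\<kappa> z) = f (u z)" if z: "z \<in> ?P" for z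
  proof -
    obtain x y where xy: "z = x \<otimes>\<^bsub>U\<^esub> y" "x \<in> carrier U" "y \<in> carrier U"
      using z by blast
    obtain t s where t: "t \<in> carrier Double" "map_prod fst fst t = (u x, \<ominus> u x)" "collapse t = f (u x)"
      and s: "s \<in> carrier Double" "map_prod fst fst s = (u y, \<ominus> u y)" "collapse s = f (u y)"
      using exists_lift[OF uK[OF xy(2)]] exists_lift[OF uK[OF xy(3)]] by blast
    have \<rho>\<kappa>: "\<rho> (\<kappa> x) \<in> carrier Double" "\<rho> (\<kappa> y) \<in> carrier Double"
      using rng_homD(1)[OF \<rho>(1)] \<kappa>(1) xy by blast+
    have eq: "map_prod fst fst (\<rho> (\<kappa> x)) = map_prod fst fst t" "map_prod fst fst (\<rho> (\<kappa> y)) = map_prod fst fst s"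
      using \<rho>(2) \<kappa>(1)[OF xy(2)] \<kappa>(1)[OF xy(3)] \<kappa>(2)[OF xy(2)] \<kappa>(2)[OF xy(3)] t(2) s(2) by simp_all
    \<comment> \<open>the lifts \<open>\<rho> (\<kappa> x)\<close>, \<open>\<rho> (\<kappa> y)\<close> differ from \<open>t\<close>, \<open>s\<close> only by annihilators, so brackets agree\<close>
    have "\<rho> (\<kappa> z) = bracket Double (\<rho> (\<kappa> x)) (\<rho> (\<kappa> y))"
      unfolding xy(1) \<kappa>(4)[OF xy(2,3)]
      using rng_hom_bracket[OF W.nonassoc_ring_axioms D.nonassoc_ring_axioms \<rho>(1) \<kappa>(1)[OF xy(2)] \<kappa>(1)[OF xy(3)]] .
    also have "\<dots> = bracket Double t s"
      unfolding bracket_def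
      using annihilator_extension_mult_eq[OF annihilator_extension_Double \<rho>\<kappa>(1) t(1) eq(1) \<rho>\<kappa>(2) s(1) eq(2)]
        annihilator_extension_mult_eq[OF annihilator_extension_Double \<rho>\<kappa>(2) s(1) eq(2) \<rho>\<kappa>(1) t(1) eq(1)]
      by simp
    finally have "\<chi> (\<kappa> z) = bracket B (f (u x)) (f (u y))"
      unfolding \<chi>_def
      using rng_hom_bracket[OF D.nonassoc_ring_axioms B.nonassoc_ring_axioms collapse_hom t(1) s(1)] t s by simp
    also have "\<dots> = f (u z)"
      unfolding xy(1) u(3)[OF xy(2,3)] using f_bracket[OF uK[OF xy(2)] uK[OF xy(3)]] by simp
    finally show ?thesis .
  qed
  \<comment> \<open>the difference of both maps is additive and vanishes on brackets\<close>
  have \<chi>\<kappa>: "\<chi> (\<kappa> x) = f (u x)" if x: "x \<in> carrier U" for x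
  proof -
    have c: "\<chi> (\<kappa> y) \<in> carrier B" "f (u y) \<in> carrier B" if "y \<in> carrier U" for y
      using rng_homD(1)[OF \<chi> \<kappa>(1)[OF that]] uK[OF that] by simp_all
    have "\<chi> (\<kappa> x) \<ominus>\<^bsub>B\<^esub> f (u x) \<in> span B {}"
    proof (rule span_hom[where h = "\<lambda>x. \<chi> (\<kappa> x) \<ominus>\<^bsub>B\<^esub> f (u x)", OF U.abelian_group_axioms B.abelian_group_axioms P])
      show "x \<in> span U ?P"
        using U_span x by blast
      show "\<chi> (\<kappa> z) \<ominus>\<^bsub>B\<^esub> f (u z) \<in> span B {}" if "z \<in> ?P" for z
        using \<chi>\<kappa>_bracket[OF that] B.minus_self[OF c(2)[OF subsetD[OF P that]]] B.span_zero by simp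
      fix y z assume yz: "y \<in> carrier U" "z \<in> carrier U"
      show "\<chi> (\<kappa> (y \<oplus>\<^bsub>U\<^esub> z)) \<ominus>\<^bsub>B\<^esub> f (u (y \<oplus>\<^bsub>U\<^esub> z)) =
          (\<chi> (\<kappa> y) \<ominus>\<^bsub>B\<^esub> f (u y)) \<oplus>\<^bsub>B\<^esub> (\<chi> (\<kappa> z) \<ominus>\<^bsub>B\<^esub> f (u z))"
        unfolding \<kappa>(3)[OF yz] u(2)[OF yz] rng_homD(3)[OF \<chi> \<kappa>(1)[OF yz(1)] \<kappa>(1)[OF yz(2)]]
          f_add[OF uK[OF yz(1)] uK[OF yz(2)]]
        using c[OF yz(1)] c[OF yz(2)] by (intro B.add_minus_add)
    qed (use c in auto)
    then show ?thesis
      using B.minus_eq_zeroD[OF c[OF x]] B.span_empty by blast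
  qed
  have unique: "\<chi>1 x = \<chi>2 x"
    if 1: "\<chi>1 \<in> rng_hom W B" "\<forall>x\<in>carrier U. \<chi>1 (\<kappa> x) = f (u x)"
      and 2: "\<chi>2 \<in> rng_hom W B" "\<forall>x\<in>carrier U. \<chi>2 (\<kappa> x) = f (u x)" and x: "x \<in> carrier W" for \<chi>1 \<chi>2 x
  proof -
    let ?W0 = "{w \<in> carrier W. \<chi>1 w = \<chi>2 w}"
    note zn1 = rng_hom_zero_neg[OF W.abelian_group_axioms B.abelian_group_axioms 1(1)]
    note zn2 = rng_hom_zero_neg[OF W.abelian_group_axioms B.abelian_group_axioms 2(1)]
    have W0: "\<zero>\<^bsub>W\<^esub> \<in> ?W0" "\<And>w. w \<in> ?W0 \<Longrightarrow> \<ominus>\<^bsub>W\<^esub> w \<in> ?W0"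
      "\<And>v w. v \<in> ?W0 \<Longrightarrow> w \<in> ?W0 \<Longrightarrow> v \<oplus>\<^bsub>W\<^esub> w \<in> ?W0"
      "\<And>v w. v \<in> ?W0 \<Longrightarrow> w \<in> ?W0 \<Longrightarrow> v \<otimes>\<^bsub>W\<^esub> w \<in> ?W0"
      by (simp_all add: zn1 zn2 rng_homD[OF 1(1)] rng_homD[OF 2(1)])
    have full: "\<omega> ` ?W0 = carrier (double_ring A)"
    proof (rule double_generated)
      show "\<omega> ` ?W0 \<subseteq> carrier (double_ring A)"
        using sur by blast
      show "\<zero>\<^bsub>double_ring A\<^esub> \<in> \<omega> ` ?W0"
        unfolding rng_hom_zero_neg(1)[OF W.abelian_group_axioms dbl.abelian_group_axioms \<omega>, symmetric]
        using W0(1) by (rule imageI)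
    next
      fix x assume "x \<in> \<omega> ` ?W0"
      then obtain w where w: "w \<in> ?W0" "x = \<omega> w"
        by (elim imageE)
      have "\<ominus>\<^bsub>double_ring A\<^esub> x = \<omega> (\<ominus>\<^bsub>W\<^esub> w)"
        unfolding w(2) using rng_hom_zero_neg(2)[OF W.abelian_group_axioms dbl.abelian_group_axioms \<omega>, of w] w(1) by simp
      then show "\<ominus>\<^bsub>double_ring A\<^esub> x \<in> \<omega> ` ?W0"
        using W0(2)[OF w(1)] by (rule image_eqI)
    next
      fix x y assume xy: "x \<in> \<omega> ` ?W0" "y \<in> \<omega> ` ?W0"
      obtain v w where vw: "v \<in> ?W0" "x = \<omega> v" "w \<in> ?W0" "y = \<omega> w"
        using xy by (elim imageE)
      have c: "v \<in> carrier W" "w \<in> carrier W"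
        using vw(1,3) by simp_all
      show "x \<oplus>\<^bsub>double_ring A\<^esub> y \<in> \<omega> ` ?W0"
        unfolding vw(2,4) rng_homD(3)[OF \<omega> c, symmetric] using W0(3)[OF vw(1,3)] by (rule imageI)
      show "x \<otimes>\<^bsub>double_ring A\<^esub> y \<in> \<omega> ` ?W0"
        unfolding vw(2,4) rng_homD(2)[OF \<omega> c, symmetric] using W0(4)[OF vw(1,3)] by (rule imageI)
    next
      fix i j a assume "i \<in> I" "j \<in> I" "i \<noteq> j" "a \<in> C i j"
      then have "a \<in> u ` carrier U"
        unfolding u(1) by (rule comp_K)
      then obtain y where y: "a = u y" "y \<in> carrier U"
        by (rule imageE)
      have "\<kappa> y \<in> ?W0"
        using \<kappa>(1)[OF y(2)] bspec[OF 1(2) y(2)] bspec[OF 2(2) y(2)] by simp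
      moreover have "(a, \<ominus> a) = \<omega> (\<kappa> y)"
        using \<kappa>(2)[OF y(2)] y(1) by simp
      ultimately show "(a, \<ominus> a) \<in> \<omega> ` ?W0"
        by (rule rev_image_eqI)
    qed
    let ?Q = "{x \<otimes>\<^bsub>W\<^esub> y | x y. x \<in> carrier W \<and> y \<in> carrier W}"
    have "x \<in> span W ?Q"
      using x extW by (simp add: annihilator_extension_def idempotent_ring_def span_prod_eq_span)
    moreover have "?Q \<subseteq> carrier W"
      by auto
    ultimately have "x \<in> ?W0"
    proof (induction rule: W.span_induct)
      case (base z)
      then obtain v w where vw: "z = v \<otimes>\<^bsub>W\<^esub> w" "v \<in> carrier W" "w \<in> carrier W"
        by blast
      have "\<omega> v \<in> \<omega> ` ?W0" "\<omega> w \<in> \<omega> ` ?W0"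
        unfolding full using rng_homD(1)[OF \<omega>] vw by blast+
      then obtain v' w' where vw': "v' \<in> ?W0" "\<omega> v = \<omega> v'" "w' \<in> ?W0" "\<omega> w = \<omega> w'"
        by (elim imageE)
      then have "z = v' \<otimes>\<^bsub>W\<^esub> w'"
        unfolding vw(1) by (intro annihilator_extension_mult_eq[OF extW vw(2) _ vw'(2) vw(3) _ vw'(4)]) simp_all
      then show ?case
        using W0(4)[OF vw'(1,3)] by simp
    qed (use W0 in blast)+
    then show ?thesis
      by simp
  qed
  show ?thesis
  proof (rule ex1I[of _ "restrict \<chi> (carrier W)"])
    have "restrict \<chi> (carrier W) \<in> rng_hom W B"
      using \<chi> by (auto simp: rng_hom_def hom_def)
    then show "restrict \<chi> (carrier W) \<in> rng_hom W B \<and> restrict \<chi> (carrier W) \<in> extensional (carrier W) \<and>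
        (\<forall>x\<in>carrier U. restrict \<chi> (carrier W) (\<kappa> x) = f (u x))"
      using \<kappa>(1) \<chi>\<kappa> by simp
  next
    fix \<chi>' assume \<chi>': "\<chi>' \<in> rng_hom W B \<and> \<chi>' \<in> extensional (carrier W) \<and> (\<forall>x\<in>carrier U. \<chi>' (\<kappa> x) = f (u x))"
    show "\<chi>' = restrict \<chi> (carrier W)"
    proof (rule extensionalityI[of _ "carrier W"])
      fix x assume "x \<in> carrier W"
      then show "\<chi>' x = restrict \<chi> (carrier W) x"
        using unique[OF _ _ \<chi>, of \<chi>' x] \<chi>' \<chi>\<kappa> by simp
    qed (use \<chi>' in auto)
  qed
qed

end

section \<open>Three orthogonal idempotents\<close>

text \<open>
  The element \<open>s\<close> is the sum of the three idempotents, so that the formal idempotent \<open>1 - s\<close> acts by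
  \<open>a \<mapsto> a - sa\<close> and \<open>a \<mapsto> a - as\<close>.
\<close>

lemma (in assoc_ring) peirce_ring_idempotents:
  fixes e :: "nat \<Rightarrow> 'a"
  assumes closed: "\<And>i. i \<in> {1..3} \<Longrightarrow> e i \<in> carrier R"
    and idem: "\<And>i. i \<in> {1..3} \<Longrightarrow> e i \<otimes> e i = e i"
    and orth: "\<And>i j. i \<in> {1..3} \<Longrightarrow> j \<in> {1..3} \<Longrightarrow> i \<noteq> j \<Longrightarrow> e i \<otimes> e j = \<zero>"
    and full: "\<And>i. i \<in> {1..3} \<Longrightarrow>
      span R {a \<otimes> e i \<otimes> b | a b. a \<in> carrier R \<and> b \<in> carrier R} = carrier R"
    and full4: "span R {a \<otimes> b \<ominus> (\<Oplus>i\<in>{1..3}. a \<otimes> e i \<otimes> b) | a b.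
      a \<in> carrier R \<and> b \<in> carrier R} = carrier R"
  defines "s \<equiv> e 1 \<oplus> (e 2 \<oplus> e 3)"
  shows "peirce_ring R {1..4} (\<lambda>i a. if i = 4 then a \<ominus> s \<otimes> a else e i \<otimes> a)
    (\<lambda>i a. if i = 4 then a \<ominus> a \<otimes> s else a \<otimes> e i)"
proof -
  let ?l = "\<lambda>i a. if i = 4 then a \<ominus> s \<otimes> a else e i \<otimes> a"
  let ?r = "\<lambda>i a. if i = 4 then a \<ominus> a \<otimes> s else a \<otimes> e i"
  have c: "e 1 \<in> carrier R" "e 2 \<in> carrier R" "e 3 \<in> carrier R"
    using closed by auto
  have sc: "s \<in> carrier R"
    unfolding s_def using c by simp
  have cases4: "i = 4 \<or> i \<in> {1..3}" if "i \<in> {1..4}" for i :: nat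
    using that by auto
  have ec: "e i \<in> carrier R" if "i \<in> {1..4}" "i \<noteq> 4" for i
    using cases4[OF that(1)] that(2) closed by blast
  have cases3: "i = 1 \<or> i = 2 \<or> i = 3" if "i \<in> {1..4}" "i \<noteq> 4" for i :: nat
    using that by auto
  have table: "e 1 \<otimes> e 1 = e 1" "e 2 \<otimes> e 2 = e 2" "e 3 \<otimes> e 3 = e 3"
    "e 1 \<otimes> e 2 = \<zero>" "e 1 \<otimes> e 3 = \<zero>" "e 2 \<otimes> e 1 = \<zero>" "e 2 \<otimes> e 3 = \<zero>" "e 3 \<otimes> e 1 = \<zero>" "e 3 \<otimes> e 2 = \<zero>"
    using idem orth by auto
  have es: "e i \<otimes> s = e i" and se: "s \<otimes> e i = e i" if "i \<in> {1..4}" "i \<noteq> 4" for i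
    using cases3[OF that] c by (auto simp: s_def l_distr r_distr table simp del: One_nat_def)
  have ss: "s \<otimes> s = s"
  proof -
    have "s \<otimes> s = e 1 \<otimes> s \<oplus> (e 2 \<otimes> s \<oplus> e 3 \<otimes> s)"
      using c sc by (subst (1) s_def) (simp add: l_distr)
    then show ?thesis
      using es[of 1] es[of 2] es[of 3] by (simp add: s_def del: One_nat_def)
  qed
  have prod: "e i \<otimes> e j = (if i = j then e i else \<zero>)" if "i \<in> {1..4}" "i \<noteq> 4" "j \<in> {1..4}" "j \<noteq> 4" for i j
    using cases4[OF that(1)] cases4[OF that(3)] that idem orth by auto
  have prod_l: "e i \<otimes> (e j \<otimes> a) = (if i = j then e i \<otimes> a else \<zero>)"
    and prod_r: "(a \<otimes> e j) \<otimes> e i = (if i = j then a \<otimes> e i else \<zero>)"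
    if ij: "i \<in> {1..4}" "i \<noteq> 4" "j \<in> {1..4}" "j \<noteq> 4" and a: "a \<in> carrier R" for i j a
    using prod[OF ij] prod[OF ij(3,4,1,2)] ec ij a m_assoc[of "e i" "e j" a] m_assoc[of a "e j" "e i"] by auto
  have es_l: "e i \<otimes> (s \<otimes> a) = e i \<otimes> a" "s \<otimes> (e i \<otimes> a) = e i \<otimes> a" "(a \<otimes> s) \<otimes> e i = a \<otimes> e i" "(a \<otimes> e i) \<otimes> s = a \<otimes> e i"
    if i: "i \<in> {1..4}" "i \<noteq> 4" and a: "a \<in> carrier R" for i a
    using es[OF i] se[OF i] ec[OF i] sc a m_assoc[of "e i" s a] m_assoc[of s "e i" a] m_assoc[of a s "e i"] m_assoc[of a "e i" s]
    by auto
  have ss_l: "s \<otimes> (s \<otimes> a) = s \<otimes> a" "(a \<otimes> s) \<otimes> s = a \<otimes> s" if a: "a \<in> carrier R" for a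
    using ss sc a m_assoc[of s s a] m_assoc[of a s s] by auto
  have I4: "{1..4} = {1, 2, 3, 4 :: nat}" "{1..3} = {1, 2, 3 :: nat}"
    by auto
  have sum_minus: "x \<oplus> (y \<oplus> (z \<oplus> (a \<ominus> (x \<oplus> (y \<oplus> z))))) = a"
    if "x \<in> carrier R" "y \<in> carrier R" "z \<in> carrier R" "a \<in> carrier R" for x y z a
  proof -
    have "x \<oplus> (y \<oplus> (z \<oplus> (a \<ominus> (x \<oplus> (y \<oplus> z))))) = (a \<ominus> (x \<oplus> (y \<oplus> z))) \<oplus> (x \<oplus> (y \<oplus> z))"
      using that by (simp add: a_ac)
    then show ?thesis
      using that by (simp add: minus_cancel)
  qed
  have mid: "?r i a \<otimes> b = a \<otimes> ?l i b" if "i \<in> {1..4}" "a \<in> carrier R" "b \<in> carrier R" for i a b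
    using that sc ec[of i] by (auto simp: l_diff r_diff m_assoc)
  show ?thesis
  proof (intro peirce_ring.intro peirce_ring_axioms.intro assoc_ring_axioms)
    fix i j :: nat and a assume i: "i \<in> {1..4}" and j: "j \<in> {1..4}" and a: "a \<in> carrier R"
    show "?l i (?l j a) = (if i = j then ?l i a else \<zero>)"
      using i j a sc ec[of i] ec[of j] es_l[OF i _ a] es_l[OF j _ a] ss_l[OF a] prod_l[OF i _ j _ a]
      by (auto simp: l_diff r_diff minus_self)
    show "?r i (?r j a) = (if i = j then ?r i a else \<zero>)"
      using i j a sc ec[of i] ec[of j] es_l[OF i _ a] es_l[OF j _ a] ss_l[OF a] prod_r[OF i _ j _ a]
      by (auto simp: l_diff r_diff minus_self)
    show "?l i (?r j a) = ?r j (?l i a)"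
    proof -
      have comm: "a \<ominus> x \<ominus> (y \<ominus> z) = a \<ominus> y \<ominus> (x \<ominus> z)"
        if "x \<in> carrier R" "y \<in> carrier R" "z \<in> carrier R" for x y z
        using that a by (simp add: minus_eq minus_add minus_minus a_ac)
      show ?thesis
        using i j a sc ec[of i] ec[of j] by (auto simp: l_diff r_diff m_assoc comm)
    qed
  next
    fix a assume a: "a \<in> carrier R"
    show "(\<Oplus>i\<in>{1..4}. ?l i a) = a"
      unfolding I4 using a c sc sum_minus[of "e 1 \<otimes> a" "e 2 \<otimes> a" "e 3 \<otimes> a" a]
      by (simp add: l_distr s_def del: One_nat_def)
    show "(\<Oplus>i\<in>{1..4}. ?r i a) = a"
      unfolding I4 using a c sc sum_minus[of "a \<otimes> e 1" "a \<otimes> e 2" "a \<otimes> e 3" a]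
      by (simp add: r_distr s_def del: One_nat_def)
  next
    fix k :: nat assume k: "k \<in> {1..4}"
    show "span R {?r k a \<otimes> b | a b. a \<in> carrier R \<and> b \<in> carrier R} = carrier R"
    proof (cases "k = 4")
      case False
      then show ?thesis
        using full[of k] cases4[OF k] by simp
    next
      case True
      have "(a \<ominus> a \<otimes> s) \<otimes> b = a \<otimes> b \<ominus> (\<Oplus>i\<in>{1..3}. a \<otimes> e i \<otimes> b)"
        if "a \<in> carrier R" "b \<in> carrier R" for a b
        unfolding I4 using that c by (simp add: s_def l_diff l_distr r_distr m_assoc del: One_nat_def)
      then have "{(a \<ominus> a \<otimes> s) \<otimes> b | a b. a \<in> carrier R \<and> b \<in> carrier R} =
          {a \<otimes> b \<ominus> (\<Oplus>i\<in>{1..3}. a \<otimes> e i \<otimes> b) | a b. a \<in> carrier R \<and> b \<in> carrier R}"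
        by (intro Collect_cong) metis
      then show ?thesis
        using full4 True by simp
    qed
  next
    fix i j :: nat assume ij: "i \<in> {1..4}" "j \<in> {1..4}" "i \<noteq> j"
    show "(\<exists>x\<in>carrier R. \<forall>a\<in>carrier R. ?l i a = x \<otimes> a) \<or> (\<exists>x\<in>carrier R. \<forall>a\<in>carrier R. ?r j a = a \<otimes> x)"
    proof (cases "i = 4")
      case False
      then show ?thesis
        using ec[OF ij(1)] by (intro disjI1 bexI[of _ "e i"]) auto
    next
      case True
      then show ?thesis
        using ec[OF ij(2)] ij(3) by (intro disjI2 bexI[of _ "e j"]) auto
    qed
  next
    fix i :: nat and a b assume i: "i \<in> {1..4}" and a: "a \<in> carrier R" and b: "b \<in> carrier R"
    show "?l i (a \<oplus> b) = ?l i a \<oplus> ?l i b"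
      using i a b sc ec[OF i] by (simp add: r_distr add_minus_add)
    show "?r i (a \<oplus> b) = ?r i a \<oplus> ?r i b"
      using i a b sc ec[OF i] by (simp add: l_distr add_minus_add)
    show "?l i (a \<otimes> b) = ?l i a \<otimes> b"
      using i a b sc ec[OF i] by (simp add: l_diff m_assoc)
    show "?r i (a \<otimes> b) = a \<otimes> ?r i b"
      using i a b sc ec[OF i] by (simp add: r_diff m_assoc)
  qed (use sc ec mid in auto)
qed

section \<open>Lie isomorphisms of commutator rings\<close>

lemma commutator_ring_simps:
  "carrier (commutator_ring R) = carrier R"
  "add_monoid (commutator_ring R) = add_monoid R"
  "add (commutator_ring R) = add R"
  "zero (commutator_ring R) = zero R"
  "x \<otimes>\<^bsub>commutator_ring R\<^esub> y = bracket R x y"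
  by (simp_all add: commutator_ring_def bracket_def)

lemma derived_ring_simps:
  "carrier (derived_ring L) = span_prod L (carrier L) (carrier L)"
  "add (derived_ring L) = add L"
  "mult (derived_ring L) = mult L"
  by (simp_all add: derived_ring_def)

lemma carrier_derived_commutator_ring:
  "carrier (derived_ring (commutator_ring R)) = commutators R"
  by (simp add: derived_ring_simps commutator_ring_simps span_prod_def commutators_def span_def)

lemma (in assoc_ring) second_derived_closed:
  "carrier (derived_ring (derived_ring (commutator_ring R))) \<subseteq> carrier R"
proof -
  let ?T = "commutators R"
  have gens: "{bracket R x y | x y. x \<in> carrier R \<and> y \<in> carrier R} \<subseteq> carrier R"
    by auto
  have T: "?T \<subseteq> carrier R" "\<zero> \<in> ?T" "\<And>x. x \<in> ?T \<Longrightarrow> \<ominus> x \<in> ?T" "\<And>x y. x \<in> ?T \<Longrightarrow> y \<in> ?T \<Longrightarrow> x \<oplus> y \<in> ?T"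
    unfolding commutators_def using span_closed[OF gens] span_zero span_neg[OF gens] span_add by blast+
  let ?S = "{bracket R x y | x y. x \<in> ?T \<and> y \<in> ?T}"
  have S: "?S \<subseteq> ?T"
    unfolding commutators_def using span_base[of _ "{bracket R x y | x y. x \<in> carrier R \<and> y \<in> carrier R}"] T(1)
    unfolding commutators_def by blast
  have "carrier (derived_ring (derived_ring (commutator_ring R))) =
      span (derived_ring (commutator_ring R)) ?S"
    by (simp add: derived_ring_simps(1)[of "derived_ring (commutator_ring R)"] span_prod_eq_span
        carrier_derived_commutator_ring) (simp add: derived_ring_simps(3) commutator_ring_simps)
  also have "\<dots> = span (R\<lparr>carrier := ?T\<rparr>) ?S"
    using carrier_derived_commutator_ring[of R]
    by (simp add: span_def derived_ring_def commutator_ring_def)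
  also have "\<dots> = span R ?S"
    by (rule span_subring[OF T S])
  also have "\<dots> \<subseteq> carrier R"
    using span_closed[of ?S] S T(1) by blast
  finally show ?thesis .
qed

theorem theorem2:
  fixes A :: "'a ring" and B :: "'b ring" and e :: "nat \<Rightarrow> 'a" and \<phi> :: "'a \<Rightarrow> 'b"
    and U :: "'l ring" and u :: "'l \<Rightarrow> 'a"
    and V :: "'k ring" and v :: "'k \<Rightarrow> 'a \<times> 'a"
    and W :: "'c ring" and \<omega> :: "'c \<Rightarrow> 'a \<times> 'a"
    and \<kappa> :: "'l \<Rightarrow> 'c"
  assumes "assoc_ring A"
    and "\<And>i. i \<in> {1..3} \<Longrightarrow> e i \<in> carrier A"
    and "\<And>i. i \<in> {1..3} \<Longrightarrow> e i \<otimes>\<^bsub>A\<^esub> e i = e i"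
    and "\<And>i j. i \<in> {1..3} \<Longrightarrow> j \<in> {1..3} \<Longrightarrow> i \<noteq> j \<Longrightarrow> e i \<otimes>\<^bsub>A\<^esub> e j = \<zero>\<^bsub>A\<^esub>"
    and "\<And>i. i \<in> {1..3} \<Longrightarrow>
      generate (add_monoid A)
        {a \<otimes>\<^bsub>A\<^esub> e i \<otimes>\<^bsub>A\<^esub> b | a b. a \<in> carrier A \<and> b \<in> carrier A} = carrier A"
    and "generate (add_monoid A)
        {a \<otimes>\<^bsub>A\<^esub> b \<ominus>\<^bsub>A\<^esub> (\<Oplus>\<^bsub>A\<^esub>i\<in>{1..3}. a \<otimes>\<^bsub>A\<^esub> e i \<otimes>\<^bsub>A\<^esub> b) | a b.
          a \<in> carrier A \<and> b \<in> carrier A} = carrier A"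
    and "assoc_ring B"
    and "\<phi> \<in> rng_iso (derived_ring (commutator_ring A)) (derived_ring (commutator_ring B))"
    and "universal_central_extension U u (derived_ring (commutator_ring A))"
    and "universal_central_extension V v (derived_ring (commutator_ring (double_ring A)))"
    and "universal_annihilator_extension W \<omega> (double_ring A)"
    and "canonical_lie_hom A U u V v W \<omega> \<kappa>"
  shows "\<exists>!\<chi>. \<chi> \<in> rng_hom W B \<and> \<chi> \<in> extensional (carrier W) \<and>
    (\<forall>x\<in>carrier U. \<chi> (\<kappa> x) = \<phi> (u x))"
proof -
  interpret A: assoc_ring A
    by fact
  interpret B: assoc_ring B
    by fact
  interpret W: assoc_ring W
    using assms(11) by (simp add: universal_annihilator_extension_def annihilator_extension_def idempotent_ring_def)
  have peirce: "\<exists>l r. peirce_ring A {1..4::nat} l r"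
    using A.peirce_ring_idempotents[of e, unfolded span_def, OF assms(2-6)] by blast
  have iso: "\<phi> \<in> rng_hom (derived_ring (commutator_ring A)) (derived_ring (commutator_ring B))"
    and bij: "bij_betw \<phi> (commutators A) (commutators B)"
    using assms(8) by (auto simp: rng_iso_def carrier_derived_commutator_ring)
  have B_gens: "{bracket B x y | x y. x \<in> carrier B \<and> y \<in> carrier B} \<subseteq> carrier B"
    by auto
  have KB: "commutators B \<subseteq> carrier B"
    unfolding commutators_def using B.span_closed[OF B_gens] by blast
  have \<phi>: "\<phi> a \<in> commutators B"
    "b \<in> commutators A \<Longrightarrow> \<phi> (a \<oplus>\<^bsub>A\<^esub> b) = \<phi> a \<oplus>\<^bsub>B\<^esub> \<phi> b"
    "b \<in> commutators A \<Longrightarrow> \<phi> (bracket A a b) = bracket B (\<phi> a) (\<phi> b)" if "a \<in> commutators A" for a b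
    using rng_homD(1)[OF iso, of a] rng_homD(2)[OF iso, of a b] rng_homD(3)[OF iso, of a b] that
    by (simp_all add: carrier_derived_commutator_ring, simp_all add: derived_ring_simps(2,3) commutator_ring_simps)
  have \<phi>_ideal: "bracket B s (\<phi> a) \<in> \<phi> ` commutators A" if "s \<in> carrier B" "a \<in> commutators A" for s a
  proof -
    have "bracket B s (\<phi> a) \<in> commutators B"
      using that \<phi>(1)[OF that(2)] KB unfolding commutators_def[of B] by (intro B.span_base) blast
    then show ?thesis
      using bij by (simp add: bij_betw_def)
  qed
  have u: "central_extension U u (derived_ring (commutator_ring A))"
    using assms(9) by (simp add: universal_central_extension_def)
  then have u_hom: "u \<in> rng_hom U (derived_ring (commutator_ring A))"
    and u_sur: "u ` carrier U = commutators A"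
    and U: "nonassoc_ring U" "span_prod U (carrier U) (carrier U) = carrier U"
    by (auto simp: central_extension_def perfect_lie_ring_def lie_ring_def carrier_derived_commutator_ring)
  have u_add: "u (x \<oplus>\<^bsub>U\<^esub> y) = u x \<oplus>\<^bsub>A\<^esub> u y" and u_mult: "u (x \<otimes>\<^bsub>U\<^esub> y) = bracket A (u x) (u y)"
    if "x \<in> carrier U" "y \<in> carrier U" for x y
    using rng_homD(2,3)[OF u_hom that] by (simp_all add: derived_ring_simps(2,3) commutator_ring_simps)
  obtain \<xi> \<gamma> where \<xi>: "\<xi> \<in> rng_hom U V" "\<forall>x\<in>carrier U. v (\<xi> x) = double_embedding A (u x)"
    and \<gamma>: "\<gamma> \<in> rng_hom V (derived_ring (derived_ring (commutator_ring W)))" "\<forall>y\<in>carrier V. \<omega> (\<gamma> y) = v y"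
    and \<kappa>: "\<forall>x\<in>carrier U. \<kappa> x = \<gamma> (\<xi> x)"
    using assms(12) unfolding canonical_lie_hom_def by blast
  have hom: "(\<lambda>x. \<gamma> (\<xi> x)) \<in> rng_hom U (derived_ring (derived_ring (commutator_ring W)))"
    by (rule rng_hom_comp[OF \<xi>(1) \<gamma>(1)])
  have \<kappa>_closed: "\<kappa> x \<in> carrier W" and \<kappa>_\<omega>: "\<omega> (\<kappa> x) = (u x, \<ominus>\<^bsub>A\<^esub> u x)" if "x \<in> carrier U" for x
  proof -
    show "\<kappa> x \<in> carrier W"
      using rng_homD(1)[OF hom that] W.second_derived_closed bspec[OF \<kappa> that] by auto
    have "\<omega> (\<kappa> x) = v (\<xi> x)"
      using bspec[OF \<kappa> that] bspec[OF \<gamma>(2) rng_homD(1)[OF \<xi>(1) that]] by simp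
    then show "\<omega> (\<kappa> x) = (u x, \<ominus>\<^bsub>A\<^esub> u x)"
      using bspec[OF \<xi>(2) that] by (simp add: double_embedding_def)
  qed
  have \<kappa>_add: "\<kappa> (x \<oplus>\<^bsub>U\<^esub> y) = \<kappa> x \<oplus>\<^bsub>W\<^esub> \<kappa> y" and \<kappa>_mult: "\<kappa> (x \<otimes>\<^bsub>U\<^esub> y) = bracket W (\<kappa> x) (\<kappa> y)"
    if xy: "x \<in> carrier U" "y \<in> carrier U" for x y
  proof -
    interpret U: nonassoc_ring U
      by fact
    show "\<kappa> (x \<oplus>\<^bsub>U\<^esub> y) = \<kappa> x \<oplus>\<^bsub>W\<^esub> \<kappa> y" "\<kappa> (x \<otimes>\<^bsub>U\<^esub> y) = bracket W (\<kappa> x) (\<kappa> y)"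
      using rng_homD(2,3)[OF hom xy] bspec[OF \<kappa> xy(1)] bspec[OF \<kappa> xy(2)]
        bspec[OF \<kappa> U.a_closed[OF xy]] bspec[OF \<kappa> U.m_closed[OF xy]]
      by (simp_all add: derived_ring_simps(2,3) commutator_ring_simps)
  qed
  obtain l r where "peirce_ring A {1..4::nat} l r"
    using peirce by blast
  moreover have "lie_ideal_map_axioms A B \<phi>"
    using \<phi> KB bij \<phi>_ideal by unfold_locales (auto simp: bij_betw_def)
  ultimately interpret lie_ideal_map A "{1..4::nat}" l r B \<phi>
    by (intro lie_ideal_map.intro B.assoc_ring_axioms)
  show ?thesis
    by (rule unique_hom_extending[OF assms(11) U u_sur u_add u_mult \<kappa>_closed \<kappa>_\<omega> \<kappa>_add \<kappa>_mult])
qed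

end
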